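(* Let $N\ge 2$, let $g\in SU(N)$ and let $N_-=\frac{N(N-1)}{2}$. Use the Euler-angle parameters $\phi_1,\dots,\phi_{N_-},\psi_1,\dots,\psi_{N_-},\omega_1,\dots,\omega_{N-1}$ of almost every $g=g_{SU(N)}\in SU(N)$ and the associated elements $g_{SU(p)}\in SU(p)$, $1\le p\le N$, described in the context. Define the finite-type function $$f^{SU(2)}(g_{SU(2)}):=c\,e^{ik_{N_-}\phi_{N_-}}\sin^{m_{N_-}}(\psi_{N_-})\cos^{n_{N_-}}(\psi_{N_-})\,e^{il_1\omega_1}$$ for some $c\in\mathbb{C}$, $m_{N_-},n_{N_-}\in\mathbb{N}_0$ and $k_{N_-},l_1\in\mathbb{Z}$, and define the finite-type function $f^{SU(N)}$ recursively as $$f^{SU(N)}(g_{SU(N)})=e^{ik_1\phi_1}\sin^{m_1}(\psi_1)\cos^{n_1}(\psi_1)\cdots e^{ik_{N-1}\phi_{N-1}}\sin^{m_{N-1}}(\psi_{N-1})\cos^{n_{N-1}}(\psi_{N-1})\cdot f^{SU(N-1)}(g_{SU(N-1)})\,e^{il_{N-1}\omega_{N-1}},$$ where $k_1,\dots,k_{N-1},l_{N-1}\in\mathbb{Z}$ and $m_1,\dots,m_{N-1},n_1,\dots,n_{N-1}\in\mathbb{N}_0$ (at the intermediate stages $3\le p\le N-1$, $f^{SU(p)}(g_{SU(p)})$ is given by the same formula in the parameters of $g_{SU(p)}$, i.e. with the indices $1,\dots,N-1$ of $k,m,n,\phi,\psi$ replaced by $s_p+1,\dots,s_p+p-1$, where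 $s_p=N_--\frac{p(p-1)}{2}$, with $f^{SU(N-1)}(g_{SU(N-1)})$ replaced by $f^{SU(p-1)}(g_{SU(p-1)})$, and with last factor $e^{il_{p-1}\omega_{p-1}}$). Then $$\int_{SU(N)} f^{SU(N)}(g)\,dg= 2\pi^N c\,\delta_{k_1,0}\cdots\delta_{k_{N-1},0}\,\delta_{l_{N-1},0}\int_{SU(N-1)}f^{SU(N-1)}(g_{SU(N-1)})\, dg_{SU(N-1)}\cdot I,$$ $$I=\int_{[0,1]^{N-1}}x_1^{m_1}(1-x_1^2)^{\frac{n_1}{2}}\cdots x_{N-1}^{m_{N-1}}(1-x_{N-1}^2)^{\frac{n_{N-1}}{2}}\, \tilde{J}_{SU(N)}(x_1,\ldots,x_{N-1})\, dx_1\cdots dx_{N-1}.$$ Here $dg_{SU(N-1)}$ is the Haar measure on $SU(N-1)$, and $\tilde{J}_{SU(N)}$ is given by $$\tilde{J}_{SU(N)}(x_1,\ldots,x_{N-1})=2^{N-1}C_N \prod_{j=1}^{N-1}x_j^{2j-1},$$ where $C_N$ is some constant.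
   Context: Let $E_{ab}$ denote matrix units. For $2\le k\le N$ put $\lambda_{k^2-1}=i(E_{k-1,k-1}-E_{k,k})$ and $\lambda_{k^2-2}=E_{k-1,k}-E_{k,k-1}$ in $\mathfrak{su}(N)$, and $A(k)(x,y)=e^{\lambda_{k^2-1}x}e^{\lambda_{k^2-2}y}$. Define $F_{SU(1)}\equiv 1$ and inductively, for $N\ge 2$ and $N_-=\frac{N(N-1)}{2}$, the map $F_{SU(N)}:[0,\pi)^{N_-}\times(0,\frac{\pi}{2})^{N_-}\times[0,2\pi)^{N-1}\to SU(N)$ by $$F_{SU(N)}(\phi,\psi,\omega)=A(2)(\phi_1,\psi_1)\cdots A(N)(\phi_{N-1},\psi_{N-1})\begin{pmatrix}F_{SU(N-1)}(\phi_N,\dots,\phi_{N_-},\psi_N,\dots,\psi_{N_-},\omega_1,\dots,\omega_{N-2})&0\\0&1\end{pmatrix}e^{\lambda_{N^2-1}\omega_{N-1}}.$$ Its image is $SU(N)$ up to a measure zero set, so almost every $g\in SU(N)$ is of the form $F_{SU(N)}(\phi,\psi,\omega)$. For such $g$ set $g_{SU(1)}:=1$ and, for $2\le p\le N$, with $s_p=N_--\frac{p(p-1)}{2}$, $$g_{SU(p)}:=F_{SU(p)}(\phi_{s_p+1},\dots,\phi_{N_-},\psi_{s_p+1},\dots,\psi_{N_-},\omega_1,\dots,\omega_{p-1})\in SU(p),$$ so $g_{SU(N)}=g$. The measure $dg$ is the Haar measure on $SU(N)$. For $N=2$, the function $f^{SU(1)}$ on the right-hand side is understood as the constant function $1$.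 A function $f:G\to\mathbb{C}$ on a compact Lie group $G$ is a finite-type function if it is a finite linear combination of matrix coefficients of irreducible representations, i.e. $f(x)=\sum_{j=1}^n\mathrm{Tr}(a_j\pi_j(x))$ with $(\pi_j,V_j)$ an irreducible representation of $G$ and $a_j\in\mathrm{End}(V_j)$. $\delta_{a,b}$ is the Kronecker delta.
   Formalization: For N ≥ 3 the explicit factor c is spurious, since the integral of f^{SU(N-1)} already contains c (all exponents 0, c=1 versus c=2); so C_N is taken as K/c for N ≥ 3 and K for N = 2, with K depending only on N. *)

theory Defs
  imports "HOL-Analysis.Analysis" "Jordan_Normal_Form.Schur_Decomposition"
    "Jordan_Normal_Form.VS_Connect"
begin

definition mat_trace :: "complex mat \<Rightarrow> complex" where
  "mat_trace A = (\<Sum>i<dim_row A. A $$ (i, i))"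

text \<open>The exponential of a square matrix; the exponential series is summed entry by entry.\<close>
definition mat_exp :: "complex mat \<Rightarrow> complex mat" where
  "mat_exp A = mat (dim_row A) (dim_row A)
     (\<lambda>(i, j). \<Sum>r. (A ^\<^sub>m r) $$ (i, j) / of_nat (fact r))"

text \<open>The usual topology on complex m x n matrices, transported from the product of m * n copies
  of the complex plane.\<close>
definition mat_top :: "nat \<Rightarrow> nat \<Rightarrow> complex mat topology" where
  "mat_top m n = pullback_topology (carrier_mat m n)
     (\<lambda>A. restrict (\<lambda>ij. A $$ ij) ({..<m} \<times> {..<n}))
     (product_topology (\<lambda>_. euclidean) ({..<m} \<times> {..<n}))"

definition SU :: "nat \<Rightarrow> complex mat set" where
  "SU N = {g \<in> carrier_mat N N. g * mat_adjoint g = 1\<^sub>m N \<and> det g = 1}"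

definition SU_top :: "nat \<Rightarrow> complex mat topology" where
  "SU_top N = subtopology (mat_top N N) (SU N)"

definition borel_SU :: "nat \<Rightarrow> complex mat measure" where
  "borel_SU N = sigma (SU N) {U. openin (SU_top N) U}"

text \<open>The Haar measure is normalised to total mass 1.\<close>
definition haar_SU :: "nat \<Rightarrow> complex mat measure \<Rightarrow> bool" where
  "haar_SU N M \<longleftrightarrow> sets M = sets (borel_SU N) \<and> emeasure M (SU N) = 1 \<and>
     (\<forall>g\<in>SU N. \<forall>B\<in>sets M. emeasure M ((\<lambda>h. g * h) ` B) = emeasure M B)"

text \<open>Irreducible (continuous, finite-dimensional, complex) representations, in coordinates on the
  representation space. Invertibility of \<open>\<rho> g\<close> follows from the homomorphism laws.\<close>
definition irrep_SU :: "nat \<Rightarrow> nat \<Rightarrow> (complex mat \<Rightarrow> complex mat) \<Rightarrow> bool" where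
  "irrep_SU N d \<rho> \<longleftrightarrow> d > 0 \<and> continuous_map (SU_top N) (mat_top d d) \<rho> \<and>
     \<rho> (1\<^sub>m N) = 1\<^sub>m d \<and> (\<forall>g\<in>SU N. \<forall>h\<in>SU N. \<rho> (g * h) = \<rho> g * \<rho> h) \<and>
     (\<forall>W. VectorSpace.subspace class_ring W (module_vec TYPE(complex) d) \<and>
          (\<forall>g\<in>SU N. \<forall>v\<in>W. \<rho> g *\<^sub>v v \<in> W) \<longrightarrow> W = {0\<^sub>v d} \<or> W = carrier_vec d)"

definition finite_type_SU :: "nat \<Rightarrow> (complex mat \<Rightarrow> complex) \<Rightarrow> bool" where
  "finite_type_SU N f \<longleftrightarrow> (\<exists>(r::nat) d \<rho> a.
     (\<forall>j<r. irrep_SU N (d j) (\<rho> j) \<and> a j \<in> carrier_mat (d j) (d j)) \<and>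
     (\<forall>g\<in>SU N. f g = (\<Sum>j<r. mat_trace (a j * \<rho> j g))))"

text \<open>Matrix units, with rows and columns numbered from 1 as on paper (entries of type
  \<^typ>\<open>complex mat\<close> are numbered from 0).\<close>
definition mat_unit :: "nat \<Rightarrow> nat \<Rightarrow> nat \<Rightarrow> complex mat" where
  "mat_unit N a b = mat N N (\<lambda>(i, j). if Suc i = a \<and> Suc j = b then 1 else 0)"

text \<open>For \<open>2 \<le> k\<close>, \<open>lam_diag N k\<close> is the generator with index \<open>k\<^sup>2 - 1\<close> and \<open>lam_rot N k\<close>
  the one with index \<open>k\<^sup>2 - 2\<close>.\<close>
definition lam_diag :: "nat \<Rightarrow> nat \<Rightarrow> complex mat" where
  "lam_diag N k = \<i> \<cdot>\<^sub>m (mat_unit N (k - 1) (k - 1) - mat_unit N k k)"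

definition lam_rot :: "nat \<Rightarrow> nat \<Rightarrow> complex mat" where
  "lam_rot N k = mat_unit N (k - 1) k - mat_unit N k (k - 1)"

definition euler_A :: "nat \<Rightarrow> nat \<Rightarrow> real \<Rightarrow> real \<Rightarrow> complex mat" where
  "euler_A N k x y =
     mat_exp (complex_of_real x \<cdot>\<^sub>m lam_diag N k) * mat_exp (complex_of_real y \<cdot>\<^sub>m lam_rot N k)"

text \<open>Parameter tuples are functions on the natural numbers; only the entries with indices
  1, 2, ... up to the length of the tuple are used.\<close>
fun euler_F :: "nat \<Rightarrow> (nat \<Rightarrow> real) \<Rightarrow> (nat \<Rightarrow> real) \<Rightarrow> (nat \<Rightarrow> real) \<Rightarrow> complex mat" where
  "euler_F 0 \<phi> \<psi> \<omega> = 1\<^sub>m 0"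
| "euler_F (Suc 0) \<phi> \<psi> \<omega> = 1\<^sub>m 1"
| "euler_F (Suc (Suc r)) \<phi> \<psi> \<omega> = (let N = Suc (Suc r) in
     foldr (\<lambda>k B. euler_A N k (\<phi> (k - 1)) (\<psi> (k - 1)) * B) [2..<Suc N] (1\<^sub>m N)
     * four_block_mat (euler_F (Suc r) (\<lambda>i. \<phi> (N - 1 + i)) (\<lambda>i. \<psi> (N - 1 + i)) \<omega>)
         (0\<^sub>m (N - 1) 1) (0\<^sub>m 1 (N - 1)) (1\<^sub>m 1)
     * mat_exp (complex_of_real (\<omega> (N - 1)) \<cdot>\<^sub>m lam_diag N N))"

definition Nminus :: "nat \<Rightarrow> nat" where
  "Nminus N = N * (N - 1) div 2"

definition euler_dom :: "nat \<Rightarrow> (nat \<Rightarrow> real) \<Rightarrow> (nat \<Rightarrow> real) \<Rightarrow> (nat \<Rightarrow> real) \<Rightarrow> bool" where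
  "euler_dom N \<phi> \<psi> \<omega> \<longleftrightarrow>
     (\<forall>i\<in>{1..Nminus N}. \<phi> i \<in> {0..<pi} \<and> \<psi> i \<in> {0<..<pi/2}) \<and>
     (\<forall>i\<in>{1..N - 1}. \<omega> i \<in> {0..<2*pi})"

definition s_shift :: "nat \<Rightarrow> nat \<Rightarrow> nat" where
  "s_shift N p = Nminus N - p * (p - 1) div 2"

text \<open>The element of SU(p) attached to the element of SU(N) with the given Euler parameters.\<close>
definition euler_g ::
  "nat \<Rightarrow> nat \<Rightarrow> (nat \<Rightarrow> real) \<Rightarrow> (nat \<Rightarrow> real) \<Rightarrow> (nat \<Rightarrow> real) \<Rightarrow> complex mat" where
  "euler_g N p \<phi> \<psi> \<omega> = euler_F p (\<lambda>i. \<phi> (s_shift N p + i)) (\<lambda>i. \<psi> (s_shift N p + i)) \<omega>"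

text \<open>\<open>f p\<close> is the function on SU(p), for \<open>1 \<le> p \<le> N\<close>. The Euler parametrisation
  is injective on its domain with image of full measure, so the equations below prescribe every
  \<open>f p\<close> almost everywhere; finite-type functions being continuous, this determines \<open>f p\<close> on SU(p).
  Not every choice of exponents is compatible with the \<open>f p\<close> being of finite type (the angles
  \<open>\<phi>\<close> run over half a period only, which forces parity conditions), so this is a
  genuine hypothesis.\<close>
definition euler_family ::
  "nat \<Rightarrow> complex \<Rightarrow> (nat \<Rightarrow> int) \<Rightarrow> (nat \<Rightarrow> nat) \<Rightarrow> (nat \<Rightarrow> nat) \<Rightarrow> (nat \<Rightarrow> int)
    \<Rightarrow> (nat \<Rightarrow> complex mat \<Rightarrow> complex) \<Rightarrow> bool" where
  "euler_family N c k m n l f \<longleftrightarrow>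
     (\<forall>p\<in>{2..N}. finite_type_SU p (f p)) \<and>
     (\<forall>g\<in>SU 1. f 1 g = 1) \<and>
     (\<forall>\<phi> \<psi> \<omega>. euler_dom N \<phi> \<psi> \<omega> \<longrightarrow>
        f 2 (euler_g N 2 \<phi> \<psi> \<omega>) =
          c * exp (\<i> * of_int (k (Nminus N)) * of_real (\<phi> (Nminus N)))
            * of_real (sin (\<psi> (Nminus N)) ^ m (Nminus N) * cos (\<psi> (Nminus N)) ^ n (Nminus N))
            * exp (\<i> * of_int (l 1) * of_real (\<omega> 1)) \<and>
        (\<forall>p\<in>{3..N}.
           f p (euler_g N p \<phi> \<psi> \<omega>) =
             (\<Prod>j\<in>{s_shift N p + 1..s_shift N p + (p - 1)}.
                exp (\<i> * of_int (k j) * of_real (\<phi> j))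
                * of_real (sin (\<psi> j) ^ m j * cos (\<psi> j) ^ n j))
             * f (p - 1) (euler_g N (p - 1) \<phi> \<psi> \<omega>)
             * exp (\<i> * of_int (l (p - 1)) * of_real (\<omega> (p - 1)))))"

definition J_tilde :: "nat \<Rightarrow> complex \<Rightarrow> (nat \<Rightarrow> real) \<Rightarrow> complex" where
  "J_tilde N C x = 2 ^ (N - 1) * C * of_real (\<Prod>j\<in>{1..N - 1}. x j ^ (2 * j - 1))"

text \<open>\<open>(1 - x\<^sup>2) powr (n / 2)\<close> differs from the convention \<open>0\<^sup>0 = 1\<close> only for
  \<open>n = 0\<close>, \<open>x = 1\<close>, hence on a null set.\<close>
definition I_int :: "nat \<Rightarrow> complex \<Rightarrow> (nat \<Rightarrow> nat) \<Rightarrow> (nat \<Rightarrow> nat) \<Rightarrow> complex" where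
  "I_int N C m n =
     (LINT x : (\<Pi>\<^sub>E j\<in>{1..N - 1}. {0..1}) | (\<Pi>\<^sub>M j\<in>{1..N - 1}. (lborel :: real measure)).
        of_real (\<Prod>j\<in>{1..N - 1}. x j ^ m j * (1 - (x j)\<^sup>2) powr (real (n j) / 2)) * J_tilde N C x)"

text \<open>The value of the constant in \<^const>\<open>J_tilde\<close>. The right-hand side of the formula carries an
  explicit factor \<open>c\<close>, although for \<open>N \<ge> 3\<close> the integral of \<open>f (N - 1)\<close> already
  contains \<open>c\<close>. The left-hand side being linear in \<open>c\<close>, the constant has to compensate for
  this: it is a number \<open>K\<close> depending on \<open>N\<close> only if \<open>N = 2\<close>, and \<open>K / c\<close> otherwise
  (for \<open>c = 0\<close> both sides vanish, whatever the constant).\<close>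
definition C_const :: "nat \<Rightarrow> complex \<Rightarrow> complex \<Rightarrow> complex" where
  "C_const N K c = (if N = 2 then K else K / c)"

end

theory Submission
  imports Defs "HOL-Probability.Probability" "HOL-Real_Asymp.Real_Asymp"
begin

text \<open>Write \<open>g = B diag(g', 1) e\<^bsup>\<lambda>\<omega>\<^esup>\<close> with \<open>B\<close> the product of the factors \<open>A(2), \<dots>, A(N)\<close> and
  \<open>g'\<close> in \<open>SU(N - 1)\<close>. The last column of \<open>g\<close> determines \<open>\<phi>\<^sub>j, \<psi>\<^sub>j\<close> (\<open>j < N\<close>) and \<open>\<omega>\<^sub>N\<^sub>-\<^sub>1\<close>,
  so by bi-invariance of the Haar measure averaging \<open>f\<close> over \<open>g diag(h, 1)\<close> splits off the
  integral over \<open>SU(N - 1)\<close> and leaves a function of the last column \<open>z\<close>. No Jacobian is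
  computed: a nontrivial phase makes this function a character under a
  measure preserving torus action, so its integral vanishes, and otherwise it depends only on
  \<open>sin\<^sup>2 \<psi>\<^sub>j = r\<^sub>j / r\<^sub>j\<^sub>+\<^sub>1\<close> with \<open>r\<^sub>j = |z\<^sub>1|\<^sup>2 + \<dots> + |z\<^sub>j|\<^sup>2\<close>. Invariance under rotations of two
  coordinates yields a recursion for the moments of these quotients, which shows that they are
  independent with density \<open>j s\<^bsup>j-1\<^esup>\<close> on \<open>[0, 1]\<close>. The parametrisation formula for \<open>f\<close> holds for
  all \<open>g'\<close> because \<open>f\<close> is continuous and the Euler parametrisation has dense image.\<close>

section \<open>The special unitary group and its Haar measure\<close>

text \<open>Several obstacles shape the proof. \<open>haar_SU\<close> provides left invariance only;
  invariance under adjoints and right translations is derived from it. The factor exp(w lambda)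
  stands to the right of diag(g', 1) and in general does not commute with diag(h, 1); moving it past
  costs a conjugation of h by a diagonal element of SU(N - 1), which the invariant mean absorbs.
  Euler angles of the last column are available only where none of its coordinates vanishes. That
  this holds almost everywhere comes from the moment recursion at the top index, where r_N = 1 and
  no null set has to be excluded beforehand. The angles phi cover half a period, so orthogonality of
  the e^(ik phi) fails for odd k; the phase is followed along a torus orbit instead. The constant: s
  = x^2 turns the density j s^(j-1) into 2 j x^(2j-1). The product over j < N is 2^(N-1) (N-1)!
  times the monomials in \<open>J_tilde\<close>, and dividing by the prefactor 2 pi^N leaves K =
  (N-1)! / (2 pi^N).\<close>

lemma mat_trace_carrier: "A \<in> carrier_mat d d \<Longrightarrow> mat_trace A = (\<Sum>i<d. A $$ (i, i))"
  by (auto simp: mat_trace_def)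

text \<open>The pullback topology is initial for the coordinate map into a product. From here on
  continuity is always tested on entries.\<close>

lemma continuous_map_into_mat_top:
  "continuous_map X (mat_top m n) F \<longleftrightarrow>
     F \<in> topspace X \<rightarrow> carrier_mat m n \<and>
     (\<forall>i<m. \<forall>j<n. continuous_map X euclidean (\<lambda>x. F x $$ (i, j)))" (is "?L \<longleftrightarrow> ?R")
proof
  define r where "r = (\<lambda>A :: complex mat. restrict (\<lambda>ij. A $$ ij) ({..<m} \<times> {..<n}))"
  define T where "T = product_topology (\<lambda>_. euclidean :: complex topology) ({..<m} \<times> {..<n})"
  have top: "mat_top m n = pullback_topology (carrier_mat m n) r T"
    by (simp add: mat_top_def r_def T_def)
  {
    assume L: ?L
    have "continuous_map (mat_top m n) T (id \<circ> r)"
      unfolding top by (rule continuous_map_pullback[OF continuous_map_id])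
    then have c: "continuous_map X T (r \<circ> F)"
      using continuous_map_compose[OF L] by (simp only: id_comp)
    have "F \<in> topspace X \<rightarrow> topspace (mat_top m n)"
      using L by (simp add: continuous_map_def)
    then have F: "F \<in> topspace X \<rightarrow> carrier_mat m n"
      by (auto simp: top topspace_pullback_topology)
    moreover have "continuous_map X euclidean (\<lambda>x. F x $$ (i, j))" if "i < m" "j < n" for i j
    proof -
      have "continuous_map X euclidean (\<lambda>x. (r \<circ> F) x (i, j))"
        using c that unfolding T_def continuous_map_componentwise by auto
      then show ?thesis using that by (simp add: r_def)
    qed
    ultimately show ?R by blast
  next
    assume R: ?R
    have "continuous_map X T (r \<circ> F)"
      unfolding T_def continuous_map_componentwise using R by (auto simp: r_def)
    moreover have "topspace X \<subseteq> F -` carrier_mat m n" using R by auto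
    ultimately show ?L
      unfolding top by (intro continuous_map_pullback') auto
  }
qed

lemma topspace_mat_top [simp]: "topspace (mat_top m n) = carrier_mat m n"
  by (auto simp: mat_top_def topspace_pullback_topology)

lemma SU_subset_carrier: "SU N \<subseteq> carrier_mat N N"
  by (auto simp: SU_def)

lemma SU_carrier: "g \<in> SU N \<Longrightarrow> g \<in> carrier_mat N N"
  by (auto simp: SU_def)

lemma SU_dim: "g \<in> SU N \<Longrightarrow> dim_row g = N" "g \<in> SU N \<Longrightarrow> dim_col g = N"
  by (auto simp: SU_def)

lemma topspace_SU_top [simp]: "topspace (SU_top N) = SU N"
  using SU_subset_carrier by (auto simp: SU_top_def)

lemma continuous_map_into_SU_top:
  "continuous_map X (SU_top N) F \<longleftrightarrow>
     F \<in> topspace X \<rightarrow> SU N \<and> (\<forall>i<N. \<forall>j<N. continuous_map X euclidean (\<lambda>x. F x $$ (i, j)))"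
  unfolding SU_top_def continuous_map_in_subtopology continuous_map_into_mat_top
  using SU_subset_carrier by blast

lemma continuous_map_SU_entry:
  "i < N \<Longrightarrow> j < N \<Longrightarrow> continuous_map (SU_top N) euclidean (\<lambda>g. g $$ (i, j))"
  using continuous_map_into_SU_top[of "SU_top N" N "\<lambda>x. x"] by simp

lemma continuous_map_SU_into:
  assumes "\<And>x. x \<in> topspace X \<Longrightarrow> F x \<in> SU N"
    and "\<And>i j. i < N \<Longrightarrow> j < N \<Longrightarrow> continuous_map X euclidean (\<lambda>x. F x $$ (i, j))"
  shows "continuous_map X (SU_top N) F"
  using assms by (auto simp: continuous_map_into_SU_top)

text \<open>Describes the generators of \<open>borel_SU\<close> as traces of open sets of a product,
  the form in which measurability can be tested on them.\<close>

lemma openin_SU_top_iff: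
  "openin (SU_top N) U \<longleftrightarrow>
     (\<exists>V. openin (product_topology (\<lambda>_. euclidean) ({..<N} \<times> {..<N})) V \<and>
        U = {g \<in> SU N. restrict (\<lambda>ij. g $$ ij) ({..<N} \<times> {..<N}) \<in> V})"
proof -
  define r where "r = (\<lambda>A :: complex mat. restrict (\<lambda>ij. A $$ ij) ({..<N} \<times> {..<N}))"
  have "(r -` V \<inter> carrier_mat N N) \<inter> SU N = {g \<in> SU N. r g \<in> V}" for V
    using SU_subset_carrier[of N] by blast
  note eq = this
  have "openin (SU_top N) U \<longleftrightarrow>
     (\<exists>V. openin (product_topology (\<lambda>_. euclidean) ({..<N} \<times> {..<N})) V \<and> U = {g \<in> SU N. r g \<in> V})"
    unfolding SU_top_def mat_top_def openin_subtopology openin_pullback_topology r_def[symmetric]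
  proof (intro iffI; elim exE conjE)
    fix T V assume "openin (product_topology (\<lambda>_. euclidean) ({..<N} \<times> {..<N})) V"
      "U = T \<inter> SU N" "T = r -` V \<inter> carrier_mat N N"
    then show "\<exists>V. openin (product_topology (\<lambda>_. euclidean) ({..<N} \<times> {..<N})) V \<and> U = {g \<in> SU N. r g \<in> V}"
      using eq[of V] by (intro exI[of _ V]) simp
  next
    fix V assume V: "openin (product_topology (\<lambda>_. euclidean) ({..<N} \<times> {..<N})) V"
      "U = {g \<in> SU N. r g \<in> V}"
    show "\<exists>T. (\<exists>V. openin (product_topology (\<lambda>_. euclidean) ({..<N} \<times> {..<N})) V \<and> T = r -` V \<inter> carrier_mat N N) \<and> U = T \<inter> SU N"
      using V(1) eq[of V] V(2)
      by (intro exI[of _ "r -` V \<inter> carrier_mat N N"] conjI exI[of _ V]) simp_all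
  qed
  then show ?thesis by (simp add: r_def)
qed

lemma space_borel_SU [simp]: "space (borel_SU N) = SU N"
  unfolding borel_SU_def using openin_subset[of "SU_top N"] by (intro space_measure_of) auto

lemma sets_borel_SU: "sets (borel_SU N) = sigma_sets (SU N) {U. openin (SU_top N) U}"
  unfolding borel_SU_def using openin_subset[of "SU_top N"] by (intro sets_measure_of) auto

lemma openin_SU_top_sets: "openin (SU_top N) U \<Longrightarrow> U \<in> sets (borel_SU N)"
  by (simp add: sets_borel_SU sigma_sets.Basic)

lemma continuous_map_SU_measurable:
  fixes f :: "complex mat \<Rightarrow> 'b :: topological_space"
  assumes "continuous_map (SU_top N) euclidean f"
  shows "f \<in> borel_measurable (borel_SU N)"
proof (rule borel_measurableI)
  fix S :: "'b set" assume "open S"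
  then have "openin (SU_top N) {x \<in> SU N. f x \<in> S}"
    using assms by (auto simp: continuous_map_def)
  moreover have "f -` S \<inter> space (borel_SU N) = {x \<in> SU N. f x \<in> S}" by auto
  ultimately show "f -` S \<inter> space (borel_SU N) \<in> sets (borel_SU N)"
    by (simp add: openin_SU_top_sets)
qed

lemma measurable_SU_entry [measurable]:
  "i < N \<Longrightarrow> j < N \<Longrightarrow> (\<lambda>g. g $$ (i, j)) \<in> borel_measurable (borel_SU N)"
  by (intro continuous_map_SU_measurable continuous_map_SU_entry)

text \<open>An open set is the preimage of an open set of entry tuples, and on a countable product
  the Borel sets are generated by the coordinates. Hence measurable entries suffice, which makes
  joint measurability in several variables easy.\<close>

lemma measurable_into_borel_SU:
  assumes F: "\<And>x. x \<in> space L \<Longrightarrow> F x \<in> SU N"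
    and m: "\<And>i j. i < N \<Longrightarrow> j < N \<Longrightarrow> (\<lambda>x. F x $$ (i, j)) \<in> borel_measurable L"
  shows "F \<in> measurable L (borel_SU N)"
proof -
  define I where "I = {..<N} \<times> {..<N}"
  \<comment> \<open>The entries are padded by 0 to a function on all of nat x nat, because
    \<open>sets_PiM_equal_borel\<close> concerns the full function space over a countable index
    type.\<close>
  define e where "e = (\<lambda>x ij. if ij \<in> I then F x $$ ij else 0)"
  have "e \<in> measurable L (PiM UNIV (\<lambda>_. borel))"
  proof (rule measurable_PiM_single')
    fix ij :: "nat \<times> nat"
    show "(\<lambda>x. e x ij) \<in> borel_measurable L"
      using m by (cases ij; cases "ij \<in> I") (auto simp: e_def I_def)
  qed auto
  then have e: "e \<in> borel_measurable L"
    using sets_PiM_equal_borel measurable_cong_sets by blast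
  show ?thesis
  proof (rule measurable_sigma_sets)
    show "{U. openin (SU_top N) U} \<subseteq> Pow (SU N)" using openin_subset[of "SU_top N"] by auto
    show "F \<in> space L \<rightarrow> SU N" using F by auto
    show "sets (borel_SU N) = sigma_sets (SU N) {U. openin (SU_top N) U}"
      by (rule sets_borel_SU)
    fix U assume "U \<in> {U. openin (SU_top N) U}"
    then obtain V where V: "openin (product_topology (\<lambda>_. euclidean) I) V"
      and U: "U = {g \<in> SU N. restrict (\<lambda>ij. g $$ ij) I \<in> V}"
      unfolding openin_SU_top_iff I_def by auto
    \<comment> \<open>Restriction to the finite index set is continuous, so the condition on the
      restricted tuple defines an open set of full tuples.\<close>
    have c: "continuous_map euclidean (product_topology (\<lambda>_. euclidean) I)
        (\<lambda>y :: nat \<times> nat \<Rightarrow> complex. restrict y I)"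
      by (auto simp: continuous_map_componentwise intro: continuous_on_product_coordinates)
    have "open {y :: nat \<times> nat \<Rightarrow> complex. restrict y I \<in> V}"
      using c V unfolding continuous_map_def by auto
    then have "e -` {y. restrict y I \<in> V} \<inter> space L \<in> sets L"
      by (intro measurable_sets[OF e]) auto
    also have "e -` {y. restrict y I \<in> V} \<inter> space L = F -` U \<inter> space L"
    proof -
      have "restrict (e x) I = restrict (\<lambda>ij. F x $$ ij) I" for x by (auto simp: e_def)
      then show ?thesis using F by (auto simp: U)
    qed
    finally show "F -` U \<inter> space L \<in> sets L" .
  qed
qed

section \<open>Adjoints and the group laws\<close>

lemma mat_adjoint_dim [simp]:
  "dim_row (mat_adjoint A) = dim_col A" "dim_col (mat_adjoint A) = dim_row A"
  by (auto simp: mat_adjoint_def)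

lemma mat_adjoint_carrier [simp]: "A \<in> carrier_mat n m \<Longrightarrow> mat_adjoint A \<in> carrier_mat m n"
  by auto

lemma mat_adjoint_index [simp]:
  "i < dim_col A \<Longrightarrow> j < dim_row A \<Longrightarrow> mat_adjoint A $$ (i, j) = cnj (A $$ (j, i))"
  for A :: "complex mat"
  by (simp add: mat_adjoint_def mat_of_rows_index)

lemma index_mult_sum:
  assumes "A \<in> carrier_mat n m" "B \<in> carrier_mat m l" "i < n" "j < l"
  shows "(A * B) $$ (i, j) = (\<Sum>k<m. A $$ (i, k) * B $$ (k, j))"
  using assms by (auto simp: scalar_prod_def atLeast0LessThan)

lemma mat_adjoint_mult:
  fixes A B :: "complex mat"
  assumes A: "A \<in> carrier_mat n m" and B: "B \<in> carrier_mat m l"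
  shows "mat_adjoint (A * B) = mat_adjoint B * mat_adjoint A"
proof (rule eq_matI)
  fix i j assume "i < dim_row (mat_adjoint B * mat_adjoint A)"
    and "j < dim_col (mat_adjoint B * mat_adjoint A)"
  then have ij: "i < l" "j < n" using A B by auto
  have "(mat_adjoint B * mat_adjoint A) $$ (i, j)
      = (\<Sum>k<m. mat_adjoint B $$ (i, k) * mat_adjoint A $$ (k, j))"
    by (rule index_mult_sum) (use A B ij in auto)
  also have "\<dots> = cnj ((A * B) $$ (j, i))"
    unfolding index_mult_sum[OF A B ij(2,1)] using A B ij
    by (simp add: mult.commute)
  finally show "mat_adjoint (A * B) $$ (i, j) = (mat_adjoint B * mat_adjoint A) $$ (i, j)"
    using A B ij by simp
qed (use A B in auto)

lemma mat_adjoint_adjoint [simp]: "mat_adjoint (mat_adjoint A) = A" for A :: "complex mat"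
  by (rule eq_matI) auto

lemma SU_one [simp]: "1\<^sub>m N \<in> SU N"
proof -
  have "mat_adjoint (1\<^sub>m N) = (1\<^sub>m N :: complex mat)" by (rule eq_matI) auto
  then show ?thesis by (simp add: SU_def)
qed

lemma SU_mult:
  assumes "g \<in> SU N" "h \<in> SU N"
  shows "g * h \<in> SU N"
proof -
  have gc: "g \<in> carrier_mat N N" and hc: "h \<in> carrier_mat N N" using assms by (auto simp: SU_def)
  have "(g * h) * mat_adjoint (g * h) = g * (h * mat_adjoint h) * mat_adjoint g"
  proof -
    have ac: "mat_adjoint g \<in> carrier_mat N N" "mat_adjoint h \<in> carrier_mat N N"
      using gc hc by auto
    have "g * h * (mat_adjoint h * mat_adjoint g) = g * (h * (mat_adjoint h * mat_adjoint g))"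
      by (rule assoc_mult_mat[OF gc hc mult_carrier_mat[OF ac(2,1)]])
    also have "h * (mat_adjoint h * mat_adjoint g) = h * mat_adjoint h * mat_adjoint g"
      by (rule assoc_mult_mat[OF hc ac(2,1), symmetric])
    also have "g * (h * mat_adjoint h * mat_adjoint g) = g * (h * mat_adjoint h) * mat_adjoint g"
      by (rule assoc_mult_mat[OF gc mult_carrier_mat[OF hc ac(2)] ac(1), symmetric])
    finally show ?thesis by (simp only: mat_adjoint_mult[OF gc hc])
  qed
  also have "\<dots> = 1\<^sub>m N" using assms gc by (simp add: SU_def)
  finally show ?thesis using assms gc hc by (simp add: SU_def det_mult)
qed

text \<open>A right inverse of a square matrix is also a left inverse, so columns are orthonormal as
  well as rows.\<close>

lemma SU_adjoint:
  assumes "g \<in> SU N"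
  shows "mat_adjoint g \<in> SU N" "mat_adjoint g * g = 1\<^sub>m N" "g * mat_adjoint g = 1\<^sub>m N"
proof -
  have gc: "g \<in> carrier_mat N N" using assms by (auto simp: SU_def)
  show r: "g * mat_adjoint g = 1\<^sub>m N" using assms by (simp add: SU_def)
  show l: "mat_adjoint g * g = 1\<^sub>m N"
    using mat_mult_left_right_inverse[OF gc _ r] gc by simp
  have "det (mat_adjoint g) = 1"
    using arg_cong[OF l, of det] assms gc by (simp add: det_mult[of _ N] SU_def)
  then show "mat_adjoint g \<in> SU N" using gc l by (simp add: SU_def)
qed

lemma SU_cancel:
  assumes "g \<in> SU N" "A \<in> carrier_mat N m"
  shows "mat_adjoint g * (g * A) = A" "g * (mat_adjoint g * A) = A"
proof -
  have gc: "g \<in> carrier_mat N N" using assms by (auto simp: SU_def)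
  show "mat_adjoint g * (g * A) = A"
    using assoc_mult_mat[of "mat_adjoint g" N N g N A m] gc assms SU_adjoint(2)[OF assms(1)] by simp
  show "g * (mat_adjoint g * A) = A"
    using assoc_mult_mat[of g N N "mat_adjoint g" N A m] gc assms SU_adjoint(3)[OF assms(1)] by simp
qed

lemma SU_mult_assoc:
  "a \<in> SU N \<Longrightarrow> b \<in> SU N \<Longrightarrow> c \<in> SU N \<Longrightarrow> a * b * c = a * (b * c)"
  by (rule assoc_mult_mat) (auto intro: SU_carrier)

lemma SU_col_norm:
  assumes "g \<in> SU N" "j < N"
  shows "(\<Sum>i<N. (cmod (g $$ (i, j)))\<^sup>2) = 1"
proof -
  have gc: "g \<in> carrier_mat N N" using assms by (auto simp: SU_def)
  have "1 = (mat_adjoint g * g) $$ (j, j)" using SU_adjoint(2)[OF assms(1)] assms by simp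
  also have "\<dots> = (\<Sum>i<N. mat_adjoint g $$ (j, i) * g $$ (i, j))"
    by (rule index_mult_sum) (use gc assms in auto)
  also have "\<dots> = (\<Sum>i<N. of_real ((cmod (g $$ (i, j)))\<^sup>2))"
    using gc assms by (intro sum.cong refl) (simp add: complex_norm_square mult.commute del: of_real_power)
  also have "\<dots> = of_real (\<Sum>i<N. (cmod (g $$ (i, j)))\<^sup>2)" by simp
  finally show ?thesis by (metis of_real_eq_1_iff)
qed

text \<open>Stated for two measurable functions on an arbitrary space, so that on a product space it
  yields the joint measurability that Fubini requires. It holds because the entries of a product are
  polynomials in the entries of the factors.\<close>

lemma measurable_SU_mult [measurable (raw)]:
  assumes F: "F \<in> measurable L (borel_SU N)" and G: "G \<in> measurable L (borel_SU N)"
  shows "(\<lambda>x. F x * G x) \<in> measurable L (borel_SU N)"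
proof (rule measurable_into_borel_SU)
  have FS: "F x \<in> SU N" "G x \<in> SU N" if "x \<in> space L" for x
    using measurable_space[OF F that] measurable_space[OF G that] by auto
  then show "F x * G x \<in> SU N" if "x \<in> space L" for x
    using that by (simp add: SU_mult)
  fix i j assume ij: "i < N" "j < N"
  have "(\<lambda>x. \<Sum>k<N. F x $$ (i, k) * G x $$ (k, j)) \<in> borel_measurable L"
    using ij measurable_compose[OF F measurable_SU_entry] measurable_compose[OF G measurable_SU_entry]
    by (intro borel_measurable_sum borel_measurable_times) auto
  also have "?this \<longleftrightarrow> (\<lambda>x. (F x * G x) $$ (i, j)) \<in> borel_measurable L"
    using ij FS by (intro measurable_cong) (auto simp: index_mult_sum[of _ N N _ N] SU_carrier)
  finally show "(\<lambda>x. (F x * G x) $$ (i, j)) \<in> borel_measurable L" .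
qed

lemma measurable_SU_adjoint [measurable (raw)]:
  assumes F: "F \<in> measurable L (borel_SU N)"
  shows "(\<lambda>x. mat_adjoint (F x)) \<in> measurable L (borel_SU N)"
proof (rule measurable_into_borel_SU)
  have FS: "F x \<in> SU N" if "x \<in> space L" for x
    using measurable_space[OF F that] by auto
  then show "mat_adjoint (F x) \<in> SU N" if "x \<in> space L" for x
    using that by (simp add: SU_adjoint)
  fix i j assume ij: "i < N" "j < N"
  have "(\<lambda>x. cnj (F x $$ (j, i))) \<in> borel_measurable L"
    using ij measurable_compose[OF measurable_compose[OF F measurable_SU_entry[of j N i]]
        borel_measurable_continuous_onI[of cnj]] by (simp add: continuous_on_cnj)
  also have "?this \<longleftrightarrow> (\<lambda>x. mat_adjoint (F x) $$ (i, j)) \<in> borel_measurable L"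
    using ij by (intro measurable_cong) (simp add: SU_dim[OF FS])
  finally show "(\<lambda>x. mat_adjoint (F x) $$ (i, j)) \<in> borel_measurable L" .
qed

section \<open>Translation invariance of the Haar measure\<close>

locale haar =
  fixes N :: nat and M :: "complex mat measure"
  assumes haar: "haar_SU N M"
begin

lemma sets_haar [measurable_cong]: "sets M = sets (borel_SU N)"
  using haar by (simp add: haar_SU_def)

lemma space_haar [simp]: "space M = SU N"
  using sets_eq_imp_space_eq[OF sets_haar] by simp

sublocale prob_space M
  by standard (use haar in \<open>simp add: haar_SU_def\<close>)

lemma emeasure_SU [simp]: "emeasure M (SU N) = 1"
  using haar by (simp add: haar_SU_def)

lemma measurable_haar: "measurable M L = measurable (borel_SU N) L"
  by (rule measurable_cong_sets[OF sets_haar refl])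

lemma measurable_left: "g \<in> SU N \<Longrightarrow> (\<lambda>h. g * h) \<in> measurable M M"
  unfolding measurable_cong_sets[OF sets_haar sets_haar] by (rule measurable_SU_mult) auto

lemma measurable_right: "g \<in> SU N \<Longrightarrow> (\<lambda>h. h * g) \<in> measurable M M"
  unfolding measurable_cong_sets[OF sets_haar sets_haar] by (rule measurable_SU_mult) auto

text \<open>\<open>haar_SU\<close> speaks of images of sets, a push-forward of preimages; the
  preimage under g is the image under the adjoint of g.\<close>

lemma distr_left:
  assumes g: "g \<in> SU N"
  shows "distr M M (\<lambda>h. g * h) = M"
proof (rule measure_eqI)
  have m: "(\<lambda>h. g * h) \<in> measurable M M"
    using g by (rule measurable_left)
  fix B assume "B \<in> sets (distr M M (\<lambda>h. g * h))"
  then have B: "B \<in> sets M" by simp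
  then have BS: "B \<subseteq> SU N" using sets.sets_into_space by fastforce
  have "(\<lambda>h. g * h) -` B \<inter> SU N = (\<lambda>h. mat_adjoint g * h) ` B"
  proof (intro equalityI subsetI)
    fix x assume x: "x \<in> (\<lambda>h. g * h) -` B \<inter> SU N"
    then have "x = mat_adjoint g * (g * x)" using SU_cancel(1)[OF g SU_carrier[of x]] by simp
    then show "x \<in> (\<lambda>h. mat_adjoint g * h) ` B" using x by blast
  next
    fix x assume "x \<in> (\<lambda>h. mat_adjoint g * h) ` B"
    then obtain y where y: "y \<in> B" "x = mat_adjoint g * y" by auto
    then show "x \<in> (\<lambda>h. g * h) -` B \<inter> SU N"
      using SU_cancel(2)[OF g SU_carrier[of y]] SU_mult[OF SU_adjoint(1)[OF g]] BS by auto
  qed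
  moreover have "emeasure M ((\<lambda>h. mat_adjoint g * h) ` B) = emeasure M B"
    using haar SU_adjoint(1)[OF g] B by (auto simp: haar_SU_def)
  ultimately show "emeasure (distr M M (\<lambda>h. g * h)) B = emeasure M B"
    by (simp add: emeasure_distr[OF m B])
qed simp

lemma nn_integral_left:
  assumes [measurable]: "f \<in> borel_measurable M" and "g \<in> SU N"
  shows "(\<integral>\<^sup>+ h. f (g * h) \<partial>M) = (\<integral>\<^sup>+ h. f h \<partial>M)"
proof -
  have m: "(\<lambda>h. g * h) \<in> measurable M M"
    using assms(2) by (rule measurable_left)
  have "(\<integral>\<^sup>+ h. f h \<partial>distr M M (\<lambda>h. g * h)) = (\<integral>\<^sup>+ h. f (g * h) \<partial>M)"
    by (rule nn_integral_distr[OF m]) simp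
  then show ?thesis using distr_left[OF assms(2)] by simp
qed

text \<open>Integrate \<open>f (h\<^sup>* g)\<close> over both variables: invariance in \<open>g\<close> gives one side,
  exchanging the integrals and replacing \<open>h\<close> by \<open>g h\<close> the other.\<close>
lemma nn_integral_adjoint:
  assumes f: "f \<in> borel_measurable M"
  shows "(\<integral>\<^sup>+ h. f (mat_adjoint h) \<partial>M) = (\<integral>\<^sup>+ h. f h \<partial>M)"
proof -
  interpret P: pair_sigma_finite M M ..
  have f': "f \<in> borel_measurable (borel_SU N)"
    using f by (simp add: measurable_cong_sets[OF sets_haar refl])
  have [measurable]: "(\<lambda>p. f (mat_adjoint (fst p) * snd p)) \<in> borel_measurable (M \<Otimes>\<^sub>M M)"
    by (rule measurable_compose[OF _ f']) measurable
  have fa: "(\<lambda>h. f (mat_adjoint h)) \<in> borel_measurable M"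
    by (rule measurable_compose[OF _ f']) measurable
  have "(\<integral>\<^sup>+ h. f h \<partial>M) = (\<integral>\<^sup>+ h. (\<integral>\<^sup>+ g. f (mat_adjoint h * g) \<partial>M) \<partial>M)"
    by (simp add: nn_integral_left[OF f SU_adjoint(1)] emeasure_space_1 space_haar[symmetric]
        del: space_haar cong: nn_integral_cong_simp)
  also have "\<dots> = (\<integral>\<^sup>+ g. (\<integral>\<^sup>+ h. f (mat_adjoint h * g) \<partial>M) \<partial>M)"
    by (subst P.Fubini') (simp_all add: split_beta')
  also have "\<dots> = (\<integral>\<^sup>+ g. (\<integral>\<^sup>+ h. f (mat_adjoint h) \<partial>M) \<partial>M)"
  proof (rule nn_integral_cong)
    fix g assume "g \<in> space M"
    then have g: "g \<in> SU N" by simp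
    have "(\<integral>\<^sup>+ h. f (mat_adjoint h * g) \<partial>M) = (\<integral>\<^sup>+ h. f (mat_adjoint (g * h) * g) \<partial>M)"
      by (rule nn_integral_left[symmetric, OF _ g])
        (rule measurable_compose[OF _ f'], rule measurable_SU_mult, use g in \<open>auto simp: measurable_haar intro: measurable_SU_adjoint\<close>)
    also have "\<dots> = (\<integral>\<^sup>+ h. f (mat_adjoint h) \<partial>M)"
    proof (rule nn_integral_cong)
      fix h assume "h \<in> space M"
      then have h: "h \<in> SU N" by simp
      have "mat_adjoint (g * h) * g = mat_adjoint h"
        using mat_adjoint_mult[of g N N h N] SU_carrier[OF g] SU_carrier[OF h] g h
          SU_mult_assoc[of "mat_adjoint h" N "mat_adjoint g" g] SU_adjoint
        by simp
      then show "f (mat_adjoint (g * h) * g) = f (mat_adjoint h)" by simp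
    qed
    finally show "(\<integral>\<^sup>+ h. f (mat_adjoint h * g) \<partial>M) = (\<integral>\<^sup>+ h. f (mat_adjoint h) \<partial>M)" .
  qed
  also have "\<dots> = (\<integral>\<^sup>+ h. f (mat_adjoint h) \<partial>M)" by (simp add: emeasure_space_1)
  finally show ?thesis by simp
qed

text \<open>Taking adjoints exchanges right and left translations, and by
  \<open>nn_integral_adjoint\<close> it preserves the integral.\<close>

lemma nn_integral_right:
  assumes f: "f \<in> borel_measurable M" and k: "k \<in> SU N"
  shows "(\<integral>\<^sup>+ h. f (h * k) \<partial>M) = (\<integral>\<^sup>+ h. f h \<partial>M)"
proof -
  have f': "f \<in> borel_measurable (borel_SU N)"
    using f by (simp add: measurable_cong_sets[OF sets_haar refl])
  have m1: "(\<lambda>h. f (h * k)) \<in> borel_measurable M"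
    by (rule measurable_compose[OF _ f'], rule measurable_SU_mult)
      (use k in \<open>auto simp: measurable_haar\<close>)
  have m2: "(\<lambda>h. f (mat_adjoint h)) \<in> borel_measurable M"
    by (rule measurable_compose[OF _ f']) measurable
  have "(\<integral>\<^sup>+ h. f (h * k) \<partial>M) = (\<integral>\<^sup>+ h. f (mat_adjoint h * k) \<partial>M)"
    using nn_integral_adjoint[OF m1] by simp
  also have "\<dots> = (\<integral>\<^sup>+ h. f (mat_adjoint (mat_adjoint k * h)) \<partial>M)"
  proof (rule nn_integral_cong)
    fix h assume "h \<in> space M"
    then have h: "h \<in> SU N" by simp
    have "mat_adjoint (mat_adjoint k * h) = mat_adjoint h * k"
      using mat_adjoint_mult[of "mat_adjoint k" N N h N] SU_carrier[OF k] SU_carrier[OF h] by simp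
    then show "f (mat_adjoint h * k) = f (mat_adjoint (mat_adjoint k * h))" by simp
  qed
  also have "\<dots> = (\<integral>\<^sup>+ h. f (mat_adjoint h) \<partial>M)"
    using nn_integral_left[OF m2 SU_adjoint(1)[OF k]] .
  also have "\<dots> = (\<integral>\<^sup>+ h. f h \<partial>M)" by (rule nn_integral_adjoint[OF f])
  finally show ?thesis .
qed

lemma distr_right:
  assumes k: "k \<in> SU N"
  shows "distr M M (\<lambda>h. h * k) = M"
proof (rule measure_eqI)
  have m: "(\<lambda>h. h * k) \<in> measurable M M"
    using k by (rule measurable_right)
  fix B assume "B \<in> sets (distr M M (\<lambda>h. h * k))"
  then have B: "B \<in> sets M" by simp
  have "emeasure (distr M M (\<lambda>h. h * k)) B = (\<integral>\<^sup>+ h. indicator B h \<partial>distr M M (\<lambda>h. h * k))"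
    using B by simp
  also have "\<dots> = (\<integral>\<^sup>+ h. indicator B (h * k) \<partial>M)"
    by (rule nn_integral_distr[OF m]) (use B in simp)
  also have "\<dots> = emeasure M B" using nn_integral_right[OF _ k, of "indicator B"] B by simp
  finally show "emeasure (distr M M (\<lambda>h. h * k)) B = emeasure M B" .
qed simp

lemma integral_left:
  fixes f :: "complex mat \<Rightarrow> 'b :: {banach, second_countable_topology}"
  assumes f: "f \<in> borel_measurable (borel_SU N)" and g: "g \<in> SU N"
  shows "(LINT h|M. f (g * h)) = (LINT h|M. f h)"
proof -
  have m: "(\<lambda>h. g * h) \<in> measurable M M"
    using g by (rule measurable_left)
  have "f \<in> borel_measurable M" using f by (simp add: measurable_cong_sets[OF sets_haar refl])
  then show ?thesis using integral_distr[OF m, of f] distr_left[OF g] by simp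
qed

lemma integral_right:
  fixes f :: "complex mat \<Rightarrow> 'b :: {banach, second_countable_topology}"
  assumes f: "f \<in> borel_measurable (borel_SU N)" and g: "g \<in> SU N"
  shows "(LINT h|M. f (h * g)) = (LINT h|M. f h)"
proof -
  have m: "(\<lambda>h. h * g) \<in> measurable M M"
    using g by (rule measurable_right)
  have "f \<in> borel_measurable M" using f by (simp add: measurable_cong_sets[OF sets_haar refl])
  then show ?thesis using integral_distr[OF m, of f] distr_right[OF g] by simp
qed

end

section \<open>Plane rotations and the factors of the Euler parametrisation\<close>

lemma sum_two_points:
  fixes f :: "nat \<Rightarrow> 'a :: comm_monoid_add"
  assumes "p < N" "q < N" "p \<noteq> q" "\<And>k. k < N \<Longrightarrow> k \<noteq> p \<Longrightarrow> k \<noteq> q \<Longrightarrow> f k = 0"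
  shows "(\<Sum>k<N. f k) = f p + f q"
proof -
  have "(\<Sum>k<N. f k) = sum f {p, q}"
    by (rule sum.mono_neutral_right) (use assms in auto)
  then show ?thesis using assms by simp
qed

lemma prod_two_points:
  fixes f :: "nat \<Rightarrow> 'a :: comm_monoid_mult"
  assumes "p < N" "q < N" "p \<noteq> q" "\<And>k. k < N \<Longrightarrow> k \<noteq> p \<Longrightarrow> k \<noteq> q \<Longrightarrow> f k = 1"
  shows "(\<Prod>k<N. f k) = f p * f q"
proof -
  have "(\<Prod>k<N. f k) = prod f {p, q}"
    by (rule prod.mono_neutral_right) (use assms in auto)
  then show ?thesis using assms by simp
qed

lemma det_upper_triangular_prod:
  fixes A :: "'a :: comm_ring_1 mat"
  assumes "upper_triangular A" "A \<in> carrier_mat n n"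
  shows "det A = (\<Prod>i<n. A $$ (i, i))"
proof -
  have "det A = prod_list (map (\<lambda>i. A $$ (i, i)) [0..<n])"
    using det_upper_triangular[OF assms] assms by (simp add: diag_mat_def)
  also have "\<dots> = (\<Prod>i<n. A $$ (i, i))"
    by (subst prod.distinct_set_conv_list[symmetric]) (auto simp: atLeast0LessThan)
  finally show ?thesis .
qed

lemma mat_diag_index: "i < N \<Longrightarrow> j < N \<Longrightarrow> mat_diag N d $$ (i, j) = (if i = j then d j else 0)"
  by (simp add: mat_diag_def)

lemma mat_diag_dims [simp]: "dim_row (mat_diag N d) = N" "dim_col (mat_diag N d) = N"
  by (auto simp: mat_diag_def)

lemma mat_diag_SU:
  assumes "\<And>i. i < N \<Longrightarrow> cmod (d i) = 1" "(\<Prod>i<N. d i) = 1"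
  shows "mat_diag N d \<in> SU N"
proof -
  have "mat_adjoint (mat_diag N d) = mat_diag N (\<lambda>i. cnj (d i))"
    by (rule eq_matI) (auto simp: mat_diag_index)
  then have "mat_diag N d * mat_adjoint (mat_diag N d) = mat_diag N (\<lambda>i. d i * cnj (d i))"
    by simp
  also have "\<dots> = mat_diag N (\<lambda>i. 1)"
    by (rule eq_matI)
      (auto simp: mat_diag_index complex_norm_square[symmetric] assms)
  finally have "mat_diag N d * mat_adjoint (mat_diag N d) = 1\<^sub>m N" by simp
  moreover have "det (mat_diag N d) = (\<Prod>i<N. d i)"
    by (subst det_upper_triangular_prod[of _ N]) (auto simp: mat_diag_index upper_triangular_def)
  ultimately show ?thesis using assms by (simp add: SU_def)
qed

text \<open>The element of SU(2) with first row (a, b), acting on the coordinates p and q. Every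
  factor of the Euler parametrisation is of this form, and so are the rotations used for the moment
  recursion.\<close>

definition plane :: "nat \<Rightarrow> nat \<Rightarrow> nat \<Rightarrow> complex \<Rightarrow> complex \<Rightarrow> complex mat" where
  "plane N p q a b = mat N N (\<lambda>(i, j).
     if i = p then (if j = p then a else if j = q then b else 0)
     else if i = q then (if j = p then - cnj b else if j = q then cnj a else 0)
     else if i = j then 1 else 0)"

lemma plane_carrier [simp]: "plane N p q a b \<in> carrier_mat N N"
  by (simp add: plane_def)

lemma plane_dims [simp]: "dim_row (plane N p q a b) = N" "dim_col (plane N p q a b) = N"
  by (simp_all add: plane_def)

lemma plane_index: "i < N \<Longrightarrow> j < N \<Longrightarrow> plane N p q a b $$ (i, j) =
     (if i = p then (if j = p then a else if j = q then b else 0)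
     else if i = q then (if j = p then - cnj b else if j = q then cnj a else 0)
     else if i = j then 1 else 0)"
  by (simp add: plane_def)

lemma plane_mult_left:
  assumes "p < N" "q < N" "p \<noteq> q" "A \<in> carrier_mat N m" "i < N" "j < m"
  shows "(plane N p q a b * A) $$ (i, j) =
    (if i = p then a * A $$ (p, j) + b * A $$ (q, j)
     else if i = q then - cnj b * A $$ (p, j) + cnj a * A $$ (q, j) else A $$ (i, j))"
proof -
  have *: "(plane N p q a b * A) $$ (i, j) = (\<Sum>k<N. plane N p q a b $$ (i, k) * A $$ (k, j))"
    by (rule index_mult_sum) (use assms in auto)
  show ?thesis
  proof (cases "i = p \<or> i = q")
    case True
    then show ?thesis
      unfolding * using assms
      by (subst sum_two_points[of p N q]) (auto simp: plane_index)
  next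
    case False
    have "(\<Sum>k<N. plane N p q a b $$ (i, k) * A $$ (k, j)) = (\<Sum>k<N. if k = i then A $$ (i, j) else 0)"
      by (rule sum.cong) (use False assms in \<open>auto simp: plane_index\<close>)
    then show ?thesis unfolding * using False assms by auto
  qed
qed

lemma plane_mult_right:
  assumes "p < N" "q < N" "p \<noteq> q" "A \<in> carrier_mat m N" "i < m" "j < N"
  shows "(A * plane N p q a b) $$ (i, j) =
    (if j = p then A $$ (i, p) * a - A $$ (i, q) * cnj b
     else if j = q then A $$ (i, p) * b + A $$ (i, q) * cnj a else A $$ (i, j))"
proof -
  have *: "(A * plane N p q a b) $$ (i, j) = (\<Sum>k<N. A $$ (i, k) * plane N p q a b $$ (k, j))"
    by (rule index_mult_sum) (use assms in auto)
  show ?thesis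
  proof (cases "j = p \<or> j = q")
    case True
    then show ?thesis
      unfolding * using assms
      by (subst sum_two_points[of p N q]) (auto simp: plane_index)
  next
    case False
    have "(\<Sum>k<N. A $$ (i, k) * plane N p q a b $$ (k, j)) = (\<Sum>k<N. if k = j then A $$ (i, j) else 0)"
      by (rule sum.cong) (use False assms in \<open>auto simp: plane_index\<close>)
    then show ?thesis unfolding * using False assms by auto
  qed
qed

lemma plane_swap: "p \<noteq> q \<Longrightarrow> plane N p q a b = plane N q p (cnj a) (- cnj b)"
  by (rule eq_matI) (auto simp: plane_index)

lemma det_plane_aux:
  assumes pq: "p < q" "q < N" and ab: "(cmod a)\<^sup>2 + (cmod b)\<^sup>2 = 1" and a: "a \<noteq> 0"
  shows "det (plane N p q a b) = 1"
proof -
  \<comment> \<open>The multiplier clears the entry below a. What remains is triangular with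
    diagonal entries a and 1/a at p and q, because |a|^2 + |b|^2 = 1.\<close>
  define U where "U = addrow (cnj b / a) q p (plane N p q a b)"
  have U: "U \<in> carrier_mat N N" by (auto simp: U_def)
  have ab': "a * cnj a + b * cnj b = 1"
    using arg_cong[OF ab, of complex_of_real] by (simp add: complex_norm_square del: of_real_power)
  have idx: "U $$ (i, j) = (if i = p then (if j = p then a else if j = q then b else 0)
     else if i = q then (if j = q then 1 / a else 0)
     else if i = j then 1 else 0)" if "i < N" "j < N" for i j
  proof -
    have "cnj b / a * b + cnj a = 1 / a" using a ab' by (simp add: field_simps)
    then show ?thesis
      using that pq a by (auto simp: U_def plane_index)
  qed
  have "upper_triangular U"
    using U pq by (auto simp: upper_triangular_def idx)
  then have "det U = (\<Prod>i<N. U $$ (i, i))" using U by (rule det_upper_triangular_prod)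
  also have "\<dots> = U $$ (p, p) * U $$ (q, q)"
    using pq by (intro prod_two_points) (auto simp: idx)
  also have "\<dots> = 1" using pq a by (simp add: idx)
  finally show ?thesis
    unfolding U_def using pq by (subst (asm) det_addrow[of p N]) auto
qed

lemma plane_SU_aux:
  assumes pq: "p < N" "q < N" "p \<noteq> q" and ab: "(cmod a)\<^sup>2 + (cmod b)\<^sup>2 = 1" and a: "a \<noteq> 0"
  shows "plane N p q a b \<in> SU N"
proof -
  have ab': "a * cnj a + b * cnj b = 1"
    using arg_cong[OF ab, of complex_of_real] by (simp add: complex_norm_square del: of_real_power)
  have "det (plane N p q a b) = 1"
  proof (cases "p < q")
    case True
    then show ?thesis using det_plane_aux[OF True] assms by simp
  next
    case False
    then have "q < p" using pq by simp
    then show ?thesis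
      using det_plane_aux[of q p N "cnj a" "- cnj b"] assms plane_swap[of p q N a b] by simp
  qed
  moreover have "plane N p q a b * mat_adjoint (plane N p q a b) = 1\<^sub>m N"
  proof (rule eq_matI)
    fix i j assume "i < dim_row (1\<^sub>m N :: complex mat)" "j < dim_col (1\<^sub>m N :: complex mat)"
    then have "i < N" "j < N" by auto
    then show "(plane N p q a b * mat_adjoint (plane N p q a b)) $$ (i, j) = 1\<^sub>m N $$ (i, j)"
      using pq ab' by (subst plane_mult_left) (auto simp: plane_index algebra_simps)
  qed auto
  ultimately show ?thesis by (simp add: SU_def)
qed

lemma plane_SU:
  assumes pq: "p < N" "q < N" "p \<noteq> q" and ab: "(cmod a)\<^sup>2 + (cmod b)\<^sup>2 = 1"
  shows "plane N p q a b \<in> SU N"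
proof (cases "a = 0")
  case False
  then show ?thesis using assms plane_SU_aux by blast
next
  case True
  \<comment> \<open>The elimination divides by a. For a = 0 the matrix is the square of the plane
    matrix with first row (c, c b): c^2 (1 - |b|^2) = 0 and 2 c^2 b = b.\<close>
  define c where "c = complex_of_real (1 / sqrt 2)"
  have c: "c * c = 1 / 2" "cnj c = c" "c \<noteq> 0"
    by (simp_all add: c_def flip: of_real_mult)
  have c2: "(cmod c)\<^sup>2 = 1 / 2"
    unfolding c_def norm_of_real by (simp add: power_divide)
  have b1: "cmod b = 1"
    using ab True norm_ge_zero[of b] by (auto simp: power2_eq_1_iff simp del: norm_ge_zero)
  then have b: "b * cnj b = 1" "cmod b = 1"
    by (simp_all flip: complex_norm_square)
  define P where "P = plane N p q c (c * b)"
  have "P \<in> SU N"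
    unfolding P_def using pq c c2 b by (intro plane_SU_aux) (simp_all add: norm_mult power_mult_distrib)
  moreover have "plane N p q a b = P * P"
  proof (rule eq_matI)
    fix i j assume "i < dim_row (P * P)" "j < dim_col (P * P)"
    then have "i < N" "j < N" by (auto simp: P_def)
    then show "plane N p q a b $$ (i, j) = (P * P) $$ (i, j)"
      unfolding P_def using pq c b True
      by (subst plane_mult_left) (auto simp: plane_index algebra_simps)
  qed (auto simp: P_def)
  ultimately show ?thesis by (simp add: SU_mult)
qed

section \<open>Exponentials of the generators\<close>

lemma mat_diag_pow: "mat_diag N d ^\<^sub>m r = mat_diag N (\<lambda>i. d i ^ r)"
proof (induction r)
  case 0
  show ?case by (auto intro!: eq_matI simp: mat_diag_index)
next
  case (Suc r)
  then show ?case by (simp add: power_Suc2 del: power_Suc)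
qed

lemma exp_complex_sums: "(\<lambda>r. x ^ r / of_nat (fact r)) sums exp (x :: complex)"
  using exp_converges[of x] by (simp add: scaleR_conv_of_real field_simps)

lemma mat_exp_diag: "mat_exp (mat_diag N d) = mat_diag N (\<lambda>i. exp (d i))"
proof (rule eq_matI)
  fix i j assume "i < dim_row (mat_diag N (\<lambda>i. exp (d i)))" "j < dim_col (mat_diag N (\<lambda>i. exp (d i)))"
  then have ij: "i < N" "j < N" by auto
  then have "mat_exp (mat_diag N d) $$ (i, j) = (\<Sum>r. (if i = j then d j ^ r / of_nat (fact r) else 0))"
    unfolding mat_exp_def
    by (auto simp: mat_diag_pow mat_diag_index intro!: arg_cong[of _ _ suminf])
  also have "\<dots> = (if i = j then exp (d j) else 0)"
    using sums_unique[OF exp_complex_sums[of "d j"]] by auto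
  finally show "mat_exp (mat_diag N d) $$ (i, j) = mat_diag N (\<lambda>i. exp (d i)) $$ (i, j)"
    using ij by (simp add: mat_diag_index)
qed (auto simp: mat_exp_def)

text \<open>The coordinates k - 1 and k of the generator, counted from 1, are the rows k - 2 and k -
  1 of the matrix type.\<close>

lemma mat_exp_lam_diag:
  assumes k: "2 \<le> k" "k \<le> N"
  shows "mat_exp (complex_of_real x \<cdot>\<^sub>m lam_diag N k) = plane N (k - 2) (k - 1) (cis x) 0"
proof -
  obtain p where p: "k = Suc (Suc p)" using k by (metis numeral_2_eq_2 Suc_le_D Suc_le_mono)
  have "complex_of_real x \<cdot>\<^sub>m lam_diag N k
      = mat_diag N (\<lambda>i. if i = p then \<i> * x else if i = Suc p then - \<i> * x else 0)"
  proof (rule eq_matI)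
    fix i j
    assume "i < dim_row (mat_diag N (\<lambda>i. if i = p then \<i> * x else if i = Suc p then - \<i> * x else 0))"
      "j < dim_col (mat_diag N (\<lambda>i. if i = p then \<i> * x else if i = Suc p then - \<i> * x else 0))"
    then have "i < N" "j < N" by auto
    then show "(complex_of_real x \<cdot>\<^sub>m lam_diag N k) $$ (i, j)
      = mat_diag N (\<lambda>i. if i = p then \<i> * x else if i = Suc p then - \<i> * x else 0) $$ (i, j)"
      by (simp add: lam_diag_def mat_unit_def mat_diag_index p)
  qed (simp_all add: lam_diag_def mat_unit_def)
  then have "mat_exp (complex_of_real x \<cdot>\<^sub>m lam_diag N k)
      = mat_diag N (\<lambda>i. if i = p then cis x else if i = Suc p then cis (- x) else 1)"
    by (auto simp: mat_exp_diag cis_conv_exp intro!: arg_cong[of _ _ "mat_diag N"])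
  also have "\<dots> = plane N p (Suc p) (cis x) 0"
    by (rule eq_matI) (simp_all add: mat_diag_index plane_index cis_cnj)
  finally show ?thesis by (simp add: p numeral_2_eq_2)
qed

lemma mat_exp_lam_rot:
  assumes k: "2 \<le> k" "k \<le> N"
  shows "mat_exp (complex_of_real y \<cdot>\<^sub>m lam_rot N k) = plane N (k - 2) (k - 1) (cos y) (sin y)"
proof -
  obtain p where p: "k = Suc (Suc p)" using k by (metis numeral_2_eq_2 Suc_le_D Suc_le_mono)
  define q where "q = Suc p"
  have pq: "p < N" "q < N" "p \<noteq> q" using k by (auto simp: p q_def)
  define z where "z = \<i> * complex_of_real y"
  define A where "A = complex_of_real y \<cdot>\<^sub>m lam_rot N k"
  have A: "A \<in> carrier_mat N N"
    by (rule carrier_matI) (simp_all add: A_def lam_rot_def mat_unit_def)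
  have Ai: "A $$ (i, j) = (if i = p \<and> j = q then of_real y else if i = q \<and> j = p then - of_real y else 0)"
    if "i < N" "j < N" for i j
    using that by (simp add: A_def lam_rot_def mat_unit_def p q_def)
  have Apow: "A ^\<^sub>m r \<in> carrier_mat N N" for r using A by (rule pow_carrier_mat)
  have mult: "(X * A) $$ (i, j) = (if j = q then y * X $$ (i, p) else if j = p then - y * X $$ (i, q) else 0)"
    if "X \<in> carrier_mat N N" "i < N" "j < N" for X i j
  proof -
    have "(X * A) $$ (i, j) = (\<Sum>k<N. X $$ (i, k) * A $$ (k, j))"
      by (rule index_mult_sum) (use A that in auto)
    also have "\<dots> = X $$ (i, p) * A $$ (p, j) + X $$ (i, q) * A $$ (q, j)"
      by (rule sum_two_points) (use that pq in \<open>auto simp: Ai\<close>)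
    also have "\<dots> = (if j = q then y * X $$ (i, p) else if j = p then - y * X $$ (i, q) else 0)"
      using that pq by (auto simp: Ai)
    finally show ?thesis .
  qed
  \<comment> \<open>The nonzero eigenvalues of A are z and -z. The even and odd parts of z^r give
    the powers of A for all r at once, and their exponential series sum to cos y and sin y with no
    case split on the parity of r.\<close>
  define C S where "C = (\<lambda>r::nat. (z ^ r + (- z) ^ r) / 2)" and "S = (\<lambda>r::nat. (z ^ r - (- z) ^ r) / (2 * \<i>))"
  have CS: "C (Suc r) = - y * S r" "S (Suc r) = y * C r" for r
    by (auto simp: C_def S_def z_def field_simps)
  have pow: "(A ^\<^sub>m r) $$ (i, j) =
     (if i = p then (if j = p then C r else if j = q then S r else 0)
     else if i = q then (if j = p then - S r else if j = q then C r else 0)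
     else if i = j then 0 ^ r else 0)" if "i < N" "j < N" for i j r
    using that
  proof (induction r arbitrary: i j)
    case 0
    then show ?case using A pq by (auto simp: C_def S_def)
  next
    case (Suc r)
    have "(A ^\<^sub>m Suc r) $$ (i, j) = (if j = q then y * (A ^\<^sub>m r) $$ (i, p) else if j = p then - y * (A ^\<^sub>m r) $$ (i, q) else 0)"
      using mult[OF Apow] Suc.prems by simp
    then show ?case using Suc pq by (simp add: CS)
  qed
  have Cs: "(\<lambda>r. C r / of_nat (fact r)) sums cos y"
  proof -
    have "(\<lambda>r. (z ^ r / of_nat (fact r) + (- z) ^ r / of_nat (fact r)) / 2) sums ((exp z + exp (- z)) / 2)"
      by (intro sums_divide sums_add exp_complex_sums)
    also have "(\<lambda>r. (z ^ r / of_nat (fact r) + (- z) ^ r / of_nat (fact r)) / 2) = (\<lambda>r. C r / of_nat (fact r))"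
      by (rule ext) (simp add: C_def field_simps)
    also have "(exp z + exp (- z)) / 2 = cos (complex_of_real y)"
      by (simp add: cos_exp_eq z_def)
    finally show ?thesis by (simp add: cos_of_real)
  qed
  have Ss: "(\<lambda>r. S r / of_nat (fact r)) sums sin y"
  proof -
    have "(\<lambda>r. (z ^ r / of_nat (fact r) - (- z) ^ r / of_nat (fact r)) / (2 * \<i>)) sums ((exp z - exp (- z)) / (2 * \<i>))"
      by (intro sums_divide sums_diff exp_complex_sums)
    also have "(\<lambda>r. (z ^ r / of_nat (fact r) - (- z) ^ r / of_nat (fact r)) / (2 * \<i>)) = (\<lambda>r. S r / of_nat (fact r))"
      by (rule ext) (simp add: S_def field_simps)
    also have "(exp z - exp (- z)) / (2 * \<i>) = sin (complex_of_real y)"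
      by (simp add: sin_exp_eq z_def)
    finally show ?thesis by (simp add: sin_of_real)
  qed
  have Ns: "(\<lambda>r. - S r / of_nat (fact r)) sums - sin y"
    using sums_minus[OF Ss] by simp
  \<comment> \<open>On the other diagonal positions only the power r = 0 contributes.\<close>
  have Zs: "(\<lambda>r. 0 ^ r / of_nat (fact r) :: complex) sums 1"
    using exp_complex_sums[of 0] by simp
  have "mat_exp A = plane N p q (cos y) (sin y)"
  proof (rule eq_matI)
    fix i j assume "i < dim_row (plane N p q (cos y) (sin y))" "j < dim_col (plane N p q (cos y) (sin y))"
    then have ij: "i < N" "j < N" by auto
    have "mat_exp A $$ (i, j) = (\<Sum>r. (A ^\<^sub>m r) $$ (i, j) / of_nat (fact r))"
      using A ij by (simp add: mat_exp_def)
    also have "\<dots> = plane N p q (cos y) (sin y) $$ (i, j)"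
      using sums_unique[OF Cs, symmetric] sums_unique[OF Ss, symmetric] sums_unique[OF Ns, symmetric]
        sums_unique[OF Zs, symmetric] ij pq
      by (simp add: pow plane_index)
    finally show "mat_exp A $$ (i, j) = plane N p q (cos y) (sin y) $$ (i, j)" .
  qed (use A in \<open>auto simp: mat_exp_def\<close>)
  then show ?thesis by (simp add: A_def p q_def numeral_2_eq_2)
qed

lemma euler_A_plane:
  assumes k: "2 \<le> k" "k \<le> N"
  shows "euler_A N k x y = plane N (k - 2) (k - 1) (cis x * cos y) (cis x * sin y)"
  unfolding euler_A_def mat_exp_lam_diag[OF k] mat_exp_lam_rot[OF k]
proof (rule eq_matI)
  fix i j assume "i < dim_row (plane N (k - 2) (k - 1) (cis x * cos y) (cis x * sin y))"
    "j < dim_col (plane N (k - 2) (k - 1) (cis x * cos y) (cis x * sin y))"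
  then have "i < N" "j < N" by auto
  then show "(plane N (k - 2) (k - 1) (cis x) 0 * plane N (k - 2) (k - 1) (cos y) (sin y)) $$ (i, j)
     = plane N (k - 2) (k - 1) (cis x * cos y) (cis x * sin y) $$ (i, j)"
    using k by (subst plane_mult_left) (auto simp: plane_index)
qed auto

lemma euler_A_carrier [simp]: "2 \<le> k \<Longrightarrow> k \<le> N \<Longrightarrow> euler_A N k x y \<in> carrier_mat N N"
  by (simp add: euler_A_plane)

lemma euler_A_SU:
  assumes k: "2 \<le> k" "k \<le> N" and y: "y \<in> {0<..<pi/2}"
  shows "euler_A N k x y \<in> SU N"
  unfolding euler_A_plane[OF k]
  using k cos_gt_zero[of y] y by (intro plane_SU) (auto simp: norm_mult)

text \<open>The last factor of the parametrisation. Its corner entry is the conjugate of cis w,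
  hence the sign in \<open>euler_E_last_col\<close>.\<close>

abbreviation euler_E :: "nat \<Rightarrow> real \<Rightarrow> complex mat" where
  "euler_E N w \<equiv> plane N (N - 2) (N - 1) (cis w) 0"

lemma euler_E_SU: "2 \<le> N \<Longrightarrow> euler_E N w \<in> SU N"
  by (intro plane_SU) auto

lemma euler_E_last_col:
  assumes "2 \<le> N" "A \<in> carrier_mat N N" "i < N"
  shows "(A * euler_E N w) $$ (i, N - 1) = cis (- w) * A $$ (i, N - 1)"
  using assms by (subst plane_mult_right) (auto simp: cis_cnj)

section \<open>Partial products of the factors A(2), ..., A(k) and their columns\<close>

definition euler_B :: "nat \<Rightarrow> nat \<Rightarrow> (nat \<Rightarrow> real) \<Rightarrow> (nat \<Rightarrow> real) \<Rightarrow> complex mat" where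
  "euler_B N k \<phi> \<psi> = foldr (\<lambda>k B. euler_A N k (\<phi> (k - 1)) (\<psi> (k - 1)) * B) [2..<Suc k] (1\<^sub>m N)"

lemma euler_B_1 [simp]: "euler_B N (Suc 0) \<phi> \<psi> = 1\<^sub>m N"
  by (simp add: euler_B_def)

lemma foldr_mult_mat:
  fixes X :: "'a :: semiring_1 mat"
  assumes "\<And>k. k \<in> set ks \<Longrightarrow> A k \<in> carrier_mat N N" "X \<in> carrier_mat N N"
  shows "foldr (\<lambda>k B. A k * B) ks (1\<^sub>m N) \<in> carrier_mat N N"
    and "foldr (\<lambda>k B. A k * B) ks X = foldr (\<lambda>k B. A k * B) ks (1\<^sub>m N) * X"
  using assms
proof (induction ks)
  case Nil
  {
    case 1
    show ?case by simp
  next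
    case 2
    then show ?case using left_mult_one_mat[of X N N] by simp
  }
next
  case (Cons k ks)
  {
    case 1
    with Cons.IH(1) show ?case by (auto intro!: mult_carrier_mat[of _ N N])
  next
    case 2
    have "A k \<in> carrier_mat N N" "foldr (\<lambda>k B. A k * B) ks (1\<^sub>m N) \<in> carrier_mat N N"
      using 2 Cons.IH(1) by auto
    moreover have "foldr (\<lambda>k B. A k * B) ks X = foldr (\<lambda>k B. A k * B) ks (1\<^sub>m N) * X"
      using 2 by (intro Cons.IH(2)) auto
    ultimately show ?case using 2 by (simp add: assoc_mult_mat[of _ N N _ N X N])
  }
qed

lemma euler_B_carrier [simp]: "k \<le> N \<Longrightarrow> euler_B N k \<phi> \<psi> \<in> carrier_mat N N"
  unfolding euler_B_def by (rule foldr_mult_mat(1)) auto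

lemma euler_B_Suc:
  assumes "1 \<le> k" "Suc k \<le> N"
  shows "euler_B N (Suc k) \<phi> \<psi> = euler_B N k \<phi> \<psi> * euler_A N (Suc k) (\<phi> k) (\<psi> k)"
proof -
  have "[2..<Suc (Suc k)] = [2..<Suc k] @ [Suc k]" using assms by simp
  then show ?thesis
    unfolding euler_B_def using assms
      foldr_mult_mat(2)[of "[2..<Suc k]" "\<lambda>k. euler_A N k (\<phi> (k - 1)) (\<psi> (k - 1))" N "euler_A N (Suc k) (\<phi> k) (\<psi> k)"]
    by (simp add: right_mult_one_mat[of _ N N] del: upt_Suc)
qed

lemma euler_B_SU:
  assumes "1 \<le> k" "k \<le> N" "\<And>j. 1 \<le> j \<Longrightarrow> j < k \<Longrightarrow> \<psi> j \<in> {0<..<pi/2}"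
  shows "euler_B N k \<phi> \<psi> \<in> SU N"
  using assms
proof (induction k rule: nat_induct_at_least)
  case base
  then show ?case by simp
next
  case (Suc k)
  then show ?case by (auto simp: euler_B_Suc intro!: SU_mult euler_A_SU)
qed

text \<open>Column k, counted from 1, of A(2) ... A(k). The factor A(k + 1) mixes column k with
  column k + 1, which until then is a unit vector; this is the recursion.\<close>

fun euler_V :: "nat \<Rightarrow> (nat \<Rightarrow> real) \<Rightarrow> (nat \<Rightarrow> real) \<Rightarrow> nat \<Rightarrow> complex" where
  "euler_V 0 \<phi> \<psi> i = 0"
| "euler_V (Suc 0) \<phi> \<psi> i = (if i = 0 then 1 else 0)"
| "euler_V (Suc (Suc k)) \<phi> \<psi> i = cis (\<phi> (Suc k)) * sin (\<psi> (Suc k)) * euler_V (Suc k) \<phi> \<psi> i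
     + (if i = Suc k then cis (- \<phi> (Suc k)) * cos (\<psi> (Suc k)) else 0)"

text \<open>The factors up to A(k) act on the first k coordinates only.\<close>

lemma euler_B_col_ge:
  assumes "1 \<le> k" "k \<le> N" "i < N" "j < N" "k \<le> j"
  shows "euler_B N k \<phi> \<psi> $$ (i, j) = (if i = j then 1 else 0)"
  using assms
proof (induction k arbitrary: i j rule: nat_induct_at_least)
  case base
  then show ?case by simp
next
  case (Suc k)
  have "euler_B N (Suc k) \<phi> \<psi> $$ (i, j) = euler_B N k \<phi> \<psi> $$ (i, j)"
    using Suc.hyps Suc.prems
    by (simp add: euler_B_Suc euler_A_plane) (subst plane_mult_right[of _ N _ _ N], auto)
  then show ?case using Suc by simp
qed

lemma euler_B_col:
  assumes "1 \<le> k" "k \<le> N" "i < N"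
  shows "euler_B N k \<phi> \<psi> $$ (i, k - 1) = euler_V k \<phi> \<psi> i"
  using assms
proof (induction k arbitrary: i rule: nat_induct_at_least)
  case base
  then show ?case by simp
next
  case (Suc k)
  then obtain k' where k': "k = Suc k'" by (cases k) auto
  have "euler_B N (Suc k) \<phi> \<psi> $$ (i, k) = euler_B N k \<phi> \<psi> $$ (i, k - 1) * (cis (\<phi> k) * sin (\<psi> k))
     + euler_B N k \<phi> \<psi> $$ (i, k) * cnj (cis (\<phi> k) * cos (\<psi> k))"
    using Suc.hyps Suc.prems
    by (simp add: euler_B_Suc euler_A_plane) (subst plane_mult_right[of _ N _ _ N], auto)
  then show ?case
    using Suc by (simp add: euler_B_col_ge cis_cnj k')
qed

section \<open>The copy of SU(n) that fixes the last basis vector\<close>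

definition ext1 :: "nat \<Rightarrow> complex mat \<Rightarrow> complex mat" where
  "ext1 n h = four_block_mat h (0\<^sub>m n 1) (0\<^sub>m 1 n) (1\<^sub>m 1)"

lemma ext1_index:
  assumes "h \<in> carrier_mat n n" "i < Suc n" "j < Suc n"
  shows "ext1 n h $$ (i, j) = (if i < n \<and> j < n then h $$ (i, j) else if i = j then 1 else 0)"
  using assms by (auto simp: ext1_def)

lemma ext1_carrier: "h \<in> carrier_mat n n \<Longrightarrow> ext1 n h \<in> carrier_mat (Suc n) (Suc n)"
  using four_block_carrier_mat[of h n n "1\<^sub>m 1" 1 1] by (simp add: ext1_def)

lemma ext1_dims [simp]:
  "h \<in> carrier_mat n n \<Longrightarrow> dim_row (ext1 n h) = Suc n" "h \<in> carrier_mat n n \<Longrightarrow> dim_col (ext1 n h) = Suc n"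
  using ext1_carrier[of h n] by auto

lemma ext1_mult:
  assumes "g \<in> carrier_mat n n" "h \<in> carrier_mat n n"
  shows "ext1 n g * ext1 n h = ext1 n (g * h)"
proof -
  have "ext1 n g * ext1 n h = four_block_mat (g * h + 0\<^sub>m n 1 * 0\<^sub>m 1 n) (g * 0\<^sub>m n 1 + 0\<^sub>m n 1 * 1\<^sub>m 1)
     (0\<^sub>m 1 n * h + 1\<^sub>m 1 * 0\<^sub>m 1 n) (0\<^sub>m 1 n * 0\<^sub>m n 1 + 1\<^sub>m 1 * 1\<^sub>m 1)"
    unfolding ext1_def by (rule mult_four_block_mat[of _ n n _ 1 _ 1]) (use assms in auto)
  then show ?thesis using assms by (simp add: ext1_def)
qed

lemma ext1_adjoint: "h \<in> carrier_mat n n \<Longrightarrow> mat_adjoint (ext1 n h) = ext1 n (mat_adjoint h)"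
  by (rule eq_matI) (auto simp: ext1_index)

lemma ext1_det: "h \<in> carrier_mat n n \<Longrightarrow> det (ext1 n h) = det h"
  using det_four_block_mat_upper_right_zero[of h n _ 1 "0\<^sub>m 1 n" "1\<^sub>m 1"] by (simp add: ext1_def)

lemma ext1_one: "ext1 n (1\<^sub>m n) = 1\<^sub>m (Suc n)"
  using four_block_one_mat[of n 1] by (simp add: ext1_def)

lemma ext1_SU_iff:
  assumes h: "h \<in> carrier_mat n n"
  shows "ext1 n h \<in> SU (Suc n) \<longleftrightarrow> h \<in> SU n"
proof -
  have "ext1 n h * mat_adjoint (ext1 n h) = 1\<^sub>m (Suc n) \<longleftrightarrow> h * mat_adjoint h = 1\<^sub>m n"
  proof
    assume "ext1 n h * mat_adjoint (ext1 n h) = 1\<^sub>m (Suc n)"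
    then have eq: "ext1 n (h * mat_adjoint h) = 1\<^sub>m (Suc n)"
      using h by (simp add: ext1_adjoint ext1_mult)
    show "h * mat_adjoint h = 1\<^sub>m n"
    proof (rule eq_matI)
      fix i j assume "i < dim_row (1\<^sub>m n :: complex mat)" "j < dim_col (1\<^sub>m n :: complex mat)"
      then have ij: "i < n" "j < n" by auto
      have "(h * mat_adjoint h) $$ (i, j) = ext1 n (h * mat_adjoint h) $$ (i, j)"
        using h ij by (subst ext1_index) auto
      then show "(h * mat_adjoint h) $$ (i, j) = 1\<^sub>m n $$ (i, j)" using eq ij by simp
    qed (use h in auto)
  next
    assume "h * mat_adjoint h = 1\<^sub>m n"
    then show "ext1 n h * mat_adjoint (ext1 n h) = 1\<^sub>m (Suc n)"
      using h by (simp add: ext1_adjoint ext1_mult ext1_one)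
  qed
  then show ?thesis using h ext1_carrier[OF h] by (simp add: SU_def ext1_det)
qed

text \<open>The last row has norm 1 too and its corner entry is already 1, so the rest of it
  vanishes and the matrix is block diagonal.\<close>

lemma SU_last_col_trivial:
  assumes H: "H \<in> SU (Suc n)" and col: "\<And>i. i < n \<Longrightarrow> H $$ (i, n) = 0" "H $$ (n, n) = 1"
  obtains h where "h \<in> SU n" "H = ext1 n h"
proof -
  have Hc: "H \<in> carrier_mat (Suc n) (Suc n)" using H by (rule SU_carrier)
  have "(\<Sum>i<Suc n. (cmod (mat_adjoint H $$ (i, n)))\<^sup>2) = 1"
    by (rule SU_col_norm[OF SU_adjoint(1)[OF H]]) simp
  moreover have "(\<Sum>i<Suc n. (cmod (mat_adjoint H $$ (i, n)))\<^sup>2) = (\<Sum>i<Suc n. (cmod (H $$ (n, i)))\<^sup>2)"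
    by (rule sum.cong) (use Hc in auto)
  ultimately have "(\<Sum>i<Suc n. (cmod (H $$ (n, i)))\<^sup>2) = 1" by simp
  then have "(\<Sum>i<n. (cmod (H $$ (n, i)))\<^sup>2) = 0" using col by simp
  then have row: "H $$ (n, i) = 0" if "i < n" for i
    using that by (subst (asm) sum_nonneg_eq_0_iff) auto
  define h where "h = mat n n (\<lambda>ij. H $$ ij)"
  have h: "h \<in> carrier_mat n n" by (simp add: h_def)
  have eq: "H = ext1 n h"
  proof (rule eq_matI)
    fix i j assume "i < dim_row (ext1 n h)" "j < dim_col (ext1 n h)"
    then have ij: "i < Suc n" "j < Suc n" using h by auto
    then show "H $$ (i, j) = ext1 n h $$ (i, j)"
      using row col by (subst ext1_index[OF h ij]) (auto simp: h_def less_Suc_eq)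
  qed (use Hc h in auto)
  then have "h \<in> SU n" using H ext1_SU_iff[OF h] by simp
  with eq that show ?thesis by blast
qed

lemma euler_F_Suc:
  assumes "1 \<le> n"
  shows "euler_F (Suc n) \<phi> \<psi> \<omega> =
    euler_B (Suc n) (Suc n) \<phi> \<psi> * ext1 n (euler_F n (\<lambda>i. \<phi> (n + i)) (\<lambda>i. \<psi> (n + i)) \<omega>)
      * euler_E (Suc n) (\<omega> n)"
proof -
  obtain r where r: "n = Suc r" using assms by (cases n) auto
  show ?thesis
    unfolding r euler_F.simps Let_def euler_B_def ext1_def
    using mat_exp_lam_diag[of "Suc (Suc r)" "Suc (Suc r)" "\<omega> (Suc r)"] by simp
qed

section \<open>Euler angles of the last column\<close>

lemma euler_V_cong:
  assumes "\<And>j. 1 \<le> j \<Longrightarrow> j < k \<Longrightarrow> \<phi> j = \<phi>' j \<and> \<psi> j = \<psi>' j"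
  shows "euler_V k \<phi> \<psi> i = euler_V k \<phi>' \<psi>' i"
  using assms
  by (induction k \<phi> \<psi> i rule: euler_V.induct) auto

lemma euler_V_ge: "k \<le> i \<Longrightarrow> euler_V k \<phi> \<psi> i = 0"
  by (induction k \<phi> \<psi> i rule: euler_V.induct) auto

lemma euler_V_Suc:
  "1 \<le> k \<Longrightarrow> euler_V (Suc k) \<phi> \<psi> i = cis (\<phi> k) * sin (\<psi> k) * euler_V k \<phi> \<psi> i
     + (if i = k then cis (- \<phi> k) * cos (\<psi> k) else 0)"
  by (cases k) auto

text \<open>Each further angle \<open>\<psi>\<^sub>k\<close> scales the earlier coordinates by its
  sine, starting from a unit vector. Quotients of consecutive partial norms therefore recover the
  single angles.\<close>

lemma euler_V_norm:
  assumes "1 \<le> p" "p \<le> k"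
  shows "(\<Sum>i<p. (cmod (euler_V k \<phi> \<psi> i))\<^sup>2) = (\<Prod>j\<in>{p..<k}. (sin (\<psi> j))\<^sup>2)"
proof -
  have 1: "(\<Sum>i<k. (cmod (euler_V k \<phi> \<psi> i))\<^sup>2) = 1" if "1 \<le> k" for k
    using that
  proof (induction k rule: nat_induct_at_least)
    case base
    then show ?case by simp
  next
    case (Suc k)
    have "(\<Sum>i<Suc k. (cmod (euler_V (Suc k) \<phi> \<psi> i))\<^sup>2)
      = (\<Sum>i<k. (sin (\<psi> k))\<^sup>2 * (cmod (euler_V k \<phi> \<psi> i))\<^sup>2) + (cos (\<psi> k))\<^sup>2"
      using Suc.hyps by (simp add: euler_V_Suc euler_V_ge norm_mult power_mult_distrib)
    also have "\<dots> = 1" using Suc.IH by (simp flip: sum_distrib_left)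
    finally show ?case .
  qed
  show ?thesis
    using assms(2)
  proof (induction k rule: dec_induct)
    case base
    then show ?case using 1[OF assms(1)] by simp
  next
    case (step k)
    have "(\<Sum>i<p. (cmod (euler_V (Suc k) \<phi> \<psi> i))\<^sup>2)
      = (\<Sum>i<p. (sin (\<psi> k))\<^sup>2 * (cmod (euler_V k \<phi> \<psi> i))\<^sup>2)"
      using step assms(1)
      by (intro sum.cong) (auto simp: euler_V_Suc norm_mult power_mult_distrib)
    also have "\<dots> = (\<Prod>j\<in>{p..<Suc k}. (sin (\<psi> j))\<^sup>2)"
      using step by (simp flip: sum_distrib_left)
    finally show ?case .
  qed
qed

text \<open>Shifting one angle \<open>\<phi>\<^sub>j\<close> acts on the column by a diagonal torus
  element. This turns the phases in f into characters of a torus acting on the group.\<close>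

lemma euler_V_shift:
  assumes "1 \<le> j" "j < k" "i < k"
  shows "euler_V k (\<phi>(j := \<phi> j + \<delta>)) \<psi> i
    = cis (\<delta> * (if i < j then 1 else if i = j then - 1 else 0)) * euler_V k \<phi> \<psi> i"
proof -
  have "Suc j \<le> k" using assms by simp
  then show ?thesis using assms(3)
  proof (induction k arbitrary: i rule: dec_induct)
    case base
    define \<phi>' where "\<phi>' = \<phi>(j := \<phi> j + \<delta>)"
    have V: "euler_V j \<phi>' \<psi> i = euler_V j \<phi> \<psi> i"
      unfolding \<phi>'_def by (rule euler_V_cong) auto
    have e: "cis (\<phi>' j) = cis \<delta> * cis (\<phi> j)" "cis (- \<phi>' j) = cis (- \<delta>) * cis (- \<phi> j)"
      unfolding cis_mult by (simp_all add: \<phi>'_def algebra_simps)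
    show ?case
      unfolding \<phi>'_def[symmetric]
      using assms(1) base euler_V_ge[of j i \<phi> \<psi>] euler_V_ge[of j i \<phi>' \<psi>]
      by (cases "i = j") (simp_all add: euler_V_Suc V e)
  next
    case (step k)
    then show ?case
      using assms(1) euler_V_ge[of k i] by (cases "i = k") (auto simp: euler_V_Suc)
  qed
qed

text \<open>Replacing \<open>(\<phi>\<^sub>k, \<omega>)\<close> by \<open>(\<phi>\<^sub>k - n \<pi>, \<omega> - n \<pi>)\<close> does not change
  \<open>e\<^bsup>-i\<omega>\<^esup> V\<close>; this brings \<open>\<phi>\<^sub>k\<close> into \<open>[0, \<pi>)\<close>.\<close>
lemma euler_V_surj:
  assumes "1 \<le> k" "\<And>i. i < k \<Longrightarrow> z i \<noteq> 0" "(\<Sum>i<k. (cmod (z i))\<^sup>2) = 1"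
  shows "\<exists>\<phi> \<psi> w. (\<forall>j\<in>{1..<k}. \<phi> j \<in> {0..<pi} \<and> \<psi> j \<in> {0<..<pi/2}) \<and>
     (\<forall>i<k. z i = cis (- w) * euler_V k \<phi> \<psi> i)"
  using assms
proof (induction k arbitrary: z rule: nat_induct_at_least)
  case base
  then have "cmod (z 0) = 1" 
    using norm_ge_zero[of "z 0"] by (auto simp: power2_eq_1_iff simp del: norm_ge_zero)
  then have "z 0 = cis (Arg (z 0))" using rcis_cmod_Arg[of "z 0"] by (simp add: rcis_def)
  then have "\<forall>i<1. z i = cis (- (- Arg (z 0))) * euler_V 1 \<phi> \<psi> i" for \<phi> \<psi> by simp
  then show ?case by (intro exI[of _ "\<lambda>_. 0"] exI[of _ "- Arg (z 0)"]) auto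
next
  case (Suc k)
  \<comment> \<open>The new coordinate has modulus c = cos y, and the earlier ones have joint norm
    sin y; dividing them by that norm makes the induction hypothesis applicable.\<close>
  define c where "c = cmod (z k)"
  define \<rho> where "\<rho> = sqrt (\<Sum>i<k. (cmod (z i))\<^sup>2)"
  have S: "(\<Sum>i<k. (cmod (z i))\<^sup>2) + c\<^sup>2 = 1" using Suc.prems by (simp add: c_def)
  have "0 < (cmod (z 0))\<^sup>2" using Suc by simp
  also have "\<dots> \<le> (\<Sum>i<k. (cmod (z i))\<^sup>2)"
    by (rule member_le_sum) (use Suc in auto)
  finally have pos: "0 < (\<Sum>i<k. (cmod (z i))\<^sup>2)" .
  then have \<rho>: "\<rho> > 0" "\<rho>\<^sup>2 = (\<Sum>i<k. (cmod (z i))\<^sup>2)" by (auto simp: \<rho>_def)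
  have c: "0 < c" "c < 1"
  proof -
    show "0 < c" using Suc.prems(1)[of k] by (simp add: c_def)
    have "c\<^sup>2 < 1\<^sup>2" using S pos by simp
    then show "c < 1" by (rule power_less_imp_less_base) simp
  qed
  have "(\<Sum>i<k. (cmod (z i / \<rho>))\<^sup>2) = (\<Sum>i<k. (cmod (z i))\<^sup>2) / \<rho>\<^sup>2"
    using \<rho>(1) by (simp add: norm_divide power_divide sum_divide_distrib)
  also have "\<dots> = 1" unfolding \<rho>(2) using pos by (intro divide_self) simp
  finally obtain \<phi> \<psi> w where IH: "\<forall>j\<in>{1..<k}. \<phi> j \<in> {0..<pi} \<and> \<psi> j \<in> {0<..<pi/2}"
     "\<forall>i<k. z i / \<rho> = cis (- w) * euler_V k \<phi> \<psi> i"
    using Suc.IH[of "\<lambda>i. z i / \<rho>"] Suc.prems(1) \<rho>(1) by auto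
  define \<beta> where "\<beta> = Arg (z k)"
  have zk: "z k = c * cis \<beta>" using rcis_cmod_Arg[of "z k"] by (simp add: rcis_def c_def \<beta>_def)
  \<comment> \<open>The phases require p - w' = -w and -p - w' = \<open>\<beta>\<close> modulo 2 pi.
    Solving gives p = (-w - \<open>\<beta>\<close>)/2 and w' = (w - \<open>\<beta>\<close>)/2 up to
    a common shift by n pi, and n is chosen to put p into the half period.\<close>
  define n where "n = \<lfloor>((- w - \<beta>) / 2) / pi\<rfloor>"
  define p where "p = (- w - \<beta>) / 2 - of_int n * pi"
  define w' where "w' = (w - \<beta>) / 2 - of_int n * pi"
  define y where "y = arccos c"
  have p: "p \<in> {0..<pi}"
  proof -
    have "of_int n * pi \<le> (- w - \<beta>) / 2 / pi * pi"
      unfolding n_def by (intro mult_right_mono) auto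
    moreover have "(- w - \<beta>) / 2 / pi * pi < (of_int n + 1) * pi"
      unfolding n_def by (intro mult_strict_right_mono) (linarith, simp)
    moreover have "(- w - \<beta>) / 2 / pi * pi = (- w - \<beta>) / 2" by simp
    ultimately show ?thesis unfolding p_def atLeastLessThan_iff distrib_right by linarith
  qed
  have y: "y \<in> {0<..<pi/2}" "cos y = c" "sin y = \<rho>"
  proof -
    show cosy: "cos y = c" using c by (simp add: y_def)
    have b: "0 \<le> y" "y \<le> pi" using c by (auto simp: y_def arccos_lbound arccos_ubound)
    have "y < pi / 2" using c arccos_less_arccos[of 0 c] by (simp add: y_def)
    moreover have "y > 0" using c arccos_less_arccos[of c 1] by (simp add: y_def)
    ultimately show yr: "y \<in> {0<..<pi/2}" by simp
    have "(sin y)\<^sup>2 = \<rho>\<^sup>2" using S \<rho> cosy by (simp add: sin_squared_eq)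
    then show "sin y = \<rho>" using sin_gt_zero[of y] yr \<rho>(1) by (simp add: power2_eq_iff)
  qed
  define \<phi>' \<psi>' where "\<phi>' = \<phi>(k := p)" and "\<psi>' = \<psi>(k := y)"
  have Vk: "euler_V k \<phi>' \<psi>' i = euler_V k \<phi> \<psi> i" for i
    by (rule euler_V_cong) (auto simp: \<phi>'_def \<psi>'_def)
  have "z i = cis (- w') * euler_V (Suc k) \<phi>' \<psi>' i" if "i < Suc k" for i
  proof (cases "i = k")
    case True
    have e: "cis (- w') * cis (- p) = cis \<beta>"
    proof -
      have "- w' + - p = \<beta> + 2 * pi * of_int n" by (simp add: w'_def p_def field_simps)
      then show ?thesis unfolding cis_mult by (simp flip: cis_mult)
    qed
    show ?thesis
      using True Suc.hyps y e by (simp add: euler_V_Suc euler_V_ge zk \<phi>'_def \<psi>'_def flip: e)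
  next
    case False
    then have ik: "i < k" using that by simp
    have "- w' + p = - w" by (simp add: w'_def p_def field_simps)
    then have e: "cis (- w') * cis p = cis (- w)" unfolding cis_mult by simp
    have "z i = \<rho> * (z i / \<rho>)" using \<rho>(1) by simp
    also have "\<dots> = \<rho> * (cis (- w) * euler_V k \<phi> \<psi> i)" using IH(2) ik by simp
    finally show ?thesis
      using False Suc.hyps y Vk by (simp add: euler_V_Suc \<phi>'_def \<psi>'_def flip: e)
  qed
  moreover have "\<forall>j\<in>{1..<Suc k}. \<phi>' j \<in> {0..<pi} \<and> \<psi>' j \<in> {0<..<pi/2}"
    using IH(1) p y(1) by (auto simp: \<phi>'_def \<psi>'_def less_Suc_eq)
  ultimately show ?case by blast
qed

text \<open>The ranges of just those parameters that the last column depends on; w stands for the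
  last \<open>\<omega>\<close>.\<close>

definition euler_box :: "nat \<Rightarrow> (nat \<Rightarrow> real) \<Rightarrow> (nat \<Rightarrow> real) \<Rightarrow> real \<Rightarrow> bool" where
  "euler_box n \<phi> \<psi> w \<longleftrightarrow>
     (\<forall>j\<in>{1..n}. \<phi> j \<in> {0..<pi} \<and> \<psi> j \<in> {0<..<pi/2}) \<and> w \<in> {0..<2*pi}"

lemma euler_box_exists:
  assumes "\<And>i. i < Suc n \<Longrightarrow> z i \<noteq> 0" "(\<Sum>i<Suc n. (cmod (z i))\<^sup>2) = 1"
  obtains \<phi> \<psi> w where "euler_box n \<phi> \<psi> w"
    "\<And>i. i < Suc n \<Longrightarrow> z i = cis (- w) * euler_V (Suc n) \<phi> \<psi> i"
proof -
  obtain \<phi> \<psi> w where *: "\<forall>j\<in>{1..<Suc n}. \<phi> j \<in> {0..<pi} \<and> \<psi> j \<in> {0<..<pi/2}"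
     "\<forall>i<Suc n. z i = cis (- w) * euler_V (Suc n) \<phi> \<psi> i"
    using euler_V_surj[of "Suc n" z] assms by auto
  define m where "m = \<lfloor>w / (2 * pi)\<rfloor>"
  define w' where "w' = w - of_int m * (2 * pi)"
  have "of_int m * (2 * pi) \<le> w / (2 * pi) * (2 * pi)"
    unfolding m_def by (intro mult_right_mono) auto
  moreover have "w / (2 * pi) * (2 * pi) < (of_int m + 1) * (2 * pi)"
    unfolding m_def by (intro mult_strict_right_mono) (linarith, simp)
  ultimately have "w' \<in> {0..<2*pi}" by (simp add: w'_def distrib_right)
  moreover have "cis (- w') = cis (- w)"
  proof -
    have "- w' = - w + 2 * pi * of_int m" by (simp add: w'_def)
    then have "cis (- w') = cis (- w) * cis (2 * pi * of_int m)" by (simp only: cis_mult)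
    then show ?thesis by simp
  qed
  moreover have "{1..<Suc n} = {1..n}" by auto
  ultimately show ?thesis using * that[of \<phi> \<psi> w'] by (auto simp: euler_box_def)
qed

lemma euler_E_adjoint:
  assumes "2 \<le> N"
  shows "mat_adjoint (euler_E N w) = euler_E N (- w)"
  using assms by (intro eq_matI) (auto simp: plane_index cis_cnj)

text \<open>Once the phase is undone by \<open>euler_E\<close> at -w, the last column agrees with
  that of B, so multiplying by the adjoint of B fixes the last basis vector and leaves a block
  matrix.\<close>

lemma euler_decomp:
  assumes g: "g \<in> SU (Suc n)" and n: "1 \<le> n"
    and psi: "\<And>j. j \<in> {1..n} \<Longrightarrow> \<psi> j \<in> {0<..<pi/2}"
    and col: "\<And>i. i < Suc n \<Longrightarrow> g $$ (i, n) = cis (- w) * euler_V (Suc n) \<phi> \<psi> i"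
  obtains h where "h \<in> SU n"
    "g = euler_B (Suc n) (Suc n) \<phi> \<psi> * ext1 n h * euler_E (Suc n) w"
proof -
  define B where "B = euler_B (Suc n) (Suc n) \<phi> \<psi>"
  have B: "B \<in> SU (Suc n)" unfolding B_def using psi by (intro euler_B_SU) auto
  have E: "euler_E (Suc n) v \<in> SU (Suc n)" for v using n by (intro euler_E_SU) auto
  define G where "G = g * euler_E (Suc n) (- w)"
  have G: "G \<in> SU (Suc n)" unfolding G_def by (intro SU_mult g E)
  have Gcol: "G $$ (i, n) = B $$ (i, n)" if "i < Suc n" for i
  proof -
    have "G $$ (i, n) = cis w * g $$ (i, n)"
      unfolding G_def using euler_E_last_col[of "Suc n" g i "- w"] n SU_carrier[OF g] that by simp
    also have "\<dots> = euler_V (Suc n) \<phi> \<psi> i" using col[OF that] by (simp add: cis_mult flip: mult.assoc)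
    also have "\<dots> = B $$ (i, n)" using euler_B_col[of "Suc n" "Suc n" i] that by (simp add: B_def)
    finally show ?thesis .
  qed
  define H where "H = mat_adjoint B * G"
  have H: "H \<in> SU (Suc n)" unfolding H_def by (intro SU_mult G SU_adjoint B)
  have "H $$ (i, n) = 1\<^sub>m (Suc n) $$ (i, n)" if "i < Suc n" for i
  proof -
    have "H $$ (i, n) = (\<Sum>k<Suc n. mat_adjoint B $$ (i, k) * G $$ (k, n))"
      unfolding H_def by (rule index_mult_sum) (use that G B SU_carrier SU_adjoint in auto)
    also have "\<dots> = (\<Sum>k<Suc n. mat_adjoint B $$ (i, k) * B $$ (k, n))"
      using Gcol by (intro sum.cong) auto
    also have "\<dots> = (mat_adjoint B * B) $$ (i, n)"
      by (rule index_mult_sum[symmetric]) (use that B SU_carrier SU_adjoint in auto)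
    finally show ?thesis using SU_adjoint(2)[OF B] by simp
  qed
  then obtain h where h: "h \<in> SU n" "H = ext1 n h"
    using SU_last_col_trivial[OF H] by auto
  have "B * H * euler_E (Suc n) w = G * euler_E (Suc n) w"
    unfolding H_def using SU_cancel(2)[OF B SU_carrier[OF G]] by simp
  also have "\<dots> = g * (euler_E (Suc n) (- w) * euler_E (Suc n) w)"
    unfolding G_def by (rule SU_mult_assoc[OF g E E])
  also have "euler_E (Suc n) (- w) * euler_E (Suc n) w = 1\<^sub>m (Suc n)"
    using SU_adjoint(2)[OF E[of w]] euler_E_adjoint[of "Suc n" w] n by simp
  also have "g * 1\<^sub>m (Suc n) = g" using SU_carrier[OF g] by simp
  finally show ?thesis using that[OF h(1)] by (simp add: h(2) B_def)
qed

section \<open>Splitting a parameter tuple into its first block and the tuple of the smaller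
  group\<close>

lemma Nminus_Suc: "Nminus (Suc n) = n + Nminus n"
proof -
  have "Suc n * n = 2 * n + n * (n - 1)" by (cases n) auto
  then show ?thesis unfolding Nminus_def by simp
qed

lemma euler_B_cong:
  assumes "\<And>j. 1 \<le> j \<Longrightarrow> j < k \<Longrightarrow> \<phi> j = \<phi>' j \<and> \<psi> j = \<psi>' j"
  shows "euler_B N k \<phi> \<psi> = euler_B N k \<phi>' \<psi>'"
  unfolding euler_B_def using assms by (intro foldr_cong) auto

lemma euler_F_cong:
  assumes "1 \<le> N" "\<And>j. j \<in> {1..Nminus N} \<Longrightarrow> \<phi> j = \<phi>' j \<and> \<psi> j = \<psi>' j"
    "\<And>j. j \<in> {1..N - 1} \<Longrightarrow> \<omega> j = \<omega>' j"
  shows "euler_F N \<phi> \<psi> \<omega> = euler_F N \<phi>' \<psi>' \<omega>'"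
  using assms
proof (induction N arbitrary: \<phi> \<psi> \<phi>' \<psi>' rule: nat_induct_at_least)
  case base
  then show ?case by simp
next
  case (Suc n)
  have "euler_B (Suc n) (Suc n) \<phi> \<psi> = euler_B (Suc n) (Suc n) \<phi>' \<psi>'"
    by (rule euler_B_cong) (use Suc.prems(1) Suc.hyps in \<open>auto simp: Nminus_Suc\<close>)
  moreover have "euler_F n (\<lambda>i. \<phi> (n + i)) (\<lambda>i. \<psi> (n + i)) \<omega>
      = euler_F n (\<lambda>i. \<phi>' (n + i)) (\<lambda>i. \<psi>' (n + i)) \<omega>'"
    by (rule Suc.IH) (use Suc.prems in \<open>auto simp: Nminus_Suc\<close>)
  moreover have "\<omega> n = \<omega>' n" using Suc by simp
  ultimately show ?case using Suc.hyps by (simp add: euler_F_Suc)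
qed

lemma euler_dom_Suc:
  assumes "1 \<le> n"
  shows "euler_dom (Suc n) \<phi> \<psi> \<omega> \<longleftrightarrow>
    euler_box n \<phi> \<psi> (\<omega> n) \<and> euler_dom n (\<lambda>i. \<phi> (n + i)) (\<lambda>i. \<psi> (n + i)) \<omega>"
proof -
  have 1: "(\<forall>i\<in>{1..n + m}. P i) \<longleftrightarrow> (\<forall>i\<in>{1..n}. P i) \<and> (\<forall>i\<in>{1..m}. P (n + i))" for P :: "nat \<Rightarrow> bool" and m
  proof (intro iffI conjI ballI; (elim conjE)?)
    fix i assume P: "\<forall>i\<in>{1..n}. P i" "\<forall>i\<in>{1..m}. P (n + i)" "i \<in> {1..n + m}"
    show "P i"
    proof (cases "i \<le> n")
      case False
      then have "i - n \<in> {1..m}" "n + (i - n) = i" using P(3) by auto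
      then show ?thesis using P(2) by metis
    qed (use P in auto)
  qed auto
  have 2: "(\<forall>i\<in>{1..n}. P i) \<longleftrightarrow> P n \<and> (\<forall>i\<in>{1..n - 1}. P i)" for P :: "nat \<Rightarrow> bool"
    using assms by (cases n) (auto simp: atLeastAtMostSuc_conv)
  show ?thesis
    unfolding euler_dom_def euler_box_def Nminus_Suc 1 diff_Suc_1
    by (subst 2[of "\<lambda>i. \<omega> i \<in> _"]) blast
qed

lemma euler_F_SU:
  assumes "1 \<le> N" "euler_dom N \<phi> \<psi> \<omega>"
  shows "euler_F N \<phi> \<psi> \<omega> \<in> SU N"
  using assms
proof (induction N arbitrary: \<phi> \<psi> rule: nat_induct_at_least)
  case base
  then show ?case by simp
next
  case (Suc n)
  have h: "euler_F n (\<lambda>i. \<phi> (n + i)) (\<lambda>i. \<psi> (n + i)) \<omega> \<in> SU n"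
    using Suc euler_dom_Suc by simp
  have "euler_B (Suc n) (Suc n) \<phi> \<psi> \<in> SU (Suc n)"
    using Suc euler_dom_Suc by (intro euler_B_SU) (auto simp: euler_box_def)
  then show ?case
    unfolding euler_F_Suc[OF Suc.hyps] using h ext1_SU_iff[OF SU_carrier[OF h]] Suc.hyps
    by (intro SU_mult euler_E_SU) auto
qed

section \<open>Continuity of the group operations and density of the parametrised elements\<close>

lemma continuous_map_complex_mult:
  fixes f g :: "'a \<Rightarrow> complex"
  assumes "continuous_map X euclidean f" "continuous_map X euclidean g"
  shows "continuous_map X euclidean (\<lambda>x. f x * g x)"
  using assms by (simp add: continuous_map_atin tendsto_mult)

lemma continuous_map_SU_mult:
  assumes F: "continuous_map X (SU_top N) F" and G: "continuous_map X (SU_top N) G"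
  shows "continuous_map X (SU_top N) (\<lambda>x. F x * G x)"
proof (rule continuous_map_SU_into)
  have FS: "F x \<in> SU N" "G x \<in> SU N" if "x \<in> topspace X" for x
    using that F G by (auto simp: continuous_map_into_SU_top)
  show "F x * G x \<in> SU N" if "x \<in> topspace X" for x
    using FS[OF that] by (rule SU_mult)
  fix i j assume ij: "i < N" "j < N"
  have "continuous_map X euclidean (\<lambda>x. \<Sum>k<N. F x $$ (i, k) * G x $$ (k, j))"
    using F G ij by (intro continuous_map_sum continuous_map_complex_mult)
      (auto simp: continuous_map_into_SU_top)
  then show "continuous_map X euclidean (\<lambda>x. (F x * G x) $$ (i, j))"
    by (rule continuous_map_eq)
      (use FS ij in \<open>auto simp: index_mult_sum[of _ N N _ N] SU_carrier\<close>)
qed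

lemma continuous_map_SU_const: "c \<in> SU N \<Longrightarrow> continuous_map X (SU_top N) (\<lambda>_. c)"
  by (simp add: continuous_map_into_SU_top)

lemma continuous_map_ext1: "continuous_map (SU_top n) (SU_top (Suc n)) (ext1 n)"
proof (rule continuous_map_SU_into)
  show "ext1 n h \<in> SU (Suc n)" if "h \<in> topspace (SU_top n)" for h
    using that ext1_SU_iff SU_carrier by simp
  fix i j assume ij: "i < Suc n" "j < Suc n"
  have "continuous_map (SU_top n) euclidean
      (\<lambda>h. if i < n \<and> j < n then h $$ (i, j) else if i = j then 1 else 0)"
    using continuous_map_SU_entry[of i n j] by (cases "i < n \<and> j < n") auto
  then show "continuous_map (SU_top n) euclidean (\<lambda>h. ext1 n h $$ (i, j))"
    by (rule continuous_map_eq) (use ij in \<open>simp add: ext1_index SU_carrier\<close>)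
qed

lemma continuous_map_real_plane:
  fixes a b :: "real \<Rightarrow> complex"
  assumes "p < N" "q < N" "p \<noteq> q" "\<And>y. (cmod (a y))\<^sup>2 + (cmod (b y))\<^sup>2 = 1"
    "continuous_on UNIV a" "continuous_on UNIV b"
  shows "continuous_map euclideanreal (SU_top N) (\<lambda>y. plane N p q (a y) (b y))"
proof (rule continuous_map_SU_into)
  show "plane N p q (a y) (b y) \<in> SU N" for y using assms by (intro plane_SU) auto
  have cif: "continuous_on UNIV (\<lambda>y. if P then f y else g y)"
    if "continuous_on UNIV f" "continuous_on UNIV g" for P and f g :: "real \<Rightarrow> complex"
    using that by (cases P) auto
  fix i j assume "i < N" "j < N"
  then show "continuous_map euclideanreal euclidean (\<lambda>y. plane N p q (a y) (b y) $$ (i, j))"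
    unfolding plane_index[OF \<open>i < N\<close> \<open>j < N\<close>] continuous_map_iff_continuous2
    by (intro cif continuous_on_cnj continuous_on_minus continuous_on_const assms(5,6))
qed

text \<open>Glues angles for the last column to a parameter tuple of SU(n). The recursion of
  \<open>euler_F\<close> shifts \<open>\<phi>\<close> and \<open>\<psi>\<close> by n but passes
  \<open>\<omega>\<close> on unshifted; since the smaller tuple reads \<open>\<omega>\<close> only
  below n, overwriting position n is harmless.\<close>

lemma euler_merge:
  assumes n: "1 \<le> n" and box: "euler_box n \<phi> \<psi> w" and dom: "euler_dom n \<phi>' \<psi>' \<omega>'"
  obtains \<phi>2 \<psi>2 \<omega>2 where "euler_dom (Suc n) \<phi>2 \<psi>2 \<omega>2"
    "euler_F (Suc n) \<phi>2 \<psi>2 \<omega>2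
      = euler_B (Suc n) (Suc n) \<phi> \<psi> * ext1 n (euler_F n \<phi>' \<psi>' \<omega>') * euler_E (Suc n) w"
    "euler_F n (\<lambda>i. \<phi>2 (n + i)) (\<lambda>i. \<psi>2 (n + i)) \<omega>2 = euler_F n \<phi>' \<psi>' \<omega>'"
    "\<And>j. j \<in> {1..n} \<Longrightarrow> \<phi>2 j = \<phi> j" "\<And>j. j \<in> {1..n} \<Longrightarrow> \<psi>2 j = \<psi> j" "\<omega>2 n = w"
proof -
  define \<phi>2 where "\<phi>2 = (\<lambda>i. if i \<le> n then \<phi> i else \<phi>' (i - n))"
  define \<psi>2 where "\<psi>2 = (\<lambda>i. if i \<le> n then \<psi> i else \<psi>' (i - n))"
  define \<omega>2 where "\<omega>2 = \<omega>'(n := w)"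
  have "euler_dom (Suc n) \<phi>2 \<psi>2 \<omega>2"
    unfolding euler_dom_Suc[OF n]
    using box dom by (auto simp: euler_box_def \<phi>2_def \<psi>2_def \<omega>2_def euler_dom_def)
  moreover have F: "euler_F n (\<lambda>i. \<phi>2 (n + i)) (\<lambda>i. \<psi>2 (n + i)) \<omega>2 = euler_F n \<phi>' \<psi>' \<omega>'"
    using n by (intro euler_F_cong) (auto simp: \<phi>2_def \<psi>2_def \<omega>2_def)
  moreover have "euler_B (Suc n) (Suc n) \<phi>2 \<psi>2 = euler_B (Suc n) (Suc n) \<phi> \<psi>"
    by (rule euler_B_cong) (auto simp: \<phi>2_def \<psi>2_def)
  ultimately show ?thesis
    using n by (intro that[of \<phi>2 \<psi>2 \<omega>2]) (auto simp: euler_F_Suc \<phi>2_def \<psi>2_def \<omega>2_def)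
qed

text \<open>Density in the form in which it is used: a closed condition on a continuous function
  passes from parametrised elements to the whole group. If the last column has no zero, the
  decomposition reduces to SU(n). Otherwise an induction on the number of zeros of that column
  approximates g by elements with fewer zeros.\<close>

lemma euler_dense:
  fixes f :: "complex mat \<Rightarrow> 'b :: topological_space"
  assumes "1 \<le> N" "continuous_map (SU_top N) euclidean f" "closed C"
    "\<And>\<phi> \<psi> \<omega>. euler_dom N \<phi> \<psi> \<omega> \<Longrightarrow> f (euler_F N \<phi> \<psi> \<omega>) \<in> C" "g \<in> SU N"
  shows "f g \<in> C"
  using assms(1,2,4,5)
proof (induction N arbitrary: f g rule: nat_induct_at_least)
  case base
  have gc: "g \<in> carrier_mat 1 1" using base SU_carrier by simp
  then have "g $$ (0, 0) = 1" using base.prems(3) det_single[OF gc] by (simp add: SU_def)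
  then have "g = 1\<^sub>m 1" using gc by (intro eq_matI) auto
  then show ?case
    using base.prems(2)[of "\<lambda>_. 0" "\<lambda>_. pi/4" "\<lambda>_. 0"] by (simp add: euler_dom_def Nminus_def)
next
  case (Suc n)
  note cf = Suc.prems(1)
  \<comment> \<open>With the angles of the last column fixed, f becomes a continuous function of the
    block h, to which the outer induction hypothesis applies.\<close>
  have generic: "f g \<in> C" if g: "g \<in> SU (Suc n)" and nz: "\<And>i. i < Suc n \<Longrightarrow> g $$ (i, n) \<noteq> 0" for g
  proof -
    obtain \<phi> \<psi> w where box: "euler_box n \<phi> \<psi> w"
      and col: "\<And>i. i < Suc n \<Longrightarrow> g $$ (i, n) = cis (- w) * euler_V (Suc n) \<phi> \<psi> i"
      using euler_box_exists[of n "\<lambda>i. g $$ (i, n)"] nz SU_col_norm[OF g, of n] by auto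
    have psi: "\<psi> j \<in> {0<..<pi/2}" if "j \<in> {1..n}" for j using box that by (auto simp: euler_box_def)
    obtain h where h: "h \<in> SU n" "g = euler_B (Suc n) (Suc n) \<phi> \<psi> * ext1 n h * euler_E (Suc n) w"
      using euler_decomp[OF g Suc.hyps psi col] by blast
    define f' where "f' = (\<lambda>h. f (euler_B (Suc n) (Suc n) \<phi> \<psi> * ext1 n h * euler_E (Suc n) w))"
    have "euler_B (Suc n) (Suc n) \<phi> \<psi> \<in> SU (Suc n)" using psi by (intro euler_B_SU) auto
    then have "continuous_map (SU_top n) (SU_top (Suc n))
        (\<lambda>h. euler_B (Suc n) (Suc n) \<phi> \<psi> * ext1 n h * euler_E (Suc n) w)"
      using Suc.hyps
      by (intro continuous_map_SU_mult continuous_map_SU_const continuous_map_ext1 euler_E_SU) auto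
    from continuous_map_compose[OF this Suc.prems(1)]
    have "continuous_map (SU_top n) euclidean f'" by (simp add: f'_def o_def)
    moreover have "f' (euler_F n \<phi>' \<psi>' \<omega>') \<in> C" if dom: "euler_dom n \<phi>' \<psi>' \<omega>'" for \<phi>' \<psi>' \<omega>'
    proof -
      obtain \<phi>2 \<psi>2 \<omega>2 where "euler_dom (Suc n) \<phi>2 \<psi>2 \<omega>2"
        "euler_F (Suc n) \<phi>2 \<psi>2 \<omega>2
          = euler_B (Suc n) (Suc n) \<phi> \<psi> * ext1 n (euler_F n \<phi>' \<psi>' \<omega>') * euler_E (Suc n) w"
        by (rule euler_merge[OF Suc.hyps box dom])
      then show ?thesis using Suc.prems(2) unfolding f'_def by metis
    qed
    ultimately have "f' h \<in> C" using Suc.IH h(1) by blast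
    then show ?thesis by (simp add: f'_def h(2))
  qed
  have "f g \<in> C" if "g \<in> SU (Suc n)" "card {i. i < Suc n \<and> g $$ (i, n) = 0} = m" for g m
    using that
  proof (induction m arbitrary: g)
    case 0
    then show ?case using generic by auto
  next
    case (Suc m)
    note g = Suc.prems(1)
    define Z where "Z = (\<lambda>g :: complex mat. {i. i < Suc n \<and> g $$ (i, n) = 0})"
    have fin: "finite (Z g)" for g by (simp add: Z_def)
    from Suc.prems(2) have "Z g \<noteq> {}" unfolding Z_def by (metis card.empty nat.distinct(1))
    then obtain q where q: "q \<in> Z g" by blast
    have "\<exists>p<Suc n. g $$ (p, n) \<noteq> 0"
    proof (rule ccontr)
      assume "\<not> ?thesis"
      then have "(\<Sum>i<Suc n. (cmod (g $$ (i, n)))\<^sup>2) = 0" by simp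
      then show False using SU_col_norm[OF g, of n] by simp
    qed
    then obtain p where p: "p < Suc n" "g $$ (p, n) \<noteq> 0" by blast
    have pq: "q < Suc n" "p \<noteq> q" "g $$ (q, n) = 0" using q p by (auto simp: Z_def)
    \<comment> \<open>Mixing the zero at q with a nonzero entry at p by an angle y in (0, pi/2)
      removes exactly this zero and creates no new one; y = 0 gives g back, so g is a limit of such
      elements.\<close>
    define R where "R = (\<lambda>y. plane (Suc n) p q (complex_of_real (cos y)) (complex_of_real (sin y)) * g)"
    have cR: "continuous_map euclideanreal (SU_top (Suc n)) R"
      unfolding R_def using p pq g
      by (intro continuous_map_SU_mult continuous_map_SU_const continuous_map_real_plane)
        (auto intro!: continuous_intros)
    have "f (R y) \<in> C" if y: "y \<in> {0<..<pi/2}" for y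
    proof (rule Suc.IH)
      show RS: "R y \<in> SU (Suc n)" using cR by (auto simp: continuous_map_into_SU_top)
      have cs: "cos y \<noteq> 0" "sin y \<noteq> 0" using y cos_gt_zero[of y] sin_gt_zero[of y] by auto
      have Rcol: "R y $$ (i, n) = (if i = p then cos y * g $$ (p, n) else if i = q then - sin y * g $$ (p, n) else g $$ (i, n))"
        if "i < Suc n" for i
        unfolding R_def using that p pq SU_carrier[OF g] by (subst plane_mult_left) auto
      have "Z (R y) = Z g - {q}" unfolding Z_def using p pq cs by (auto simp: Rcol split: if_splits)
      moreover have "card (Z g) = Suc m" using Suc.prems(2) by (simp add: Z_def)
      ultimately have "card (Z (R y)) = m" using q fin[of g] by simp
      then show "card {i. i < Suc n \<and> R y $$ (i, n) = 0} = m" by (simp add: Z_def)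
    qed
    moreover have "closed ((\<lambda>y. f (R y)) -` C)"
    proof (rule continuous_closed_vimage[OF assms(3)])
      have "continuous_map euclideanreal euclidean (f \<circ> R)"
        by (rule continuous_map_compose[OF cR cf])
      then show "isCont (\<lambda>y. f (R y)) x" for x
        by (simp add: o_def continuous_on_eq_continuous_at)
    qed
    ultimately have "closure {0<..<pi/2} \<subseteq> (\<lambda>y. f (R y)) -` C"
      by (intro closure_minimal) auto
    then have "f (R 0) \<in> C" by (auto simp: closure_greaterThanLessThan dest!: subsetD[of _ _ 0])
    moreover have "R 0 = g"
      unfolding R_def using p pq SU_carrier[OF g]
      by (intro eq_matI) (auto simp: plane_mult_left[of p "Suc n" q _ "Suc n"] simp del: index_mult_mat(1))
    ultimately show ?case by simp
  qed
  then show ?case using Suc.prems(3) by blast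
qed

section \<open>Moments and the beta law\<close>

text \<open>Expand \<open>E[|cos y w\<^sub>1 + sin y w\<^sub>2|\<^bsup>2n\<^esup> X]\<close> binomially: phase invariance kills the mixed
  terms, and the term of first order in \<open>1 - cos\<^sup>2 y\<close> gives the claim.\<close>
lemma (in prob_space) pair_moment:
  fixes w1 w2 :: "'a \<Rightarrow> complex" and X :: "'a \<Rightarrow> real"
  assumes [measurable]: "w1 \<in> borel_measurable M" "w2 \<in> borel_measurable M" "X \<in> borel_measurable M"
    and bound: "\<And>x. x \<in> space M \<Longrightarrow> cmod (w1 x) \<le> 1" "\<And>x. x \<in> space M \<Longrightarrow> cmod (w2 x) \<le> 1"
      "\<And>x. x \<in> space M \<Longrightarrow> \<bar>X x\<bar> \<le> K"
    and rot: "\<And>y. (LINT x|M. cmod (complex_of_real (cos y) * w1 x + complex_of_real (sin y) * w2 x) ^ (2 * n) * X x)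
        = (LINT x|M. cmod (w1 x) ^ (2 * n) * X x)"
    and phase: "\<And>\<theta> i j. (LINT x|M. (cis \<theta> * w1 x) ^ i * (cis (- \<theta>) * w2 x) ^ (n - i)
          * cnj ((cis \<theta> * w1 x) ^ j * (cis (- \<theta>) * w2 x) ^ (n - j)) * X x)
        = (LINT x|M. w1 x ^ i * w2 x ^ (n - i) * cnj (w1 x ^ j * w2 x ^ (n - j)) * X x)"
    and n: "n \<ge> 1"
  shows "n * (LINT x|M. cmod (w1 x) ^ (2 * (n - 1)) * (cmod (w2 x))\<^sup>2 * X x)
    = (LINT x|M. cmod (w1 x) ^ (2 * n) * X x)"
proof -
  define G where "G = (\<lambda>i j. LINT x|M. w1 x ^ i * w2 x ^ (n - i) * cnj (w1 x ^ j * w2 x ^ (n - j)) * X x)"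
  define e where "e = (\<lambda>i. LINT x|M. cmod (w1 x) ^ (2 * i) * cmod (w2 x) ^ (2 * (n - i)) * X x)"
  have int: "integrable M (\<lambda>x. w1 x ^ i * w2 x ^ k * cnj (w1 x ^ j * w2 x ^ l) * X x)" for i j k l
  proof (rule integrable_const_bound[where B = K])
    show "AE x in M. norm (w1 x ^ i * w2 x ^ k * cnj (w1 x ^ j * w2 x ^ l) * X x) \<le> K"
    proof (rule AE_I2)
      fix x assume x: "x \<in> space M"
      have "norm (w1 x ^ i * w2 x ^ k * cnj (w1 x ^ j * w2 x ^ l) * X x)
        = cmod (w1 x) ^ i * cmod (w2 x) ^ k * (cmod (w1 x) ^ j * cmod (w2 x) ^ l) * \<bar>X x\<bar>"
        by (simp add: norm_mult norm_power)
      also have "\<dots> \<le> 1 * 1 * (1 * 1) * K"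
        using bound[OF x] by (intro mult_mono power_le_one mult_nonneg_nonneg) auto
      finally show "norm (w1 x ^ i * w2 x ^ k * cnj (w1 x ^ j * w2 x ^ l) * X x) \<le> K" by simp
    qed
    have [measurable]: "cnj \<in> borel_measurable borel"
      by (intro borel_measurable_continuous_onI continuous_on_cnj continuous_on_id)
    show "(\<lambda>x. w1 x ^ i * w2 x ^ k * cnj (w1 x ^ j * w2 x ^ l) * X x) \<in> borel_measurable M"
      by measurable
  qed
  have diag: "G i i = of_real (e i)" for i
  proof -
    have n2: "complex_of_real (cmod z ^ (2 * k)) = z ^ k * cnj z ^ k" for z k
      by (simp add: power_mult complex_norm_square[unfolded of_real_power] power_mult_distrib)
    have "w1 x ^ i * w2 x ^ (n - i) * cnj (w1 x ^ i * w2 x ^ (n - i)) * X x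
        = of_real (cmod (w1 x) ^ (2 * i) * cmod (w2 x) ^ (2 * (n - i)) * X x)" for x
      unfolding of_real_mult n2 by (simp add: mult_ac)
    then have "G i i = (LINT x|M. of_real (cmod (w1 x) ^ (2 * i) * cmod (w2 x) ^ (2 * (n - i)) * X x))"
      unfolding G_def by (rule Bochner_Integration.integral_cong[OF refl])
    then show ?thesis unfolding e_def by (simp del: of_real_mult of_real_power)
  qed
  have off: "G i j = 0" if "i \<noteq> j" "i \<le> n" "j \<le> n" for i j
  proof -
    define d where "d = real i - real j"
    \<comment> \<open>The substitution multiplies the mixed moment by cis (2 d
      \<open>\<theta>\<close>), and this choice of angle makes the factor -1.\<close>
    define \<theta> where "\<theta> = pi / (2 * d)"
    have d: "d \<noteq> 0" using that by (simp add: d_def)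
    have "G i j = (LINT x|M. (cis \<theta> * w1 x) ^ i * (cis (- \<theta>) * w2 x) ^ (n - i)
          * cnj ((cis \<theta> * w1 x) ^ j * (cis (- \<theta>) * w2 x) ^ (n - j)) * X x)"
      unfolding G_def by (rule phase[symmetric])
    also have "\<dots> = (LINT x|M. - (w1 x ^ i * w2 x ^ (n - i) * cnj (w1 x ^ j * w2 x ^ (n - j)) * X x))"
    proof (rule Bochner_Integration.integral_cong[OF refl])
      fix x
      have "cis \<theta> ^ i * cis (- \<theta>) ^ (n - i) * cnj (cis \<theta> ^ j * cis (- \<theta>) ^ (n - j))
          = cis (i * \<theta> + (n - i) * (- \<theta>) + (j * (- \<theta>) + (n - j) * \<theta>))"
        by (simp only: complex_cnj_mult complex_cnj_power cis_cnj Complex.DeMoivre cis_mult) (simp add: algebra_simps)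
      also have "i * \<theta> + (n - i) * (- \<theta>) + (j * (- \<theta>) + (n - j) * \<theta>) = 2 * d * \<theta>"
        using that by (simp add: d_def of_nat_diff algebra_simps)
      also have "\<dots> = pi" using d by (simp add: \<theta>_def)
      finally have "cis \<theta> ^ i * cis (- \<theta>) ^ (n - i) * cnj (cis \<theta> ^ j * cis (- \<theta>) ^ (n - j)) = - 1"
        by simp
      then have "cis \<theta> ^ i * cis (- \<theta>) ^ (n - i) * cnj (cis \<theta> ^ j * cis (- \<theta>) ^ (n - j))
          * (w1 x ^ i * w2 x ^ (n - i) * cnj (w1 x ^ j * w2 x ^ (n - j)) * X x)
          = - (w1 x ^ i * w2 x ^ (n - i) * cnj (w1 x ^ j * w2 x ^ (n - j)) * X x)"
        by (simp only: mult_minus1)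
      then show "(cis \<theta> * w1 x) ^ i * (cis (- \<theta>) * w2 x) ^ (n - i)
          * cnj ((cis \<theta> * w1 x) ^ j * (cis (- \<theta>) * w2 x) ^ (n - j)) * X x
          = - (w1 x ^ i * w2 x ^ (n - i) * cnj (w1 x ^ j * w2 x ^ (n - j)) * X x)"
        by (simp add: power_mult_distrib mult_ac)
    qed
    also have "\<dots> = - G i j" unfolding G_def by simp
    finally show ?thesis by simp
  qed
  \<comment> \<open>With t = (cos y)^2 only the diagonal moments survive. The result is an identity
    between polynomials in t on [0, 1].\<close>
  have key: "(\<Sum>i\<le>n. (n choose i)\<^sup>2 * (t ^ i * (1 - t) ^ (n - i)) * e i) = e n" if t: "t \<in> {0..1}" for t :: real
  proof -
    obtain y where y: "(cos y)\<^sup>2 = t" "(sin y)\<^sup>2 = 1 - t"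
    proof -
      have "- 1 \<le> sqrt t" "sqrt t \<le> 1" using t by (auto intro: order_trans[of _ 0])
      then have "(cos (arccos (sqrt t)))\<^sup>2 = t" using t by (simp add: cos_arccos)
      then show ?thesis using that by (simp add: sin_squared_eq)
    qed
    define b where "b = (\<lambda>i. of_nat (n choose i) * complex_of_real (cos y ^ i * sin y ^ (n - i)))"
    have "of_real (e n) = (LINT x|M. complex_of_real (cmod (complex_of_real (cos y) * w1 x + complex_of_real (sin y) * w2 x) ^ (2 * n) * X x))"
      unfolding e_def using rot[of y] by (simp del: of_real_mult of_real_power)
    also have "\<dots> = (LINT x|M. (\<Sum>i\<le>n. \<Sum>j\<le>n. b i * b j *
        (w1 x ^ i * w2 x ^ (n - i) * cnj (w1 x ^ j * w2 x ^ (n - j)) * X x)))"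
    proof (rule Bochner_Integration.integral_cong[OF refl])
      fix x
      define v where "v = complex_of_real (cos y) * w1 x + complex_of_real (sin y) * w2 x"
      have vn: "v ^ n = (\<Sum>i\<le>n. b i * (w1 x ^ i * w2 x ^ (n - i)))"
        unfolding v_def binomial_ring
        by (intro sum.cong) (auto simp: b_def power_mult_distrib)
      have "complex_of_real (cmod v ^ (2 * n)) = v ^ n * cnj (v ^ n)"
        by (simp add: power_mult complex_norm_square[unfolded of_real_power] power_mult_distrib)
      also have "cnj (v ^ n) = (\<Sum>j\<le>n. b j * cnj (w1 x ^ j * w2 x ^ (n - j)))"
        unfolding vn by (simp add: b_def)
      also have "v ^ n * \<dots> = (\<Sum>i\<le>n. \<Sum>j\<le>n. b i * b j *
        (w1 x ^ i * w2 x ^ (n - i) * cnj (w1 x ^ j * w2 x ^ (n - j))))"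
        unfolding vn sum_product by (intro sum.cong refl) (simp add: mult_ac)
      finally show "complex_of_real (cmod (complex_of_real (cos y) * w1 x + complex_of_real (sin y) * w2 x) ^ (2 * n) * X x)
        = (\<Sum>i\<le>n. \<Sum>j\<le>n. b i * b j * (w1 x ^ i * w2 x ^ (n - i) * cnj (w1 x ^ j * w2 x ^ (n - j)) * X x))"
        unfolding v_def[symmetric] by (simp add: sum_distrib_right mult.assoc)
    qed
    also have "\<dots> = (\<Sum>i\<le>n. \<Sum>j\<le>n. b i * b j * G i j)"
      unfolding G_def using int
      by (subst Bochner_Integration.integral_sum; (intro sum.cong refl)?)
        (auto intro!: Bochner_Integration.integrable_sum integrable_mult_right
          simp: Bochner_Integration.integral_sum)
    also have "\<dots> = (\<Sum>i\<le>n. b i * b i * G i i)"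
    proof (rule sum.cong[OF refl])
      fix i assume i: "i \<in> {..n}"
      have "(\<Sum>j\<le>n. b i * b j * G i j) = (\<Sum>j\<le>n. if j = i then b i * b i * G i i else 0)"
        using off i by (intro sum.cong) auto
      then show "(\<Sum>j\<le>n. b i * b j * G i j) = b i * b i * G i i" using i by simp
    qed
    also have "\<dots> = of_real (\<Sum>i\<le>n. (n choose i)\<^sup>2 * (t ^ i * (1 - t) ^ (n - i)) * e i)"
    proof -
      have "b i * b i = of_real ((n choose i)\<^sup>2 * (t ^ i * (1 - t) ^ (n - i)))" for i
      proof -
        define P where "P = cos y ^ i * sin y ^ (n - i)"
        have "P * P = ((cos y)\<^sup>2) ^ i * ((sin y)\<^sup>2) ^ (n - i)"
          by (simp only: P_def power2_eq_square power_mult_distrib mult_ac)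
        then have "P * P = t ^ i * (1 - t) ^ (n - i)" by (simp only: y)
        moreover have "b i * b i = of_real ((n choose i)\<^sup>2 * (P * P))"
          unfolding b_def P_def[symmetric] by (simp add: power2_eq_square mult_ac)
        ultimately show ?thesis by (simp only:)
      qed
      then show ?thesis by (simp add: diag)
    qed
    finally show ?thesis using of_real_eq_iff by metis
  qed
  obtain m where m: "n = Suc m" using n by (cases n) auto
  \<comment> \<open>The term i = n of \<open>key\<close> is t^n e(n). Moving it to the right and
    dividing by 1 - t gives P = Q for t < 1. The limit t -> 1, where only the summand i = n - 1 of P
    survives, reads n^2 e(n - 1) = n e(n).\<close>
  define P where "P = (\<lambda>t::real. \<Sum>i\<le>m. (n choose i)\<^sup>2 * (t ^ i * (1 - t) ^ (m - i)) * e i)"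
  define Q where "Q = (\<lambda>t::real. e n * (\<Sum>i<n. t ^ i))"
  have PQ: "P t = Q t" if t: "t \<in> {0..<1}" for t
  proof -
    have "(1 - t) * P t = (\<Sum>i\<le>m. (n choose i)\<^sup>2 * (t ^ i * (1 - t) ^ (n - i)) * e i)"
      unfolding P_def sum_distrib_left by (intro sum.cong) (auto simp: m Suc_diff_le mult_ac)
    also have "\<dots> = e n - t ^ n * e n"
      using key[of t] t by (simp add: m)
    also have "\<dots> = e n * (1 - t ^ n)" by (simp add: algebra_simps)
    also have "\<dots> = (1 - t) * Q t" unfolding one_diff_power_eq Q_def by simp
    finally show ?thesis using t by simp
  qed
  have "(P \<longlongrightarrow> P 1) (at_left 1)" unfolding P_def by (intro tendsto_intros)
  moreover have "(Q \<longlongrightarrow> Q 1) (at_left 1)" unfolding Q_def by (intro tendsto_intros)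
  moreover have "eventually (\<lambda>t. Q t = P t) (at_left 1)"
    unfolding eventually_at_left_field by (intro exI[of _ 0]) (use PQ in auto)
  ultimately have "P 1 = Q 1"
    using tendsto_unique[OF trivial_limit_at_left_real, of Q] tendsto_cong[of Q P "at_left 1" "P 1"] by blast
  moreover have "P 1 = n\<^sup>2 * e m"
  proof -
    have "P 1 = (\<Sum>i\<le>m. if i = m then n\<^sup>2 * e m else 0)"
      unfolding P_def by (intro sum.cong) (auto simp: m power_0_left)
    then show ?thesis by simp
  qed
  moreover have "Q 1 = n * e n" by (simp add: Q_def)
  ultimately have "n * e m = e n" using n by (simp add: power2_eq_square)
  then show ?thesis by (simp add: e_def m)
qed

text \<open>The mean of h under the density j s^(j-1) on [0, 1], that is the Beta(j, 1) law, after
  the substitution s = x^2; the variable x is the one that occurs in \<open>I_int\<close>.\<close>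

definition beta_int :: "nat \<Rightarrow> (real \<Rightarrow> real) \<Rightarrow> real" where
  "beta_int j h = (LINT x:{0..1}|lborel. h (x\<^sup>2) * (2 * real j * x ^ (2 * j - 1)))"

lemma beta_integrable:
  assumes "continuous_on {0..1} h"
  shows "set_integrable lborel {0..1} (\<lambda>x::real. h (x\<^sup>2) * (2 * real j * x ^ (2 * j - 1)))"
proof (rule borel_integrable_atLeastAtMost')
  have "continuous_on {0..1} (\<lambda>x::real. h (x\<^sup>2))"
    by (rule continuous_on_compose2[OF assms]) (auto intro!: continuous_intros power_le_one)
  then show "continuous_on {0..1} (\<lambda>x::real. h (x\<^sup>2) * (2 * real j * x ^ (2 * j - 1)))"
    by (intro continuous_intros)
qed

lemma continuous_on_power_diff: "continuous_on S (\<lambda>s::real. (1 - s) ^ b)"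
  by (intro continuous_intros)

lemma beta_int_FTC:
  assumes "\<And>x. 0 \<le> x \<Longrightarrow> x \<le> 1 \<Longrightarrow> (F has_real_derivative h (x\<^sup>2) * (2 * real j * x ^ (2 * j - 1))) (at x)"
    and "continuous_on {0..1} h"
  shows "beta_int j h = F 1 - F 0"
proof -
  have c: "continuous_on {0..1} (\<lambda>x::real. h (x\<^sup>2) * (2 * real j * x ^ (2 * j - 1)))"
  proof -
    have "continuous_on {0..1} (\<lambda>x::real. h (x\<^sup>2))"
      by (rule continuous_on_compose2[OF assms(2)]) (auto intro!: continuous_intros power_le_one)
    then show ?thesis by (intro continuous_intros)
  qed
  have "(LINT x|lborel. indicator {0..1} x *\<^sub>R (h (x\<^sup>2) * (2 * real j * x ^ (2 * j - 1)))) = F 1 - F 0"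
    by (rule integral_FTC_atLeastAtMost[OF _ _ c])
      (use assms(1) in \<open>auto simp: has_real_derivative_iff_has_vector_derivative
        intro: has_vector_derivative_at_within\<close>)
  then show ?thesis by (simp add: beta_int_def set_lebesgue_integral_def)
qed

text \<open>The case a = 0 says that the weight has total mass 1. The decay in a is what later shows
  that coordinates vanish only on a null set.\<close>

lemma beta_int_power:
  assumes "j \<ge> 1"
  shows "beta_int j (\<lambda>s. s ^ a) = j / (a + j)"
proof -
  have "beta_int j (\<lambda>s. s ^ a) = j / (a + j) * 1 ^ (2 * (a + j)) - j / (a + j) * 0 ^ (2 * (a + j))"
  proof (rule beta_int_FTC)
    fix x :: real
    have nz: "real a + real j \<noteq> 0" using assms by linarith
    have "((\<lambda>x. j / (a + j) * x ^ (2 * (a + j))) has_real_derivative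
        j / (a + j) * ((2 * (a + j)) * x ^ (2 * (a + j) - 1))) (at x)"
      using nz by (auto intro!: derivative_eq_intros)
    also have "j / (a + j) * ((2 * (a + j)) * x ^ (2 * (a + j) - 1)) = (x\<^sup>2) ^ a * (2 * real j * x ^ (2 * j - 1))"
    proof -
      have "2 * (a + j) - 1 = 2 * a + (2 * j - 1)" using assms by simp
      then have "x ^ (2 * (a + j) - 1) = (x\<^sup>2) ^ a * x ^ (2 * j - 1)"
        by (simp add: power_add power_mult)
      then show ?thesis using nz by (simp add: field_simps)
    qed
    finally show "((\<lambda>x. j / (a + j) * x ^ (2 * (a + j))) has_real_derivative
        (x\<^sup>2) ^ a * (2 * real j * x ^ (2 * j - 1))) (at x)" .
  qed (intro continuous_intros)
  then show ?thesis using assms by simp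
qed

lemma beta_int_moment_rec:
  assumes j: "j \<ge> 1"
  shows "(Suc a + j) * beta_int j (\<lambda>s. (1 - s) ^ Suc a) = Suc a * beta_int j (\<lambda>s. (1 - s) ^ a)"
proof -
  define f where "f = (\<lambda>s::real. (Suc a + j) * (1 - s) ^ Suc a - Suc a * (1 - s) ^ a)"
  \<comment> \<open>The primitive j (1 - x^2)^(a+1) x^(2j) vanishes at both ends, at 0 because j is
    positive. The recursion is an integration by parts, arranged to agree with the one found on the
    group.\<close>
  have "beta_int j f = real j * (1 - 1\<^sup>2) ^ Suc a * 1 ^ (2 * j) - real j * (1 - 0\<^sup>2) ^ Suc a * 0 ^ (2 * j)"
  proof (rule beta_int_FTC)
    fix x :: real
    have e: "x ^ (2 * j) = x * x ^ (2 * j - 1)"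
    proof -
      have "2 * j = Suc (2 * j - 1)" using j by simp
      then show ?thesis by (metis power_Suc)
    qed
    have "((\<lambda>x. 1 - x\<^sup>2) has_real_derivative (- 2 * x)) (at x)"
      by (auto intro!: derivative_eq_intros)
    note d1 = DERIV_power_Suc[OF this, of a]
    have d2: "((\<lambda>x. x ^ (2 * j)) has_real_derivative (2 * j * x ^ (2 * j - 1))) (at x)"
      by (auto intro!: derivative_eq_intros)
    have "((\<lambda>x. real j * (1 - x\<^sup>2) ^ Suc a * x ^ (2 * j)) has_real_derivative
        j * (Suc a * (1 - x\<^sup>2) ^ a * (- 2 * x)) * x ^ (2 * j)
          + j * (1 - x\<^sup>2) ^ Suc a * (2 * real j * x ^ (2 * j - 1))) (at x)"
      by (rule DERIV_cong[OF DERIV_mult[OF DERIV_cmult[OF d1] d2]]) (simp add: algebra_simps)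
    also have "j * (Suc a * (1 - x\<^sup>2) ^ a * (- 2 * x)) * x ^ (2 * j)
          + j * (1 - x\<^sup>2) ^ Suc a * (2 * real j * x ^ (2 * j - 1))
        = f (x\<^sup>2) * (2 * real j * x ^ (2 * j - 1))"
      unfolding e f_def by (simp add: algebra_simps power2_eq_square)
    finally show "((\<lambda>x. real j * (1 - x\<^sup>2) ^ Suc a * x ^ (2 * j)) has_real_derivative
        f (x\<^sup>2) * (2 * real j * x ^ (2 * j - 1))) (at x)" .
  qed (auto simp: f_def intro!: continuous_intros)
  then have "beta_int j f = 0" using j by simp
  moreover have "beta_int j f = (Suc a + j) * beta_int j (\<lambda>s. (1 - s) ^ Suc a) - Suc a * beta_int j (\<lambda>s. (1 - s) ^ a)"
  proof -
    have i: "set_integrable lborel {0..1} (\<lambda>x::real. c * ((1 - x\<^sup>2) ^ b * (2 * real j * x ^ (2 * j - 1))))" for b c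
      using beta_integrable[OF continuous_on_power_diff[of _ b], of j]
      by (intro set_integrable_mult_right)
    have "beta_int j f = (LINT x:{0..1}|lborel. (Suc a + j) * ((1 - x\<^sup>2) ^ Suc a * (2 * real j * x ^ (2 * j - 1)))
        - Suc a * ((1 - x\<^sup>2) ^ a * (2 * real j * x ^ (2 * j - 1))))"
      unfolding beta_int_def f_def by (simp add: algebra_simps)
    also have "\<dots> = (LINT x:{0..1}|lborel. (Suc a + j) * ((1 - x\<^sup>2) ^ Suc a * (2 * real j * x ^ (2 * j - 1))))
        - (LINT x:{0..1}|lborel. Suc a * ((1 - x\<^sup>2) ^ a * (2 * real j * x ^ (2 * j - 1))))"
      by (rule set_integral_diff(2)[OF i i])
    finally show ?thesis by (simp add: beta_int_def)
  qed
  ultimately show ?thesis by simp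
qed

lemma beta_int_bound:
  assumes j: "j \<ge> 1" and h: "continuous_on {0..1} h" and b: "\<And>s. s \<in> {0..1} \<Longrightarrow> \<bar>h s\<bar> \<le> B"
  shows "\<bar>beta_int j h\<bar> \<le> B"
proof -
  define \<rho> where "\<rho> = (\<lambda>x::real. 2 * real j * x ^ (2 * j - 1))"
  have "\<bar>beta_int j h\<bar> \<le> (LINT x:{0..1}|lborel. \<bar>h (x\<^sup>2) * \<rho> x\<bar>)"
    unfolding beta_int_def \<rho>_def[symmetric]
    using set_integral_norm_bound[OF beta_integrable[OF h, of j]] by (simp add: \<rho>_def)
  also have "\<dots> \<le> (LINT x:{0..1}|lborel. B * \<rho> x)"
  proof (rule set_integral_mono)
    show "set_integrable lborel {0..1} (\<lambda>x. \<bar>h (x\<^sup>2) * \<rho> x\<bar>)"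
      using set_integrable_abs[OF beta_integrable[OF h, of j]] by (simp add: \<rho>_def)
    show "set_integrable lborel {0..1} (\<lambda>x. B * \<rho> x)"
      using beta_integrable[of "\<lambda>_. B" j] by (simp add: \<rho>_def)
    fix x :: real assume x: "x \<in> {0..1}"
    then have "0 \<le> \<rho> x" "x\<^sup>2 \<in> {0..1}" by (auto simp: \<rho>_def power_le_one)
    then show "\<bar>h (x\<^sup>2) * \<rho> x\<bar> \<le> B * \<rho> x" using b by (simp add: abs_mult mult_right_mono)
  qed
  also have "\<dots> = B * beta_int j (\<lambda>s. s ^ 0)"
    by (simp add: beta_int_def \<rho>_def)
  finally show ?thesis using beta_int_power[OF j, of 0] j by simp
qed

lemma beta_int_diff:
  assumes "continuous_on {0..1} h" "continuous_on {0..1} h'"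
  shows "beta_int j h - beta_int j h' = beta_int j (\<lambda>s. h s - h' s)"
  unfolding beta_int_def left_diff_distrib
  by (rule set_integral_diff(2)[symmetric]) (intro beta_integrable assms)+

lemma beta_int_sum:
  fixes c :: "nat \<Rightarrow> real"
  shows "beta_int j (\<lambda>s. \<Sum>i\<le>m. c i * (1 - s) ^ i) = (\<Sum>i\<le>m. c i * beta_int j (\<lambda>s. (1 - s) ^ i))"
proof -
  have i: "set_integrable lborel {0..1} (\<lambda>x::real. c b * ((1 - x\<^sup>2) ^ b * (2 * real j * x ^ (2 * j - 1))))" for b
    using beta_integrable[OF continuous_on_power_diff[of _ b], of j]
    by (intro set_integrable_mult_right)
  have "beta_int j (\<lambda>s. \<Sum>i\<le>m. c i * (1 - s) ^ i)
    = (LINT x:{0..1}|lborel. \<Sum>i\<le>m. c i * ((1 - x\<^sup>2) ^ i * (2 * real j * x ^ (2 * j - 1))))"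
    unfolding beta_int_def by (simp add: sum_distrib_right mult.assoc)
  also have "\<dots> = (\<Sum>i\<le>m. LINT x:{0..1}|lborel. c i * ((1 - x\<^sup>2) ^ i * (2 * real j * x ^ (2 * j - 1))))"
    unfolding set_lebesgue_integral_def scaleR_sum_right
    by (rule Bochner_Integration.integral_sum) (use i in \<open>auto simp: set_integrable_def\<close>)
  finally show ?thesis by (simp add: beta_int_def)
qed

text \<open>The recursion fixes all moments of u weighted by X, and polynomials are dense in the
  continuous functions on [0, 1]. The weight X is carried along because splitting it off amounts to
  independence.\<close>

lemma (in prob_space) beta_law:
  fixes u X :: "'a \<Rightarrow> real"
  assumes [measurable]: "u \<in> borel_measurable M" "X \<in> borel_measurable M"
    and u: "\<And>x. x \<in> space M \<Longrightarrow> u x \<in> {0..1}" and X: "\<And>x. x \<in> space M \<Longrightarrow> \<bar>X x\<bar> \<le> K"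
    and j: "j \<ge> 1"
    and rec: "\<And>a. (Suc a + j) * (LINT x|M. u x ^ Suc a * X x) = Suc a * (LINT x|M. u x ^ a * X x)"
    and h: "continuous_on {0..1} h"
  shows "(LINT x|M. h (1 - u x) * X x) = beta_int j h * (LINT x|M. X x)"
proof -
  have K: "0 \<le> K"
  proof -
    obtain x where "x \<in> space M" using not_empty by blast
    then show ?thesis using X[of x] by linarith
  qed
  have mom: "(LINT x|M. u x ^ a * X x) = beta_int j (\<lambda>s. (1 - s) ^ a) * (LINT x|M. X x)" for a
  proof (induction a)
    case 0
    then show ?case using beta_int_power[OF j, of 0] j by simp
  next
    case (Suc a)
    have "(Suc a + j) * (LINT x|M. u x ^ Suc a * X x)
        = (Suc a + j) * (beta_int j (\<lambda>s. (1 - s) ^ Suc a) * (LINT x|M. X x))"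
      using rec[of a] beta_int_moment_rec[OF j, of a] Suc by (metis mult.assoc)
    then show ?case using j by simp
  qed
  have h1: "continuous_on {0..1} (\<lambda>v. h (1 - v))"
    by (rule continuous_on_compose2[OF h]) (auto intro!: continuous_intros)
  have hm: "(\<lambda>x. h (1 - u x)) \<in> borel_measurable M"
  proof -
    have "(\<lambda>v. indicator {0..1} v *\<^sub>R h v) \<in> borel_measurable borel"
      by (rule borel_measurable_continuous_on_indicator[OF _ h]) simp
    then have "(\<lambda>x. indicator {0..1} (1 - u x) *\<^sub>R h (1 - u x)) \<in> borel_measurable M"
      by measurable
    also have "?this \<longleftrightarrow> ?thesis" using u by (intro measurable_cong) auto
    finally show ?thesis .
  qed
  obtain B where B: "\<And>s. s \<in> {0..1} \<Longrightarrow> \<bar>h s\<bar> \<le> B"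
  proof -
    have "bounded (h ` {0..1})" by (intro compact_imp_bounded compact_continuous_image h compact_Icc)
    then obtain a where "\<forall>x\<in>h ` {0..1}. norm x \<le> a" by (auto simp: bounded_iff)
    then show ?thesis using that[of a] by auto
  qed
  have inth: "integrable M (\<lambda>x. h (1 - u x) * X x)"
  proof (rule integrable_const_bound[where B = "B * K"])
    show "AE x in M. norm (h (1 - u x) * X x) \<le> B * K"
    proof (rule AE_I2)
      fix x assume x: "x \<in> space M"
      then have "\<bar>h (1 - u x)\<bar> \<le> B" using B u by simp
      then show "norm (h (1 - u x) * X x) \<le> B * K" using X[OF x] by (auto simp: abs_mult intro!: mult_mono)
    qed
  qed (use hm in measurable)
  have intp: "integrable M (\<lambda>x. u x ^ i * X x)" for i
  proof (rule integrable_const_bound[where B = K])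
    show "AE x in M. norm (u x ^ i * X x) \<le> K"
    proof (rule AE_I2)
      fix x assume x: "x \<in> space M"
      have "\<bar>u x ^ i\<bar> * \<bar>X x\<bar> \<le> 1 * K"
        using u[OF x] X[OF x] by (intro mult_mono) (auto simp: power_abs intro!: power_le_one)
      then show "norm (u x ^ i * X x) \<le> K" by (simp add: abs_mult)
    qed
  qed measurable
  \<comment> \<open>Replacing h by an approximating polynomial costs at most
    \<open>\<epsilon>\<close> K in the expectation and again in the beta integral, whose weight has
    mass 1.\<close>
  have "\<bar>(LINT x|M. h (1 - u x) * X x) - beta_int j h * (LINT x|M. X x)\<bar> \<le> \<epsilon> * (2 * K)" if \<epsilon>: "\<epsilon> > 0" for \<epsilon>
  proof -
    obtain p where p: "real_polynomial_function p" "\<And>v. v \<in> {0..1} \<Longrightarrow> \<bar>h (1 - v) - p v\<bar> < \<epsilon>"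
      using Stone_Weierstrass_real_polynomial_function[OF compact_Icc h1 \<epsilon>] by blast
    then obtain c m where c: "p = (\<lambda>x. \<Sum>i\<le>m. c i * x ^ i)" by (auto simp: real_polynomial_function_iff_sum)
    have intpp: "integrable M (\<lambda>x. p (u x) * X x)"
      unfolding c sum_distrib_right mult.assoc using intp by auto
    have "(LINT x|M. p (u x) * X x) = (\<Sum>i\<le>m. c i * (LINT x|M. u x ^ i * X x))"
      unfolding c sum_distrib_right mult.assoc using intp by simp
    also have "\<dots> = beta_int j (\<lambda>s. p (1 - s)) * (LINT x|M. X x)"
      unfolding c beta_int_sum by (simp add: mom sum_distrib_right mult.assoc)
    finally have P: "(LINT x|M. p (u x) * X x) = beta_int j (\<lambda>s. p (1 - s)) * (LINT x|M. X x)" .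
    have cp: "continuous_on {0..1} (\<lambda>s. p (1 - s))" unfolding c by (intro continuous_intros)
    have "\<bar>(LINT x|M. h (1 - u x) * X x) - (LINT x|M. p (u x) * X x)\<bar> = \<bar>LINT x|M. (h (1 - u x) - p (u x)) * X x\<bar>"
      using inth intpp by (simp add: left_diff_distrib)
    also have "\<dots> \<le> (LINT x|M. \<epsilon> * K)"
    proof (rule order_trans[OF integral_abs_bound], rule integral_mono_AE)
      show "AE x in M. \<bar>(h (1 - u x) - p (u x)) * X x\<bar> \<le> \<epsilon> * K"
      proof (rule AE_I2)
        fix x assume x: "x \<in> space M"
        show "\<bar>(h (1 - u x) - p (u x)) * X x\<bar> \<le> \<epsilon> * K"
          unfolding abs_mult using p(2)[OF u[OF x]] X[OF x] \<epsilon> by (intro mult_mono) auto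
      qed
      show "integrable M (\<lambda>x. \<bar>(h (1 - u x) - p (u x)) * X x\<bar>)"
        using inth intpp by (intro integrable_abs) (simp add: left_diff_distrib)
    qed simp
    finally have 1: "\<bar>(LINT x|M. h (1 - u x) * X x) - (LINT x|M. p (u x) * X x)\<bar> \<le> \<epsilon> * K"
      by (simp add: prob_space)
    have "\<bar>beta_int j h - beta_int j (\<lambda>s. p (1 - s))\<bar> \<le> \<epsilon>"
      unfolding beta_int_diff[OF h cp]
      by (rule beta_int_bound[OF j]) (use p(2)[of "1 - _"] in \<open>auto intro!: continuous_intros h cp less_imp_le\<close>)
    moreover have "\<bar>LINT x|M. X x\<bar> \<le> K"
    proof -
      have "\<bar>LINT x|M. X x\<bar> \<le> (LINT x|M. K)"
        using X intp[of 0] by (intro order_trans[OF integral_abs_bound] integral_mono_AE) auto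
      then show ?thesis by (simp add: prob_space)
    qed
    ultimately have "\<bar>beta_int j h - beta_int j (\<lambda>s. p (1 - s))\<bar> * \<bar>LINT x|M. X x\<bar> \<le> \<epsilon> * K"
      using \<epsilon> by (intro mult_mono) auto
    then have "\<bar>beta_int j h * (LINT x|M. X x) - (LINT x|M. p (u x) * X x)\<bar> \<le> \<epsilon> * K"
      unfolding P by (simp add: left_diff_distrib flip: abs_mult)
    with 1 show ?thesis by linarith
  qed
  note small = this
  have "\<bar>(LINT x|M. h (1 - u x) * X x) - beta_int j h * (LINT x|M. X x)\<bar> \<le> 0 + \<delta>" if "\<delta> > 0" for \<delta>
  proof -
    \<comment> \<open>The summand 1 in the denominator covers K = 0.\<close>
    have "\<delta> / (2 * K + 1) * (2 * K) \<le> \<delta>" using that K by (simp add: field_simps)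
    then show ?thesis using small[of "\<delta> / (2 * K + 1)"] that K by fastforce
  qed
  then have "\<bar>(LINT x|M. h (1 - u x) * X x) - beta_int j h * (LINT x|M. X x)\<bar> \<le> 0"
    by (rule field_le_epsilon)
  then show ?thesis by simp
qed

section \<open>The distribution of the last column\<close>

text \<open>The partial norms \<open>r\<^sub>j\<close> of the last column, whose 0-based index is N
  - 1.\<close>

definition col_sum :: "nat \<Rightarrow> nat \<Rightarrow> complex mat \<Rightarrow> real" where
  "col_sum N j g = (\<Sum>i<j. (cmod (g $$ (i, N - 1)))\<^sup>2)"

lemma norm_unitary_pair:
  fixes a b x y :: complex
  assumes "(cmod a)\<^sup>2 + (cmod b)\<^sup>2 = 1"
  shows "(cmod (a * x + b * y))\<^sup>2 + (cmod (- cnj b * x + cnj a * y))\<^sup>2 = (cmod x)\<^sup>2 + (cmod y)\<^sup>2"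
proof -
  have "complex_of_real ((cmod (a * x + b * y))\<^sup>2 + (cmod (- cnj b * x + cnj a * y))\<^sup>2)
    = complex_of_real (((cmod a)\<^sup>2 + (cmod b)\<^sup>2) * ((cmod x)\<^sup>2 + (cmod y)\<^sup>2))"
    unfolding of_real_add of_real_mult complex_norm_square by (simp add: algebra_simps)
  then show ?thesis unfolding of_real_eq_iff assms by simp
qed

text \<open>A unitary mixing of two of the first j coordinates preserves their joint norm. Hence
  functions of later partial norms are admissible invariant weights below.\<close>

lemma col_sum_plane:
  assumes g: "g \<in> SU N" and pq: "p < j" "q < j" "p \<noteq> q" "j \<le> N"
    and ab: "(cmod a)\<^sup>2 + (cmod b)\<^sup>2 = 1"
  shows "col_sum N j (plane N p q a b * g) = col_sum N j g"
proof -
  define v where "v = (\<lambda>i. g $$ (i, N - 1))"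
  define v' where "v' = (\<lambda>i. (plane N p q a b * g) $$ (i, N - 1))"
  have v': "v' i = (if i = p then a * v p + b * v q else if i = q then - cnj b * v p + cnj a * v q else v i)"
    if "i < N" for i
    unfolding v'_def v_def using that pq SU_carrier[OF g] by (subst plane_mult_left[of p N q g N]) auto
  have split: "(\<Sum>i<j. f i) = f p + f q + (\<Sum>i\<in>{..<j} - {p, q}. f i)" for f :: "nat \<Rightarrow> real"
  proof -
    have "(\<Sum>i<j. f i) = sum f {p, q} + (\<Sum>i\<in>{..<j} - {p, q}. f i)"
      by (subst sum.subset_diff[of "{p, q}"]) (use pq in auto)
    then show ?thesis using pq by simp
  qed
  have "(\<Sum>i\<in>{..<j} - {p, q}. (cmod (v' i))\<^sup>2) = (\<Sum>i\<in>{..<j} - {p, q}. (cmod (v i))\<^sup>2)"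
    using pq by (intro sum.cong) (auto simp: v')
  moreover have "(cmod (v' p))\<^sup>2 + (cmod (v' q))\<^sup>2 = (cmod (v p))\<^sup>2 + (cmod (v q))\<^sup>2"
    using norm_unitary_pair[OF ab, of "v p" "v q"] pq by (simp add: v')
  ultimately have "(\<Sum>i<j. (cmod (v' i))\<^sup>2) = (\<Sum>i<j. (cmod (v i))\<^sup>2)"
    unfolding split[of "\<lambda>i. (cmod (v i))\<^sup>2"] split[of "\<lambda>i. (cmod (v' i))\<^sup>2"] by simp
  then show ?thesis by (simp add: col_sum_def v_def v'_def)
qed

lemma col_sum_Suc: "col_sum N (Suc j) g = col_sum N j g + (cmod (g $$ (j, N - 1)))\<^sup>2"
  by (simp add: col_sum_def)

lemma col_sum_nonneg: "0 \<le> col_sum N j g"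
  by (simp add: col_sum_def sum_nonneg)

lemma col_sum_ge: "i < j \<Longrightarrow> (cmod (g $$ (i, N - 1)))\<^sup>2 \<le> col_sum N j g"
  unfolding col_sum_def by (rule member_le_sum) auto

lemma col_sum_full: "g \<in> SU N \<Longrightarrow> 1 \<le> N \<Longrightarrow> col_sum N N g = 1"
  unfolding col_sum_def by (rule SU_col_norm) auto

context haar
begin

lemma prob_SU [simp]: "prob (SU N) = 1"
  using prob_space by simp

lemma measurable_entry [measurable]:
  "i < N \<Longrightarrow> j < N \<Longrightarrow> (\<lambda>g. g $$ (i, j)) \<in> borel_measurable M"
  by (simp add: measurable_haar)

lemma measurable_col_sum [measurable]:
  "1 \<le> N \<Longrightarrow> j \<le> N \<Longrightarrow> col_sum N j \<in> borel_measurable M"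
  unfolding col_sum_def by (intro borel_measurable_sum borel_measurable_power borel_measurable_norm measurable_entry) auto

lemma integrable_bounded:
  fixes f :: "complex mat \<Rightarrow> 'b :: {banach, second_countable_topology}"
  assumes "f \<in> borel_measurable M" "\<And>g. g \<in> SU N \<Longrightarrow> norm (f g) \<le> B"
  shows "integrable M f"
  by (rule integrable_const_bound[where B = B]) (use assms in auto)

text \<open>\<open>pair_moment\<close> compares coordinate q with each of the j other coordinates
  among the first j + 1. Adding these identities and using that the normalised squares u sum to 1
  yields a recursion in the moments of u q alone.\<close>

lemma col_moment_rec:
  assumes j: "1 \<le> j" "j < N" and q: "q \<le> j"
    and X [measurable]: "X \<in> borel_measurable M" and XK: "\<And>g. g \<in> SU N \<Longrightarrow> \<bar>X g :: real\<bar> \<le> K"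
    and inv: "\<And>p p' a b g. p \<le> j \<Longrightarrow> p' \<le> j \<Longrightarrow> p \<noteq> p' \<Longrightarrow> (cmod a)\<^sup>2 + (cmod b)\<^sup>2 = 1 \<Longrightarrow>
      g \<in> SU N \<Longrightarrow> X (plane N p p' a b * g) = X g"
    and nz: "AE g in M. col_sum N (Suc j) g \<noteq> 0"
  defines "u \<equiv> \<lambda>p g. (cmod (g $$ (p, N - 1)))\<^sup>2 / col_sum N (Suc j) g"
  shows "(Suc a + j) * (LINT g|M. u q g ^ Suc a * X g) = Suc a * (LINT g|M. u q g ^ a * X g)"
proof -
  define r where "r = col_sum N (Suc j)"
  have [measurable]: "r \<in> borel_measurable M" unfolding r_def using j by (intro measurable_col_sum) auto
  \<comment> \<open>Coordinates normalised by the joint norm. Where that norm is 0 the quotient is 0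
    by convention, so the bound by 1 holds everywhere.\<close>
  define w where "w = (\<lambda>p g. g $$ (p, N - 1) / complex_of_real (sqrt (r g)))"
  have wm [measurable]: "w p \<in> borel_measurable M" if "p \<le> j" for p
  proof -
    have [measurable]: "(\<lambda>g. g $$ (p, N - 1)) \<in> borel_measurable M" using that j by (intro measurable_entry) auto
    show ?thesis unfolding w_def by measurable
  qed
  have r0: "0 \<le> r g" for g by (simp add: r_def col_sum_nonneg)
  have uw: "(cmod (w p g))\<^sup>2 = u p g" for p g
    using r0[of g] by (simp add: w_def u_def r_def norm_divide power_divide)
  have u01: "0 \<le> u p g \<and> u p g \<le> 1" if "p \<le> j" for p g
    using col_sum_ge[of p "Suc j" g N] that r0[of g]
    by (auto simp: u_def r_def divide_le_eq_1)
  have um [measurable]: "u p \<in> borel_measurable M" if "p \<le> j" for p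
    unfolding uw[symmetric] using that by measurable
  have w1: "cmod (w p g) \<le> 1" if "p \<le> j" for p g
    using u01[OF that, of g] unfolding uw[symmetric] by (simp add: power_le_one_iff abs_square_le_1)
  have pair: "Suc a * (LINT g|M. u q g ^ a * u p g * X g) = (LINT g|M. u q g ^ Suc a * X g)"
    if p: "p \<le> j" "p \<noteq> q" for p
  proof -
    have ent: "(plane N q p c d * g) $$ (q, N - 1) = c * g $$ (q, N - 1) + d * g $$ (p, N - 1)"
         "(plane N q p c d * g) $$ (p, N - 1) = - cnj d * g $$ (q, N - 1) + cnj c * g $$ (p, N - 1)"
      if "g \<in> SU N" for c d g
      using p q j SU_carrier[OF that] by (subst plane_mult_left[of q N p g N]; auto)+
    have wr: "w q (plane N q p c d * g) = c * w q g + d * w p g"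
         "w p (plane N q p c d * g) = - cnj d * w q g + cnj c * w p g"
         "X (plane N q p c d * g) = X g"
      if "g \<in> SU N" "(cmod c)\<^sup>2 + (cmod d)\<^sup>2 = 1" for c d g
    proof -
      have "r (plane N q p c d * g) = r g"
        unfolding r_def using p q j that by (intro col_sum_plane) auto
      then show "w q (plane N q p c d * g) = c * w q g + d * w p g"
         "w p (plane N q p c d * g) = - cnj d * w q g + cnj c * w p g"
        using ent[OF that(1)] by (simp_all add: w_def add_divide_distrib diff_divide_distrib)
      show "X (plane N q p c d * g) = X g" using p q that by (intro inv) auto
    qed
    \<comment> \<open>Left invariance under the plane matrix with first row (c, d): real rotations
      supply the rotation hypothesis of \<open>pair_moment\<close>, and d = 0 supplies the phase
      hypothesis.\<close>
    have trans: "(LINT g|M. F (w q g) (w p g) (X g)) = (LINT g|M. F (c * w q g + d * w p g) (- cnj d * w q g + cnj c * w p g) (X g))"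
      if cd: "(cmod c)\<^sup>2 + (cmod d)\<^sup>2 = 1" and F: "(\<lambda>g. F (w q g) (w p g) (X g)) \<in> borel_measurable M"
      for c d and F :: "complex \<Rightarrow> complex \<Rightarrow> real \<Rightarrow> 'c :: {banach, second_countable_topology}"
    proof -
      have P: "plane N q p c d \<in> SU N" using p q j cd by (intro plane_SU) auto
      have "(LINT g|M. F (w q g) (w p g) (X g))
         = (LINT g|M. F (w q (plane N q p c d * g)) (w p (plane N q p c d * g)) (X (plane N q p c d * g)))"
        by (rule integral_left[OF _ P, symmetric]) (use F in \<open>simp add: measurable_haar\<close>)
      also have "\<dots> = (LINT g|M. F (c * w q g + d * w p g) (- cnj d * w q g + cnj c * w p g) (X g))"
        by (rule Bochner_Integration.integral_cong[OF refl]) (simp add: wr[OF _ cd])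
      finally show ?thesis .
    qed
    have wq: "w q \<in> borel_measurable M" and wp: "w p \<in> borel_measurable M" using p q by measurable
    have [measurable]: "cnj \<in> borel_measurable borel"
      by (intro borel_measurable_continuous_onI continuous_on_cnj continuous_on_id)
    have "Suc a * (LINT g|M. cmod (w q g) ^ (2 * (Suc a - 1)) * (cmod (w p g))\<^sup>2 * X g)
      = (LINT g|M. cmod (w q g) ^ (2 * Suc a) * X g)"
    proof (rule pair_moment[where K = K])
      fix y
      show "(LINT g|M. cmod (complex_of_real (cos y) * w q g + complex_of_real (sin y) * w p g) ^ (2 * Suc a) * X g)
        = (LINT g|M. cmod (w q g) ^ (2 * Suc a) * X g)"
        using trans[of "complex_of_real (cos y)" "complex_of_real (sin y)" "\<lambda>w w' X. cmod w ^ (2 * Suc a) * X"] wq wp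
        by simp
    next
      fix \<theta> i k
      have "cnj (cis \<theta>) = cis (- \<theta>)" by (simp add: cis_cnj)
      then show "(LINT x|M. (cis \<theta> * w q x) ^ i * (cis (- \<theta>) * w p x) ^ (Suc a - i)
          * cnj ((cis \<theta> * w q x) ^ k * (cis (- \<theta>) * w p x) ^ (Suc a - k)) * X x)
        = (LINT x|M. w q x ^ i * w p x ^ (Suc a - i) * cnj (w q x ^ k * w p x ^ (Suc a - k)) * X x)"
        using trans[of "cis \<theta>" 0 "\<lambda>w w' X. w ^ i * w' ^ (Suc a - i) * cnj (w ^ k * w' ^ (Suc a - k)) * X"] wq wp
        by simp
    qed (use wq wp w1 p q XK in auto)
    moreover have "cmod (w q g) ^ (2 * i) = u q g ^ i" for g i by (simp only: power_mult uw)
    ultimately show ?thesis by (simp only: uw diff_Suc_1)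
  qed
  have bnd: "\<bar>u q g ^ a * v * X g\<bar> \<le> K" if "g \<in> SU N" "0 \<le> v" "v \<le> 1" for g v
  proof -
    have "\<bar>u q g ^ a * v * X g\<bar> \<le> 1 * 1 * K"
      unfolding abs_mult using u01[OF q, of g] XK[OF that(1)] that
      by (intro mult_mono) (auto simp: power_abs intro!: power_le_one mult_nonneg_nonneg)
    then show ?thesis by simp
  qed
  have int: "integrable M (\<lambda>g. u q g ^ a * u p g * X g)" if "p \<le> j" for p
    using bnd u01[OF that] um[OF that] um[OF q]
    by (intro integrable_bounded[where B = K]) auto
  have int0: "integrable M (\<lambda>g. u q g ^ a * X g)"
    using bnd[of _ 1] um[OF q] by (intro integrable_bounded[where B = K]) auto
  \<comment> \<open>The j on the left counts the indices up to j other than q.\<close>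
  have "j * (LINT g|M. u q g ^ Suc a * X g) = (\<Sum>p\<in>{..j} - {q}. LINT g|M. u q g ^ Suc a * X g)"
    using q by simp
  also have "\<dots> = (\<Sum>p\<in>{..j} - {q}. Suc a * (LINT g|M. u q g ^ a * u p g * X g))"
    by (intro sum.cong refl) (use pair in auto)
  also have "\<dots> = Suc a * (LINT g|M. (\<Sum>p\<in>{..j} - {q}. u q g ^ a * u p g * X g))"
    unfolding sum_distrib_left[symmetric]
    by (subst Bochner_Integration.integral_sum) (use int in auto)
  also have "(LINT g|M. (\<Sum>p\<in>{..j} - {q}. u q g ^ a * u p g * X g))
     = (LINT g|M. u q g ^ a * X g - u q g ^ a * u q g * X g)"
  proof (rule integral_cong_AE)
    show "AE g in M. (\<Sum>p\<in>{..j} - {q}. u q g ^ a * u p g * X g) = u q g ^ a * X g - u q g ^ a * u q g * X g"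
      using nz
    proof eventually_elim
      case (elim g)
      \<comment> \<open>This quotient is 1 only where r does not vanish, hence the almost everywhere
        hypothesis.\<close>
      have "(\<Sum>p\<le>j. u p g) = r g / r g"
        unfolding u_def r_def by (simp add: col_sum_def lessThan_Suc_atMost flip: sum_divide_distrib)
      then have "(\<Sum>p\<le>j. u p g) = 1" using elim by (simp add: r_def)
      then have "(\<Sum>p\<in>{..j} - {q}. u p g) = 1 - u q g"
        using q by (simp add: sum_diff1)
      moreover have "(\<Sum>p\<in>{..j} - {q}. u q g ^ a * u p g * X g)
          = u q g ^ a * X g * (\<Sum>p\<in>{..j} - {q}. u p g)"
        by (simp add: sum_distrib_left mult_ac)
      ultimately show ?case by (simp only:) (simp add: algebra_simps)
    qed
  qed (use int int0 q in \<open>auto intro!: borel_measurable_sum borel_measurable_diff dest: borel_measurable_integrable\<close>)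
  also have "\<dots> = (LINT g|M. u q g ^ a * X g) - (LINT g|M. u q g ^ Suc a * X g)"
    using int0 int[OF q] by (subst Bochner_Integration.integral_diff) (auto simp: mult_ac)
  finally show ?thesis by (simp add: algebra_simps)
qed

text \<open>With X allowed to be any bounded weight invariant under rotations of the first j + 1
  coordinates, this gives the law of the quotient together with its independence of such
  weights.\<close>

lemma col_law:
  assumes j: "1 \<le> j" "j < N" and q: "q \<le> j"
    and X [measurable]: "X \<in> borel_measurable M" and XK: "\<And>g. g \<in> SU N \<Longrightarrow> \<bar>X g :: real\<bar> \<le> K"
    and inv: "\<And>p p' a b g. p \<le> j \<Longrightarrow> p' \<le> j \<Longrightarrow> p \<noteq> p' \<Longrightarrow> (cmod a)\<^sup>2 + (cmod b)\<^sup>2 = 1 \<Longrightarrow>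
      g \<in> SU N \<Longrightarrow> X (plane N p p' a b * g) = X g"
    and nz: "AE g in M. col_sum N (Suc j) g \<noteq> 0"
    and h: "continuous_on {0..1} h"
  shows "(LINT g|M. h (1 - (cmod (g $$ (q, N - 1)))\<^sup>2 / col_sum N (Suc j) g) * X g) = beta_int j h * (LINT g|M. X g)"
proof (rule beta_law[OF _ X _ _ j(1) _ h, where K = K])
  have [measurable]: "(\<lambda>g. g $$ (q, N - 1)) \<in> borel_measurable M"
     "col_sum N (Suc j) \<in> borel_measurable M"
    using q j by (auto intro!: measurable_entry measurable_col_sum)
  show "(\<lambda>g. (cmod (g $$ (q, N - 1)))\<^sup>2 / col_sum N (Suc j) g) \<in> borel_measurable M" by measurable
  show "(cmod (g $$ (q, N - 1)))\<^sup>2 / col_sum N (Suc j) g \<in> {0..1}" for g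
    using col_sum_ge[of q "Suc j" g N] q col_sum_nonneg[of N "Suc j" g] by (auto simp: divide_le_eq_1)
  show "(Suc a + j) * (LINT g|M. ((cmod (g $$ (q, N - 1)))\<^sup>2 / col_sum N (Suc j) g) ^ Suc a * X g)
    = Suc a * (LINT g|M. ((cmod (g $$ (q, N - 1)))\<^sup>2 / col_sum N (Suc j) g) ^ a * X g)" for a
    by (rule col_moment_rec[OF j q X XK inv nz])
qed (use XK in auto)

text \<open>At the top index the joint norm is 1, so \<open>col_law\<close> applies with no
  exceptional set. The event of a zero has probability at most the mean of (1 - |z_q|^2)^a, which is
  j/(a + j) and tends to 0 as a grows.\<close>

lemma AE_col_nonzero:
  assumes N: "2 \<le> N" and q: "q < N"
  shows "AE g in M. g $$ (q, N - 1) \<noteq> 0"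
proof -
  define j where "j = N - 1"
  have j: "1 \<le> j" "j < N" "q \<le> j" "Suc j = N" using N q by (auto simp: j_def)
  have [measurable]: "(\<lambda>g. g $$ (q, N - 1)) \<in> borel_measurable M"
    using q by (intro measurable_entry) auto
  define Z where "Z = {g \<in> space M. g $$ (q, N - 1) = 0}"
  have Z [measurable]: "Z \<in> sets M" unfolding Z_def by measurable
  have c1: "col_sum N (Suc j) g = 1" if "g \<in> SU N" for g using that j N by (simp add: col_sum_full)
  have "prob Z \<le> j / (a + j)" for a
  proof -
    have m01: "(cmod (g $$ (q, N - 1)))\<^sup>2 \<le> 1" if "g \<in> SU N" for g
      using col_sum_ge[of q "Suc j" g N] c1[OF that] j by simp
    have "prob Z = (LINT g|M. indicator Z g)"
      using sets.sets_into_space[OF Z] by (simp add: Int_absorb2)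
    also have "\<dots> \<le> (LINT g|M. (1 - (cmod (g $$ (q, N - 1)))\<^sup>2) ^ a * 1)"
    proof (rule integral_mono)
      show "integrable M (\<lambda>g. (1 - (cmod (g $$ (q, N - 1)))\<^sup>2) ^ a * 1)"
      proof (rule integrable_bounded[where B = 1])
        show "(\<lambda>g. (1 - (cmod (g $$ (q, N - 1)))\<^sup>2) ^ a * 1) \<in> borel_measurable M" by measurable
      qed (use m01 in \<open>auto simp: power_abs intro!: power_le_one\<close>)
      show "indicator Z g \<le> (1 - (cmod (g $$ (q, N - 1)))\<^sup>2) ^ a * 1" if "g \<in> space M" for g
        using m01[of g] that by (auto simp: Z_def indicator_def)
      show "integrable M (indicat_real Z)"
        using Z by (intro integrable_bounded[where B = 1]) (auto simp: indicator_def)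
    qed
    also have "\<dots> = (LINT g|M. (1 - (cmod (g $$ (q, N - 1)))\<^sup>2 / col_sum N (Suc j) g) ^ a * 1)"
      by (rule Bochner_Integration.integral_cong[OF refl]) (simp add: c1)
    also have "\<dots> = beta_int j (\<lambda>s. s ^ a) * (LINT g|M. 1)"
      using c1 by (intro col_law[where K = 1] j) (auto intro!: continuous_intros AE_I2)
    finally show ?thesis by (simp add: beta_int_power[OF j(1)] prob_space)
  qed
  moreover have "(\<lambda>a. j / (a + j)) \<longlonglongrightarrow> 0" by real_asymp
  ultimately have "prob Z \<le> 0" by (intro LIMSEQ_le_const[of "\<lambda>a. j / (a + j)"]) auto
  then have "prob Z = 0" by (simp add: measure_le_0_iff)
  then have "AE g in M. g \<notin> Z" using Z by (simp add: prob_eq_0)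
  then show ?thesis by (rule AE_mp) (auto simp: Z_def intro!: AE_I2)
qed

lemma AE_cols_nonzero:
  assumes "2 \<le> N"
  shows "AE g in M. \<forall>q<N. g $$ (q, N - 1) \<noteq> 0"
proof -
  have "AE g in M. \<forall>q\<in>{..<N}. g $$ (q, N - 1) \<noteq> 0"
    by (intro AE_finite_allI) (use AE_col_nonzero[OF assms] in auto)
  then show ?thesis by (rule AE_mp) (auto intro!: AE_I2)
qed

text \<open>The factor of lowest index k is split off by \<open>col_law\<close>; the remaining ones
  involve only the partial norms from k + 1 on and are therefore invariant under rotations of the
  first k + 1 coordinates.\<close>

lemma integral_col_prod:
  assumes N: "2 \<le> N" and h: "\<And>j. continuous_on UNIV (h j :: real \<Rightarrow> real)" and k: "1 \<le> k" "k \<le> N"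
  shows "(LINT g|M. (\<Prod>j\<in>{k..<N}. h j (col_sum N j g / col_sum N (Suc j) g))) = (\<Prod>j\<in>{k..<N}. beta_int j (h j))"
  using k(2,1)
proof (induction k rule: inc_induct)
  case base
  then show ?case by (simp add: prob_space)
next
  case (step k)
  define X where "X = (\<lambda>g. \<Prod>j\<in>{Suc k..<N}. h j (col_sum N j g / col_sum N (Suc j) g))"
  have hm: "h j \<in> borel_measurable borel" for j by (rule borel_measurable_continuous_onI[OF h])
  have "AE g in M. g $$ (0, N - 1) \<noteq> 0" by (rule AE_col_nonzero[OF N]) (use N in simp)
  then have nz: "AE g in M. col_sum N (Suc k) g \<noteq> 0"
  proof eventually_elim
    case (elim g)
    have "0 < (cmod (g $$ (0, N - 1)))\<^sup>2" using elim N by simp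
    also have "\<dots> \<le> col_sum N (Suc k) g" by (rule col_sum_ge) simp
    finally show ?case by simp
  qed
  have sm: "(\<lambda>g. col_sum N j g / col_sum N (Suc j) g) \<in> borel_measurable M" if "j < N" for j
    using that by (intro borel_measurable_divide measurable_col_sum) auto
  have s01: "col_sum N j g / col_sum N (Suc j) g \<in> {0..1}" for j g
  proof -
    have "col_sum N j g \<le> col_sum N (Suc j) g" by (simp add: col_sum_Suc)
    then show ?thesis
      using col_sum_nonneg[of N j g] col_sum_nonneg[of N "Suc j" g] by (auto simp: divide_le_eq_1)
  qed
  obtain B where B: "\<And>j s. s \<in> {0..1} \<Longrightarrow> \<bar>h j s\<bar> \<le> B j"
  proof -
    have "\<exists>b. \<forall>s\<in>{0..1}. \<bar>h j s\<bar> \<le> b" for j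
    proof -
      have "bounded (h j ` {0..1})"
        by (intro compact_imp_bounded compact_continuous_image compact_Icc continuous_on_subset[OF h]) simp
      then show ?thesis by (auto simp: bounded_iff)
    qed
    then show ?thesis using that by metis
  qed
  have XK: "\<bar>X g\<bar> \<le> (\<Prod>j\<in>{Suc k..<N}. B j)" for g
    unfolding X_def abs_prod using B s01 by (intro prod_mono) auto
  have Xm: "X \<in> borel_measurable M"
    unfolding X_def by (intro borel_measurable_prod measurable_compose[OF sm hm]) auto
  have inv: "X (plane N p p' a b * g) = X g"
    if "p \<le> k" "p' \<le> k" "p \<noteq> p'" "(cmod a)\<^sup>2 + (cmod b)\<^sup>2 = 1" "g \<in> SU N" for p p' a b g
    unfolding X_def using that
    by (intro prod.cong refl arg_cong2[of _ _ _ _ "\<lambda>x y. h _ (x / y)"] col_sum_plane) auto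
  have "(LINT g|M. (\<Prod>j\<in>{k..<N}. h j (col_sum N j g / col_sum N (Suc j) g)))
     = (LINT g|M. h k (1 - (cmod (g $$ (k, N - 1)))\<^sup>2 / col_sum N (Suc k) g) * X g)"
  proof (rule integral_cong_AE)
    show "AE g in M. (\<Prod>j\<in>{k..<N}. h j (col_sum N j g / col_sum N (Suc j) g))
       = h k (1 - (cmod (g $$ (k, N - 1)))\<^sup>2 / col_sum N (Suc k) g) * X g"
      using nz
    proof eventually_elim
      case (elim g)
      then have "1 - (cmod (g $$ (k, N - 1)))\<^sup>2 / col_sum N (Suc k) g = col_sum N k g / col_sum N (Suc k) g"
        by (simp add: col_sum_Suc field_simps)
      then show ?case using step by (simp add: X_def prod.atLeast_Suc_lessThan)
    qed
    show "(\<lambda>g. \<Prod>j\<in>{k..<N}. h j (col_sum N j g / col_sum N (Suc j) g)) \<in> borel_measurable M"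
      by (intro borel_measurable_prod measurable_compose[OF sm hm]) auto
    have "(\<lambda>g. 1 - (cmod (g $$ (k, N - 1)))\<^sup>2 / col_sum N (Suc k) g) \<in> borel_measurable M"
      using step by (intro borel_measurable_diff borel_measurable_divide borel_measurable_power
        borel_measurable_norm measurable_entry measurable_col_sum) auto
    from measurable_compose[OF this hm]
    show "(\<lambda>g. h k (1 - (cmod (g $$ (k, N - 1)))\<^sup>2 / col_sum N (Suc k) g) * X g) \<in> borel_measurable M"
      using Xm by (rule borel_measurable_times)
  qed
  also have "\<dots> = beta_int k (h k) * (LINT g|M. X g)"
    by (rule col_law[OF _ _ _ Xm XK inv nz])
      (use step in \<open>auto intro: continuous_on_subset[OF h]\<close>)
  also have "\<dots> = (\<Prod>j\<in>{k..<N}. beta_int j (h j))"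
    using step by (simp add: X_def prod.atLeast_Suc_lessThan)
  finally show ?case .
qed

end

section \<open>The mean over the cosets of the smaller group\<close>

text \<open>The set where H equals H a is closed by continuity, and from its supremum in [a, b] one
  can still move to the right unless this is b.\<close>

lemma right_locally_constant:
  fixes H :: "real \<Rightarrow> 'a :: t2_space"
  assumes c: "continuous_on UNIV H" and loc: "\<And>x. \<exists>\<epsilon>>0. \<forall>\<delta>\<in>{0..<\<epsilon>}. H (x + \<delta>) = H x"
    and ab: "a \<le> b"
  shows "H b = H a"
proof -
  define S where "S = {x \<in> {a..b}. H x = H a}"
  have "closed {x. H x = H a}"
    by (intro closed_Collect_eq c continuous_on_const)
  moreover have "S = {a..b} \<inter> {x. H x = H a}" by (auto simp: S_def)
  ultimately have "closed S" by (simp add: closed_Int)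
  moreover have "a \<in> S" "bdd_above S" using ab by (auto simp: S_def)
  ultimately have s: "Sup S \<in> S" using closed_contains_Sup[of S] by blast
  obtain \<epsilon> where \<epsilon>: "\<epsilon> > 0" "\<forall>\<delta>\<in>{0..<\<epsilon>}. H (Sup S + \<delta>) = H (Sup S)" using loc by blast
  define \<delta> where "\<delta> = min (\<epsilon> / 2) (b - Sup S)"
  have "\<delta> \<in> {0..<\<epsilon>}" using s \<epsilon>(1) by (auto simp: \<delta>_def S_def)
  then have "Sup S + \<delta> \<in> S" using s \<epsilon>(2) by (auto simp: S_def \<delta>_def)
  then have "Sup S + \<delta> \<le> Sup S" using \<open>bdd_above S\<close> by (rule cSup_upper)
  then have "Sup S = b" using \<epsilon>(1) s by (auto simp: \<delta>_def S_def min_def split: if_splits)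
  then show ?thesis using s by (simp add: S_def)
qed

section \<open>Continuity, bounds and factorisation of the family f\<close>

lemma finite_type_continuous:
  assumes "finite_type_SU p f"
  shows "continuous_map (SU_top p) euclidean f"
proof -
  obtain r :: nat and d \<rho> a where
    A: "\<forall>j<r. irrep_SU p (d j) (\<rho> j) \<and> a j \<in> carrier_mat (d j) (d j)"
      "\<forall>g\<in>SU p. f g = (\<Sum>j<r. mat_trace (a j * \<rho> j g))"
    using assms unfolding finite_type_SU_def by blast
  then have *: "\<And>j. j < r \<Longrightarrow> irrep_SU p (d j) (\<rho> j)" "\<And>j. j < r \<Longrightarrow> a j \<in> carrier_mat (d j) (d j)"
    and f: "\<And>g. g \<in> SU p \<Longrightarrow> f g = (\<Sum>j<r. mat_trace (a j * \<rho> j g))"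
    by simp_all
  have c: "continuous_map (SU_top p) (mat_top (d j) (d j)) (\<rho> j)" if "j < r" for j
    using *(1)[OF that] by (simp add: irrep_SU_def)
  have "continuous_map (SU_top p) euclidean (\<lambda>g. \<Sum>j<r. \<Sum>i<d j. \<Sum>k<d j. a j $$ (i, k) * \<rho> j g $$ (k, i))"
  proof (intro continuous_map_sum continuous_map_complex_mult)
    fix j i k assume "j \<in> {..<r}" "i \<in> {..<d j}" "k \<in> {..<d j}"
    then show "continuous_map (SU_top p) euclidean (\<lambda>g. \<rho> j g $$ (k, i))"
      using c[of j] unfolding continuous_map_into_mat_top by auto
  qed auto
  then show ?thesis
  proof (rule continuous_map_eq)
    fix g assume "g \<in> topspace (SU_top p)"
    then have g: "g \<in> SU p" by simp
    have "mat_trace (a j * \<rho> j g) = (\<Sum>i<d j. \<Sum>k<d j. a j $$ (i, k) * \<rho> j g $$ (k, i))" if j: "j < r" for j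
    proof -
      have \<rho>: "\<rho> j g \<in> carrier_mat (d j) (d j)"
        using c[OF j] g unfolding continuous_map_into_mat_top by auto
      then show ?thesis
        unfolding mat_trace_carrier[OF mult_carrier_mat[OF *(2)[OF j] \<rho>]]
        by (intro sum.cong refl index_mult_sum[OF *(2)[OF j] \<rho>]) auto
    qed
    then show "(\<Sum>j<r. \<Sum>i<d j. \<Sum>k<d j. a j $$ (i, k) * \<rho> j g $$ (k, i)) = f g"
      using f[OF g] by simp
  qed
qed

lemma Nminus_mono: "p \<le> N \<Longrightarrow> Nminus p \<le> Nminus N"
  by (induction N rule: dec_induct) (auto simp: Nminus_Suc)

lemma s_shift_eq: "s_shift N p = Nminus N - Nminus p"
  by (simp add: s_shift_def Nminus_def)

lemma Nminus_2 [simp]: "Nminus 2 = 1"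
  by (simp add: Nminus_def)

text \<open>\<open>euler_family\<close> quantifies over parameters of the full group only, so those
  of SU(p) are padded in front; pi/4 is a filler inside the open interval.\<close>

lemma euler_dom_extend:
  assumes p: "1 \<le> p" "p \<le> N" and dom: "euler_dom p \<phi>' \<psi>' \<omega>'"
  obtains \<phi> \<psi> \<omega> where "euler_dom N \<phi> \<psi> \<omega>" "euler_g N p \<phi> \<psi> \<omega> = euler_F p \<phi>' \<psi>' \<omega>'"
proof -
  define s where "s = s_shift N p"
  have s: "Nminus N = s + Nminus p" using Nminus_mono[OF p(2)] by (simp add: s_def s_shift_eq)
  define \<phi> where "\<phi> = (\<lambda>i. if i \<le> s then 0 else \<phi>' (i - s))"
  define \<psi> where "\<psi> = (\<lambda>i. if i \<le> s then pi / 4 else \<psi>' (i - s))"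
  define \<omega> where "\<omega> = (\<lambda>i. if i < p then \<omega>' i else 0)"
  have "\<phi> i \<in> {0..<pi} \<and> \<psi> i \<in> {0<..<pi/2}" if i: "i \<in> {1..Nminus N}" for i
  proof (cases "i \<le> s")
    case False
    then have "i - s \<in> {1..Nminus p}" using i s by auto
    then show ?thesis using False dom by (simp add: \<phi>_def \<psi>_def euler_dom_def)
  qed (simp add: \<phi>_def \<psi>_def)
  then have "euler_dom N \<phi> \<psi> \<omega>"
    using dom unfolding euler_dom_def by (auto simp: \<omega>_def)
  moreover have "euler_g N p \<phi> \<psi> \<omega> = euler_F p \<phi>' \<psi>' \<omega>'"
    unfolding euler_g_def s_def[symmetric]
    by (rule euler_F_cong[OF p(1)]) (auto simp: \<phi>_def \<psi>_def \<omega>_def)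
  ultimately show ?thesis by (rule that)
qed

lemma family_continuous:
  assumes fam: "euler_family N c k m n l f" and p: "1 \<le> p" "p \<le> N"
  shows "continuous_map (SU_top p) euclidean (f p)"
proof (cases "p = 1")
  case True
  have "continuous_map (SU_top 1) euclidean (\<lambda>_. 1 :: complex)" by simp
  then show ?thesis unfolding True
    by (rule continuous_map_eq) (use fam in \<open>simp add: euler_family_def\<close>)
next
  case False
  then have "finite_type_SU p (f p)" using fam p by (simp add: euler_family_def)
  then show ?thesis by (rule finite_type_continuous)
qed

lemma family_2:
  assumes "euler_family N c k m n l f" "euler_dom N \<phi> \<psi> \<omega>"
  shows "f 2 (euler_g N 2 \<phi> \<psi> \<omega>) =
    c * exp (\<i> * of_int (k (Nminus N)) * of_real (\<phi> (Nminus N)))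
      * of_real (sin (\<psi> (Nminus N)) ^ m (Nminus N) * cos (\<psi> (Nminus N)) ^ n (Nminus N))
      * exp (\<i> * of_int (l 1) * of_real (\<omega> 1))"
  using assms unfolding euler_family_def by blast

lemma family_ge3:
  assumes "euler_family N c k m n l f" "euler_dom N \<phi> \<psi> \<omega>" "p \<in> {3..N}"
  shows "f p (euler_g N p \<phi> \<psi> \<omega>) =
    (\<Prod>j\<in>{s_shift N p + 1..s_shift N p + (p - 1)}.
        exp (\<i> * of_int (k j) * of_real (\<phi> j)) * of_real (sin (\<psi> j) ^ m j * cos (\<psi> j) ^ n j))
      * f (p - 1) (euler_g N (p - 1) \<phi> \<psi> \<omega>) * exp (\<i> * of_int (l (p - 1)) * of_real (\<omega> (p - 1)))"
  using assms unfolding euler_family_def by blast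

text \<open>On parametrised elements each additional factor has modulus at most 1, and density
  extends the bound to the group. It supplies integrability and the dominating constant, and shows
  that f vanishes when c = 0.\<close>

lemma family_bound:
  assumes fam: "euler_family N c k m n l f" and p: "2 \<le> p" "p \<le> N" and g: "g \<in> SU p"
  shows "cmod (f p g) \<le> cmod c"
proof -
  have trig: "\<bar>sin x ^ a * cos x ^ b\<bar> \<le> 1" for x :: real and a b
    unfolding abs_mult power_abs by (intro mult_le_one power_le_one) auto
  have *: "cmod (f p (euler_g N p \<phi> \<psi> \<omega>)) \<le> cmod c" if dom: "euler_dom N \<phi> \<psi> \<omega>" for \<phi> \<psi> \<omega>
    using p
  proof (induction p rule: nat_induct_at_least)
    case base
    have "cmod (f 2 (euler_g N 2 \<phi> \<psi> \<omega>))
      = cmod c * \<bar>sin (\<psi> (Nminus N)) ^ m (Nminus N) * cos (\<psi> (Nminus N)) ^ n (Nminus N)\<bar>"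
      by (simp add: family_2[OF fam dom] norm_mult norm_power abs_mult power_abs)
    also have "\<dots> \<le> cmod c * 1" by (intro mult_left_mono trig) auto
    finally show ?case by simp
  next
    case (Suc p)
    let ?P = "\<Prod>j\<in>{s_shift N (Suc p) + 1..s_shift N (Suc p) + (Suc p - 1)}.
                exp (\<i> * of_int (k j) * of_real (\<phi> j)) * complex_of_real (sin (\<psi> j) ^ m j * cos (\<psi> j) ^ n j)"
    have "Suc p \<in> {3..N}" using Suc by auto
    then have "f (Suc p) (euler_g N (Suc p) \<phi> \<psi> \<omega>) = ?P * f p (euler_g N p \<phi> \<psi> \<omega>)
        * exp (\<i> * of_int (l p) * of_real (\<omega> p))"
      using family_ge3[OF fam dom, of "Suc p"] by (simp only: diff_Suc_1)
    then have "cmod (f (Suc p) (euler_g N (Suc p) \<phi> \<psi> \<omega>)) = cmod ?P * cmod (f p (euler_g N p \<phi> \<psi> \<omega>))"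
      by (simp add: norm_mult)
    also have "\<dots> \<le> 1 * cmod c"
    proof (intro mult_mono)
      show "cmod ?P \<le> 1"
        unfolding prod_norm[symmetric]
        by (intro prod_le_1) (auto simp: norm_mult simp del: of_real_mult of_real_power intro!: trig)
    qed (use Suc in auto)
    finally show ?case by simp
  qed
  have "f p g \<in> cball 0 (cmod c)"
  proof (rule euler_dense[OF _ family_continuous[OF fam]])
    fix \<phi>' \<psi>' \<omega>' assume dom: "euler_dom p \<phi>' \<psi>' \<omega>'"
    have "1 \<le> p" using p by simp
    then obtain \<phi> \<psi> \<omega> where "euler_dom N \<phi> \<psi> \<omega>" "euler_g N p \<phi> \<psi> \<omega> = euler_F p \<phi>' \<psi>' \<omega>'"
      by (rule euler_dom_extend[OF _ p(2) dom])
    then show "f p (euler_F p \<phi>' \<psi>' \<omega>') \<in> cball 0 (cmod c)" using *[of \<phi> \<psi> \<omega>] by simp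
  qed (use p g in auto)
  then show ?thesis by simp
qed

text \<open>The part of f that is read off from the angles of the last column, without the constant
  c.\<close>

definition col_fun :: "nat \<Rightarrow> (nat \<Rightarrow> int) \<Rightarrow> (nat \<Rightarrow> nat) \<Rightarrow> (nat \<Rightarrow> nat) \<Rightarrow> int
    \<Rightarrow> (nat \<Rightarrow> real) \<Rightarrow> (nat \<Rightarrow> real) \<Rightarrow> real \<Rightarrow> complex" where
  "col_fun q k m n l \<phi> \<psi> w =
     (\<Prod>j\<in>{1..q}. exp (\<i> * of_int (k j) * of_real (\<phi> j)) * of_real (sin (\<psi> j) ^ m j * cos (\<psi> j) ^ n j))
     * exp (\<i> * of_int l * of_real w)"

lemma family_factor:
  assumes fam: "euler_family (Suc q) c k m n l f" and q: "1 \<le> q"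
    and box: "euler_box q \<phi> \<psi> w" and h: "h \<in> SU q"
  shows "f (Suc q) (euler_B (Suc q) (Suc q) \<phi> \<psi> * ext1 q h * euler_E (Suc q) w)
    = (if q = 1 then c else 1) * col_fun q k m n (l q) \<phi> \<psi> w * f q h"
proof -
  \<comment> \<open>For q = 1 the constant c belongs to this step, since f on SU(1) is 1; for larger
    q it is already contained in f q.\<close>
  define C where "C = (if q = 1 then c else 1) * col_fun q k m n (l q) \<phi> \<psi> w"
  define D where "D = (\<lambda>h. f (Suc q) (euler_B (Suc q) (Suc q) \<phi> \<psi> * ext1 q h * euler_E (Suc q) w) - C * f q h)"
  have B: "euler_B (Suc q) (Suc q) \<phi> \<psi> \<in> SU (Suc q)"
    using box by (intro euler_B_SU) (auto simp: euler_box_def)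
  have "continuous_map (SU_top q) (SU_top (Suc q)) (\<lambda>h. euler_B (Suc q) (Suc q) \<phi> \<psi> * ext1 q h * euler_E (Suc q) w)"
    using q B by (intro continuous_map_SU_mult continuous_map_SU_const continuous_map_ext1 euler_E_SU) auto
  from continuous_map_compose[OF this family_continuous[OF fam]]
  have "continuous_map (SU_top q) euclidean D"
    unfolding D_def using q
    by (intro continuous_map_diff continuous_map_complex_mult family_continuous[OF fam]) (auto simp: o_def)
  then have "D h \<in> {0}"
  proof (rule euler_dense[OF q _ _ _ h])
    fix \<phi>' \<psi>' \<omega>' assume dom: "euler_dom q \<phi>' \<psi>' \<omega>'"
    obtain \<phi>2 \<psi>2 \<omega>2 where dom2: "euler_dom (Suc q) \<phi>2 \<psi>2 \<omega>2"
      and F2: "euler_F (Suc q) \<phi>2 \<psi>2 \<omega>2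
        = euler_B (Suc q) (Suc q) \<phi> \<psi> * ext1 q (euler_F q \<phi>' \<psi>' \<omega>') * euler_E (Suc q) w"
      and Fq: "euler_F q (\<lambda>i. \<phi>2 (q + i)) (\<lambda>i. \<psi>2 (q + i)) \<omega>2 = euler_F q \<phi>' \<psi>' \<omega>'"
      and eq: "\<And>j. j \<in> {1..q} \<Longrightarrow> \<phi>2 j = \<phi> j" "\<And>j. j \<in> {1..q} \<Longrightarrow> \<psi>2 j = \<psi> j" "\<omega>2 q = w"
      by (rule euler_merge[OF q box dom]) blast
    have s: "s_shift (Suc q) (Suc q) = 0" "s_shift (Suc q) q = q"
      by (simp_all add: s_shift_eq Nminus_Suc)
    have g: "euler_g (Suc q) (Suc q) \<phi>2 \<psi>2 \<omega>2 = euler_F (Suc q) \<phi>2 \<psi>2 \<omega>2"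
       "euler_g (Suc q) q \<phi>2 \<psi>2 \<omega>2 = euler_F q \<phi>' \<psi>' \<omega>'"
      unfolding euler_g_def s using Fq by simp_all
    have "f (Suc q) (euler_F (Suc q) \<phi>2 \<psi>2 \<omega>2) = C * f q (euler_F q \<phi>' \<psi>' \<omega>')"
    proof (cases "q = 1")
      case True
      have "f q (euler_F q \<phi>' \<psi>' \<omega>') = 1"
        using fam euler_F_SU[OF q dom] True by (simp add: euler_family_def)
      moreover have "f 2 (euler_g 2 2 \<phi>2 \<psi>2 \<omega>2) =
          c * exp (\<i> * of_int (k 1) * of_real (\<phi>2 1)) * of_real (sin (\<psi>2 1) ^ m 1 * cos (\<psi>2 1) ^ n 1)
            * exp (\<i> * of_int (l 1) * of_real (\<omega>2 1))"
        using family_2[OF fam dom2] True by (simp add: numeral_2_eq_2[symmetric])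
      ultimately show ?thesis
        using g(1) eq True by (simp add: C_def col_fun_def numeral_2_eq_2 mult_ac)
    next
      case False
      then have "Suc q \<in> {3..Suc q}" using q by auto
      then have "f (Suc q) (euler_g (Suc q) (Suc q) \<phi>2 \<psi>2 \<omega>2) =
          (\<Prod>j\<in>{1..q}. exp (\<i> * of_int (k j) * of_real (\<phi>2 j)) * of_real (sin (\<psi>2 j) ^ m j * cos (\<psi>2 j) ^ n j))
          * f q (euler_g (Suc q) q \<phi>2 \<psi>2 \<omega>2) * exp (\<i> * of_int (l q) * of_real (\<omega>2 q))"
        using family_ge3[OF fam dom2, of "Suc q"] by (simp only: diff_Suc_1 s(1) add_0)
      moreover have "(\<Prod>j\<in>{1..q}. exp (\<i> * of_int (k j) * of_real (\<phi>2 j)) * complex_of_real (sin (\<psi>2 j) ^ m j * cos (\<psi>2 j) ^ n j))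
        = (\<Prod>j\<in>{1..q}. exp (\<i> * of_int (k j) * of_real (\<phi> j)) * complex_of_real (sin (\<psi> j) ^ m j * cos (\<psi> j) ^ n j))"
        by (rule prod.cong[OF refl]) (simp only: eq)
      ultimately show ?thesis using g eq(3) False by (simp add: C_def col_fun_def mult_ac)
    qed
    then show "D (euler_F q \<phi>' \<psi>' \<omega>') \<in> {0}" by (simp add: D_def F2)
  qed simp
  then show ?thesis by (simp add: D_def C_def)
qed

text \<open>\<open>euler_E\<close> is diagonal, so moving a block matrix past it conjugates the
  block by diag(1, ..., 1, cis w). Conjugation ignores scalars, which allows normalising this matrix
  to determinant 1.\<close>

lemma euler_E_ext1:
  assumes q: "1 \<le> q"
  obtains A where "A \<in> SU q"
    "\<And>h. h \<in> SU q \<Longrightarrow> euler_E (Suc q) w * ext1 q h = ext1 q (A * (h * mat_adjoint A)) * euler_E (Suc q) w"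
proof -
  define d where "d = (\<lambda>i. if i = q - 1 then cis w else 1)"
  \<comment> \<open>A q-th root of cis (-w): the scalar that brings the determinant cis w to 1 and
    cancels in the conjugation.\<close>
  define s where "s = cis (- (w / q))"
  have ss: "s * cnj s = 1" by (simp add: s_def cis_cnj cis_mult)
  define A where "A = mat_diag q (\<lambda>i. s * d i)"
  have A: "A \<in> SU q"
    unfolding A_def
  proof (rule mat_diag_SU)
    show "cmod (s * d i) = 1" for i by (simp add: s_def d_def norm_mult)
    have "(\<Prod>i<q. s * d i) = s ^ q * (\<Prod>i<q. d i)" by (simp add: prod.distrib)
    also have "(\<Prod>i<q. d i) = cis w" using q by (simp add: d_def prod.delta)
    also have "s ^ q * cis w = 1" using q by (simp add: s_def Complex.DeMoivre cis_mult)
    finally show "(\<Prod>i<q. s * d i) = 1" .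
  qed
  have adj: "mat_adjoint A = mat_diag q (\<lambda>i. cnj (s * d i))"
    unfolding A_def by (rule eq_matI) (auto simp: mat_diag_index)
  have "euler_E (Suc q) w * ext1 q h = ext1 q (A * (h * mat_adjoint A)) * euler_E (Suc q) w" if h: "h \<in> SU q" for h
  proof (rule eq_matI)
    have hc: "h \<in> carrier_mat q q" using h by (rule SU_carrier)
    have Mc: "A * (h * mat_adjoint A) \<in> carrier_mat q q"
      using SU_mult[OF A SU_mult[OF h SU_adjoint(1)[OF A]]] by (rule SU_carrier)
    have M: "(A * (h * mat_adjoint A)) $$ (i, j) = d i * h $$ (i, j) * cnj (d j)" if "i < q" "j < q" for i j
    proof -
      have hA: "h * mat_adjoint A = mat q q (\<lambda>(i, j). h $$ (i, j) * cnj (s * d j))"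
        unfolding adj by (rule mat_diag_mult_right[OF hc])
      have "A * (h * mat_adjoint A) = mat q q (\<lambda>(i, j). s * d i * (h * mat_adjoint A) $$ (i, j))"
        unfolding A_def[symmetric] by (subst (1) A_def, rule mat_diag_mult_left) (simp add: hA)
      then have "(A * (h * mat_adjoint A)) $$ (i, j) = s * d i * (h $$ (i, j) * cnj (s * d j))"
        using that by (simp add: hA)
      also have "\<dots> = (s * cnj s) * (d i * h $$ (i, j) * cnj (d j))" by simp
      finally show ?thesis by (simp add: ss)
    qed
    have dd: "cnj (d j) * d j = 1" for j by (simp add: d_def cis_cnj cis_mult)
    fix i j assume "i < dim_row (ext1 q (A * (h * mat_adjoint A)) * euler_E (Suc q) w)"
      "j < dim_col (ext1 q (A * (h * mat_adjoint A)) * euler_E (Suc q) w)"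
    then have ij: "i < Suc q" "j < Suc q" using Mc by auto
    define e where "e = (\<lambda>i. if i = q then cis (- w) else d i)"
    have "(euler_E (Suc q) w * ext1 q h) $$ (i, j) = e i * ext1 q h $$ (i, j)"
      using plane_mult_left[of "Suc q - 2" "Suc q" "Suc q - 1" "ext1 q h" "Suc q" i j "cis w" 0] q ij ext1_carrier[OF hc]
      by (auto simp: e_def d_def cis_cnj)
    moreover have "(ext1 q (A * (h * mat_adjoint A)) * euler_E (Suc q) w) $$ (i, j)
        = ext1 q (A * (h * mat_adjoint A)) $$ (i, j) * e j"
      using plane_mult_right[of "Suc q - 2" "Suc q" "Suc q - 1" "ext1 q (A * (h * mat_adjoint A))" "Suc q" i j "cis w" 0]
        q ij ext1_carrier[OF Mc]
      by (auto simp: e_def d_def cis_cnj)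
    moreover have "e i * ext1 q h $$ (i, j) = ext1 q (A * (h * mat_adjoint A)) $$ (i, j) * e j"
      unfolding ext1_index[OF hc ij] ext1_index[OF Mc ij]
      using dd[of j] M[of i j] by (auto simp: e_def mult.assoc)
    ultimately show "(euler_E (Suc q) w * ext1 q h) $$ (i, j)
       = (ext1 q (A * (h * mat_adjoint A)) * euler_E (Suc q) w) $$ (i, j)" by simp
  qed (use SU_carrier[OF h] SU_carrier[OF SU_mult[OF A SU_mult[OF h SU_adjoint(1)[OF A]]]] in auto)
  with A show ?thesis by (rule that)
qed

section \<open>The mean of f over a coset of SU(q), where N = q + 1\<close>

locale euler_int = G: haar "Suc q" M + H: haar q M'
  for q and M M' :: "complex mat measure" +
  fixes c k m n l f
  assumes q: "1 \<le> q" and fam: "euler_family (Suc q) c k m n l f"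
begin

definition avg :: "complex mat \<Rightarrow> complex" where
  "avg g = (LINT h|M'. f (Suc q) (g * ext1 q h))"

abbreviation "c' \<equiv> if q = 1 then c else 1"
abbreviation "I' \<equiv> LINT h|M'. f q h"
abbreviation "F \<equiv> col_fun q k m n (l q)"

lemma continuous_fN: "continuous_map (SU_top (Suc q)) euclidean (f (Suc q))"
  by (rule family_continuous[OF fam]) auto

lemma measurable_fN [measurable]: "f (Suc q) \<in> borel_measurable (borel_SU (Suc q))"
  by (rule continuous_map_SU_measurable[OF continuous_fN])

lemma measurable_fn [measurable]: "f q \<in> borel_measurable (borel_SU q)"
  by (rule continuous_map_SU_measurable[OF family_continuous[OF fam]]) (use q in auto)

lemma bound_fN: "g \<in> SU (Suc q) \<Longrightarrow> cmod (f (Suc q) g) \<le> cmod c"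
  by (rule family_bound[OF fam]) (use q in auto)

lemma ext1_SU: "h \<in> SU q \<Longrightarrow> ext1 q h \<in> SU (Suc q)"
  using ext1_SU_iff SU_carrier by blast

lemma measurable_ext1 [measurable]: "ext1 q \<in> measurable (borel_SU q) (borel_SU (Suc q))"
proof (rule measurable_into_borel_SU)
  fix i j assume "i < Suc q" "j < Suc q"
  then show "(\<lambda>h. ext1 q h $$ (i, j)) \<in> borel_measurable (borel_SU q)"
    using continuous_map_ext1[of q] by (auto simp: continuous_map_into_SU_top intro: continuous_map_SU_measurable)
qed (simp add: ext1_SU)

lemma measurable_pair:
  "(\<lambda>p. f (Suc q) (fst p * ext1 q (snd p))) \<in> borel_measurable (M \<Otimes>\<^sub>M M')"
  by (rule measurable_compose[OF _ measurable_fN], rule measurable_SU_mult) measurable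

lemma measurable_avg: "avg \<in> borel_measurable M"
  unfolding avg_def using measurable_pair
  by (intro H.borel_measurable_lebesgue_integral) (simp add: split_beta')

text \<open>For fixed h the translation by diag(h, 1) on the right preserves the integral over g;
  boundedness of f permits the exchange.\<close>

lemma integral_avg: "(LINT g|M. avg g) = (LINT g|M. f (Suc q) g)"
proof -
  interpret P: pair_prob_space M M' ..
  have int: "integrable (M \<Otimes>\<^sub>M M') (\<lambda>p. f (Suc q) (fst p * ext1 q (snd p)))"
  proof (rule P.integrable_const_bound[where B = "cmod c"])
    show "AE p in M \<Otimes>\<^sub>M M'. cmod (f (Suc q) (fst p * ext1 q (snd p))) \<le> cmod c"
      by (rule AE_I2) (auto simp: space_pair_measure intro!: bound_fN SU_mult ext1_SU)
  qed (rule measurable_pair)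
  have "(LINT g|M. avg g) = (LINT h|M'. LINT g|M. f (Suc q) (g * ext1 q h))"
    unfolding avg_def using P.Fubini_integral[of "\<lambda>g h. f (Suc q) (g * ext1 q h)"] int
    by (simp add: split_beta')
  also have "\<dots> = (LINT h|M'. LINT g|M. f (Suc q) g)"
    by (rule Bochner_Integration.integral_cong[OF refl]) (simp add: G.integral_right measurable_fN ext1_SU)
  finally show ?thesis by simp
qed

text \<open>Writing g = B diag(h0, 1) E, the translate by diag(h, 1) has block h0 A h A^-1. Right
  invariance removes the inverse of A, left invariance then A and h0, so the mean depends on the
  last column alone.\<close>

lemma avg_eq:
  assumes g: "g \<in> SU (Suc q)" and box: "euler_box q \<phi> \<psi> w"
    and col: "\<And>i. i < Suc q \<Longrightarrow> g $$ (i, q) = cis (- w) * euler_V (Suc q) \<phi> \<psi> i"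
  shows "avg g = c' * F \<phi> \<psi> w * I'"
proof -
  have psi: "\<psi> j \<in> {0<..<pi/2}" if "j \<in> {1..q}" for j using box that by (auto simp: euler_box_def)
  define B where "B = euler_B (Suc q) (Suc q) \<phi> \<psi>"
  define E where "E = euler_E (Suc q) w"
  obtain h0 where h0: "h0 \<in> SU q" "g = B * ext1 q h0 * E"
    unfolding B_def E_def by (rule euler_decomp[OF g q psi col])
  obtain A where A: "A \<in> SU q" "\<And>h. h \<in> SU q \<Longrightarrow> E * ext1 q h = ext1 q (A * (h * mat_adjoint A)) * E"
    unfolding E_def by (rule euler_E_ext1[OF q, of w]) blast
  have B: "B \<in> SU (Suc q)" unfolding B_def using psi by (intro euler_B_SU) auto
  have E: "E \<in> SU (Suc q)" unfolding E_def using q by (intro euler_E_SU) auto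
  have "avg g = (LINT h|M'. c' * F \<phi> \<psi> w * f q (h0 * (A * (h * mat_adjoint A))))"
    unfolding avg_def
  proof (rule Bochner_Integration.integral_cong[OF refl])
    fix h assume "h \<in> space M'"
    then have h: "h \<in> SU q" by simp
    define h' where "h' = A * (h * mat_adjoint A)"
    have h': "h' \<in> SU q" unfolding h'_def by (intro SU_mult A SU_adjoint h)
    have "g * ext1 q h = B * ext1 q h0 * (E * ext1 q h)"
      unfolding h0(2) by (rule SU_mult_assoc[where N = "Suc q"]) (intro SU_mult B E ext1_SU h h0)+
    also have "\<dots> = B * ext1 q h0 * (ext1 q h' * E)" using A(2)[OF h] by (simp add: h'_def)
    also have "\<dots> = B * ext1 q h0 * ext1 q h' * E"
      by (rule SU_mult_assoc[where N = "Suc q", symmetric]) (intro SU_mult B E ext1_SU h' h0)+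
    also have "B * ext1 q h0 * ext1 q h' = B * (ext1 q h0 * ext1 q h')"
      by (rule SU_mult_assoc[where N = "Suc q"]) (intro SU_mult B E ext1_SU h' h0)+
    also have "ext1 q h0 * ext1 q h' = ext1 q (h0 * h')"
      by (rule ext1_mult) (intro SU_carrier h0 h')+
    finally have "g * ext1 q h = B * ext1 q (h0 * h') * E" .
    then show "f (Suc q) (g * ext1 q h) = c' * F \<phi> \<psi> w * f q (h0 * (A * (h * mat_adjoint A)))"
      unfolding B_def E_def using family_factor[OF fam q box SU_mult[OF h0(1) h']] by (simp add: h'_def)
  qed
  also have "\<dots> = c' * F \<phi> \<psi> w * (LINT h|M'. f q (h0 * (A * (h * mat_adjoint A))))" by simp
  also have "(LINT h|M'. f q (h0 * (A * (h * mat_adjoint A)))) = (LINT h|M'. f q (h0 * (A * h)))"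
    by (rule H.integral_right[OF _ SU_adjoint(1)[OF A(1)], of "\<lambda>x. f q (h0 * (A * x))"])
      (rule measurable_compose[OF _ measurable_fn], intro measurable_SU_mult measurable_const, use h0 A in auto)
  also have "\<dots> = (LINT h|M'. f q (h0 * h))"
    by (rule H.integral_left[OF _ A(1), of "\<lambda>x. f q (h0 * x)"])
      (rule measurable_compose[OF _ measurable_fn], intro measurable_SU_mult measurable_const, use h0 in auto)
  also have "\<dots> = I'"
    by (rule H.integral_left[OF measurable_fn h0(1)])
  finally show ?thesis .
qed

text \<open>Dominated convergence with the constant bound |c|. Paths suffice because the
  transformation law is propagated along one-parameter orbits.\<close>

lemma avg_continuous_path:
  assumes \<gamma>: "continuous_map euclideanreal (SU_top (Suc q)) \<gamma>"
  shows "continuous_on UNIV (\<lambda>t. avg (\<gamma> t))"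
proof -
  have \<gamma>S: "\<gamma> t \<in> SU (Suc q)" for t using \<gamma> by (auto simp: continuous_map_into_SU_top)
  have m: "(\<lambda>h. f (Suc q) (\<gamma> t * ext1 q h)) \<in> borel_measurable M'" for t
    by (rule measurable_compose[OF _ measurable_fN], rule measurable_SU_mult)
      (use \<gamma>S in \<open>auto simp: H.measurable_haar intro: measurable_ext1\<close>)
  have c: "continuous_on UNIV (\<lambda>t. f (Suc q) (\<gamma> t * ext1 q h))" if "h \<in> SU q" for h
  proof -
    have "continuous_map euclideanreal (SU_top (Suc q)) (\<lambda>t. \<gamma> t * ext1 q h)"
      by (intro continuous_map_SU_mult \<gamma> continuous_map_SU_const ext1_SU that)
    from continuous_map_compose[OF this continuous_fN] show ?thesis by (simp add: o_def)
  qed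
  show ?thesis
    unfolding continuous_on_sequentially
  proof (intro ballI allI impI, elim conjE)
    fix t :: real and x :: "nat \<Rightarrow> real" assume x: "x \<longlonglongrightarrow> t"
    show "((\<lambda>t. avg (\<gamma> t)) \<circ> x) \<longlonglongrightarrow> avg (\<gamma> t)"
      unfolding o_def avg_def
    proof (rule integral_dominated_convergence[where w = "\<lambda>_. cmod c"])
      show "AE h in M'. (\<lambda>i. f (Suc q) (\<gamma> (x i) * ext1 q h)) \<longlonglongrightarrow> f (Suc q) (\<gamma> t * ext1 q h)"
        using c x by (intro AE_I2) (auto simp: continuous_on_sequentially o_def)
      show "AE h in M'. cmod (f (Suc q) (\<gamma> (x i) * ext1 q h)) \<le> cmod c" for i
        by (intro AE_I2) (auto intro!: bound_fN SU_mult \<gamma>S ext1_SU)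
    qed (use m in auto)
  qed
qed

lemma column_box:
  assumes "g \<in> SU (Suc q)" "\<And>i. i < Suc q \<Longrightarrow> g $$ (i, q) \<noteq> 0"
  obtains \<phi> \<psi> w where "euler_box q \<phi> \<psi> w" "\<And>i. i < Suc q \<Longrightarrow> g $$ (i, q) = cis (- w) * euler_V (Suc q) \<phi> \<psi> i"
  using euler_box_exists[of q "\<lambda>i. g $$ (i, q)"] assms SU_col_norm[OF assms(1), of q] by auto

text \<open>The Euler angles run through half-open intervals, so a phase can always be increased a little,
  never by a full period: the transformation law is only visible locally, and continuity of
  the mean along the orbit makes it global. This also covers odd frequencies, where the integral of
  \<open>e\<^bsup>ik\<phi>\<^esup>\<close> over the half period does not vanish.\<close>
lemma integral_avg_zero:
  fixes e :: "nat \<Rightarrow> real" and \<mu> :: int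
  assumes \<mu>: "\<mu> \<noteq> 0"
    and shift: "\<And>\<phi> \<psi> w. euler_box q \<phi> \<psi> w \<Longrightarrow> \<exists>\<epsilon>>0. \<forall>\<delta>\<in>{0..<\<epsilon>::real}. \<exists>\<phi>' \<psi>' w'. euler_box q \<phi>' \<psi>' w' \<and>
      (\<forall>i<Suc q. cis (- w') * euler_V (Suc q) \<phi>' \<psi>' i = cis (\<delta> * e i) * (cis (- w) * euler_V (Suc q) \<phi> \<psi> i)) \<and>
      F \<phi>' \<psi>' w' = cis (\<mu> * \<delta>) * F \<phi> \<psi> w"
  shows "(LINT g|M. avg g) = 0"
proof -
  \<comment> \<open>The phases e need not sum to 0. Subtracting their mean a makes T t unimodular,
    and R t on the right restores the common phase cis (t a) on the last column.\<close>
  define a where "a = (\<Sum>i<Suc q. e i) / Suc q"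
  define T where "T = (\<lambda>t. mat_diag (Suc q) (\<lambda>i. cis (t * (e i - a))))"
  define R where "R = (\<lambda>t. euler_E (Suc q) (- (t * a)))"
  have TS: "T t \<in> SU (Suc q)" for t
    unfolding T_def
  proof (rule mat_diag_SU)
    have "(\<Prod>i<Suc q. cis (t * (e i - a))) = cis (\<Sum>i<Suc q. t * (e i - a))"
      by (induction q) (simp_all add: cis_mult)
    also have "(\<Sum>i<Suc q. t * (e i - a)) = t * ((\<Sum>i<Suc q. e i) - Suc q * a)"
      by (simp only: sum_distrib_left[symmetric] sum_subtractf sum_constant card_lessThan)
    also have "\<dots> = 0" by (simp add: a_def)
    finally show "(\<Prod>i<Suc q. cis (t * (e i - a))) = 1" by simp
  qed simp
  have RS: "R t \<in> SU (Suc q)" for t unfolding R_def using q by (intro euler_E_SU) auto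
  have cT: "continuous_map euclideanreal (SU_top (Suc q)) T"
  proof (rule continuous_map_SU_into)
    fix i j assume "i < Suc q" "j < Suc q"
    then show "continuous_map euclideanreal euclidean (\<lambda>t. T t $$ (i, j))"
      by (cases "i = j") (auto simp: T_def mat_diag_index cis_conv_exp intro!: continuous_intros)
  qed (simp add: TS)
  have cR: "continuous_map euclideanreal (SU_top (Suc q)) R"
    unfolding R_def using q
    by (intro continuous_map_real_plane) (auto simp: cis_conv_exp intro!: continuous_intros)
  have law: "avg (T t * g * R t) = cis (\<mu> * t) * avg g"
    if g: "g \<in> SU (Suc q)" "\<And>i. i < Suc q \<Longrightarrow> g $$ (i, q) \<noteq> 0" and t: "t \<ge> 0" for g and t :: real
  proof -
    define \<gamma> where "\<gamma> = (\<lambda>t. T t * g * R t)"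
    have \<gamma>S: "\<gamma> t \<in> SU (Suc q)" for t unfolding \<gamma>_def by (intro SU_mult TS RS g)
    have c\<gamma>: "continuous_map euclideanreal (SU_top (Suc q)) \<gamma>"
      unfolding \<gamma>_def by (intro continuous_map_SU_mult cT cR continuous_map_SU_const g)
    have col: "\<gamma> t $$ (i, q) = cis (t * e i) * g $$ (i, q)" if i: "i < Suc q" for t i
    proof -
      have "\<gamma> t $$ (i, q) = cis (t * a) * (T t * g) $$ (i, q)"
        unfolding \<gamma>_def R_def
        using euler_E_last_col[of "Suc q" "T t * g" i "- (t * a)"] q i SU_carrier[OF SU_mult[OF TS g(1)]]
        by simp
      also have "(T t * g) $$ (i, q) = cis (t * (e i - a)) * g $$ (i, q)"
        unfolding T_def using mat_diag_mult_left[OF SU_carrier[OF g(1)]] i by simp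
      also have "cis (t * a) * (cis (t * (e i - a)) * g $$ (i, q)) = cis (t * a + t * (e i - a)) * g $$ (i, q)"
        by (simp only: cis_mult mult.assoc[symmetric])
      finally show ?thesis by (simp add: right_diff_distrib)
    qed
    \<comment> \<open>Dividing out the expected character turns the transformation law into
      constancy of H.\<close>
    define H where "H = (\<lambda>t::real. cis (- (of_int \<mu> * t)) * avg (\<gamma> t))"
    have "H t = H 0"
    proof (rule right_locally_constant[where H = H and a = 0 and b = t])
      show "0 \<le> t" by (rule t)
      show "continuous_on UNIV H"
        unfolding H_def cis_conv_exp
        by (intro continuous_intros avg_continuous_path c\<gamma>)
      fix x
      have "\<gamma> x $$ (i, q) \<noteq> 0" if "i < Suc q" for i using g(2)[OF that] by (simp add: col[OF that])
      then obtain \<phi> \<psi> w where box: "euler_box q \<phi> \<psi> w"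
        and cx: "\<And>i. i < Suc q \<Longrightarrow> \<gamma> x $$ (i, q) = cis (- w) * euler_V (Suc q) \<phi> \<psi> i"
        using column_box[OF \<gamma>S[of x]] by blast
      obtain \<epsilon> where \<epsilon>: "\<epsilon> > 0" and sh: "\<forall>\<delta>\<in>{0..<\<epsilon>::real}. \<exists>\<phi>' \<psi>' w'. euler_box q \<phi>' \<psi>' w' \<and>
        (\<forall>i<Suc q. cis (- w') * euler_V (Suc q) \<phi>' \<psi>' i = cis (\<delta> * e i) * (cis (- w) * euler_V (Suc q) \<phi> \<psi> i)) \<and>
        F \<phi>' \<psi>' w' = cis (\<mu> * \<delta>) * F \<phi> \<psi> w"
        using shift[OF box] by (elim exE conjE) (rule that)
      have ax: "avg (\<gamma> x) = c' * F \<phi> \<psi> w * I'" by (rule avg_eq[OF \<gamma>S box cx])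
      have "H (x + \<delta>) = H x" if \<delta>: "\<delta> \<in> {0..<\<epsilon>}" for \<delta>
      proof -
        obtain \<phi>' \<psi>' w' where box': "euler_box q \<phi>' \<psi>' w'"
          and V': "\<forall>i<Suc q. cis (- w') * euler_V (Suc q) \<phi>' \<psi>' i = cis (\<delta> * e i) * (cis (- w) * euler_V (Suc q) \<phi> \<psi> i)"
          and F': "F \<phi>' \<psi>' w' = cis (\<mu> * \<delta>) * F \<phi> \<psi> w"
          using bspec[OF sh \<delta>] by (elim exE conjE) (rule that)
        have "\<gamma> (x + \<delta>) $$ (i, q) = cis (- w') * euler_V (Suc q) \<phi>' \<psi>' i" if i: "i < Suc q" for i
        proof -
          have "\<gamma> (x + \<delta>) $$ (i, q) = cis (\<delta> * e i) * \<gamma> x $$ (i, q)"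
            unfolding col[OF i] mult.assoc[symmetric] cis_mult by (simp add: algebra_simps)
          then show ?thesis using cx[OF i] V' i by simp
        qed
        then have "avg (\<gamma> (x + \<delta>)) = c' * F \<phi>' \<psi>' w' * I'" by (rule avg_eq[OF \<gamma>S box'])
        also have "\<dots> = cis (\<mu> * \<delta>) * avg (\<gamma> x)"
          unfolding F' ax by (simp only: mult_ac)
        finally show ?thesis
          unfolding H_def by (simp only: mult.assoc[symmetric] cis_mult) (simp add: algebra_simps)
      qed
      then show "\<exists>\<epsilon>>0. \<forall>\<delta>\<in>{0..<\<epsilon>}. H (x + \<delta>) = H x" using \<epsilon> by blast
    qed
    moreover have "\<gamma> 0 = g"
    proof -
      have "T 0 = 1\<^sub>m (Suc q)" by (simp add: T_def)
      moreover have "R 0 = 1\<^sub>m (Suc q)"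
        unfolding R_def by (rule eq_matI) (auto simp: plane_index)
      ultimately show ?thesis using SU_carrier[OF g(1)] by (simp add: \<gamma>_def)
    qed
    ultimately have "cis (- (\<mu> * t)) * avg (\<gamma> t) = avg g" by (simp add: H_def)
    then have "cis (\<mu> * t) * (cis (- (\<mu> * t)) * avg (\<gamma> t)) = cis (\<mu> * t) * avg g" by simp
    then show ?thesis by (simp add: \<gamma>_def cis_mult flip: mult.assoc)
  qed
  \<comment> \<open>At this time the character takes the value -1, so the integral equals its own
    negative.\<close>
  define t where "t = pi / \<bar>real_of_int \<mu>\<bar>"
  have t: "t \<ge> 0" "cis (\<mu> * t) = - 1"
  proof -
    show "t \<ge> 0" by (simp add: t_def)
    have "\<mu> * t = pi \<or> \<mu> * t = - pi" using \<mu> by (auto simp: t_def abs_if)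
    then show "cis (\<mu> * t) = - 1" by (auto simp: complex_eq_iff)
  qed
  have am: "avg \<in> borel_measurable (borel_SU (Suc q))" using measurable_avg by (simp add: G.measurable_haar)
  have atm: "(\<lambda>g. avg (T t * g)) \<in> borel_measurable (borel_SU (Suc q))"
    by (rule measurable_compose[OF _ am], rule measurable_SU_mult) (auto simp: TS)
  have "(LINT g|M. avg g) = (LINT g|M. avg (T t * g))"
    by (rule G.integral_left[OF am TS, symmetric])
  also have "\<dots> = (LINT g|M. avg (T t * (g * R t)))"
    by (rule G.integral_right[OF atm RS, symmetric])
  also have "\<dots> = (LINT g|M. avg (T t * g * R t))"
    by (rule Bochner_Integration.integral_cong[OF refl]) (simp add: SU_mult_assoc[OF TS _ RS])
  also have "\<dots> = (LINT g|M. - avg g)"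
  proof (rule integral_cong_AE)
    show "AE g in M. avg (T t * g * R t) = - avg g"
    proof (rule AE_mp[OF G.AE_cols_nonzero])
      show "AE g in M. (\<forall>i<Suc q. g $$ (i, Suc q - 1) \<noteq> 0) \<longrightarrow> avg (T t * g * R t) = - avg g"
        using law[OF _ _ t(1)] t(2) by (intro AE_I2) simp
    qed (use q in simp)
    show "(\<lambda>g. avg (T t * g * R t)) \<in> borel_measurable M"
      unfolding G.measurable_haar
      by (rule measurable_compose[OF _ am], intro measurable_SU_mult measurable_const) (auto simp: TS RS)
  qed (use measurable_avg in measurable)
  finally show ?thesis by simp
qed

lemma integral_avg_zero_\<phi>:
  assumes j: "j \<in> {1..q}" and kj: "k j \<noteq> 0"
  shows "(LINT g|M. avg g) = 0"
proof (rule integral_avg_zero[OF kj, where e = "\<lambda>i. if i < j then 1 else if i = j then - 1 else 0"])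
  fix \<phi> \<psi> w assume box: "euler_box q \<phi> \<psi> w"
  show "\<exists>\<epsilon>>0. \<forall>\<delta>\<in>{0..<\<epsilon>::real}. \<exists>\<phi>' \<psi>' w'. euler_box q \<phi>' \<psi>' w' \<and>
      (\<forall>i<Suc q. cis (- w') * euler_V (Suc q) \<phi>' \<psi>' i = cis (\<delta> * (if i < j then 1 else if i = j then - 1 else 0))
         * (cis (- w) * euler_V (Suc q) \<phi> \<psi> i)) \<and> F \<phi>' \<psi>' w' = cis (of_int (k j) * \<delta>) * F \<phi> \<psi> w"
  \<comment> \<open>The room left above \<open>\<phi>\<^sub>j\<close> in its half-open interval; it
    is positive because pi itself is excluded.\<close>
  proof (intro exI[of _ "pi - \<phi> j"] conjI ballI)
    show "0 < pi - \<phi> j" using box j by (auto simp: euler_box_def)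
    fix \<delta> assume \<delta>: "\<delta> \<in> {0..<pi - \<phi> j}"
    let ?\<phi> = "\<phi>(j := \<phi> j + \<delta>)"
    have "euler_box q ?\<phi> \<psi> w" using box \<delta> j by (auto simp: euler_box_def)
    moreover have "cis (- w) * euler_V (Suc q) ?\<phi> \<psi> i = cis (\<delta> * (if i < j then 1 else if i = j then - 1 else 0))
         * (cis (- w) * euler_V (Suc q) \<phi> \<psi> i)" if "i < Suc q" for i
      using euler_V_shift[of j "Suc q" i \<phi> \<delta> \<psi>] j that by simp
    moreover have "F ?\<phi> \<psi> w = cis (of_int (k j) * \<delta>) * F \<phi> \<psi> w"
    proof -
      define P where "P = (\<lambda>\<phi> j. exp (\<i> * of_int (k j) * of_real (\<phi> j)) * complex_of_real (sin (\<psi> j) ^ m j * cos (\<psi> j) ^ n j))"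
      have "P ?\<phi> j = cis (of_int (k j) * \<delta>) * P \<phi> j"
        by (simp add: P_def cis_conv_exp exp_add distrib_left mult_ac)
      moreover have "(\<Prod>i\<in>{1..q} - {j}. P ?\<phi> i) = (\<Prod>i\<in>{1..q} - {j}. P \<phi> i)"
        by (rule prod.cong) (auto simp: P_def)
      moreover have "(\<Prod>i\<in>{1..q}. P \<phi> i) = P \<phi> j * (\<Prod>i\<in>{1..q} - {j}. P \<phi> i)" for \<phi>
        using j by (intro prod.remove) auto
      ultimately have "(\<Prod>i\<in>{1..q}. P ?\<phi> i) = cis (of_int (k j) * \<delta>) * (\<Prod>i\<in>{1..q}. P \<phi> i)"
        by (simp only: mult.assoc)
      then show ?thesis unfolding col_fun_def P_def by simp
    qed
    ultimately show "\<exists>\<phi>' \<psi>' w'. euler_box q \<phi>' \<psi>' w' \<and>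
      (\<forall>i<Suc q. cis (- w') * euler_V (Suc q) \<phi>' \<psi>' i = cis (\<delta> * (if i < j then 1 else if i = j then - 1 else 0))
         * (cis (- w) * euler_V (Suc q) \<phi> \<psi> i)) \<and> F \<phi>' \<psi>' w' = cis (of_int (k j) * \<delta>) * F \<phi> \<psi> w"
      by blast
  qed
qed

text \<open>All coordinates receive the same phase, so the exponents equal their mean, the left
  torus element is the identity, and the whole action takes place on the right.\<close>

lemma integral_avg_zero_\<omega>:
  assumes lq: "l q \<noteq> 0"
  shows "(LINT g|M. avg g) = 0"
proof (rule integral_avg_zero[OF lq, where e = "\<lambda>i. - 1"])
  fix \<phi> \<psi> w assume box: "euler_box q \<phi> \<psi> w"
  show "\<exists>\<epsilon>>0. \<forall>\<delta>\<in>{0..<\<epsilon>::real}. \<exists>\<phi>' \<psi>' w'. euler_box q \<phi>' \<psi>' w' \<and>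
      (\<forall>i<Suc q. cis (- w') * euler_V (Suc q) \<phi>' \<psi>' i = cis (\<delta> * - 1) * (cis (- w) * euler_V (Suc q) \<phi> \<psi> i)) \<and>
      F \<phi>' \<psi>' w' = cis (of_int (l q) * \<delta>) * F \<phi> \<psi> w"
  proof (intro exI[of _ "2 * pi - w"] conjI ballI)
    show "0 < 2 * pi - w" using box by (auto simp: euler_box_def)
    fix \<delta> assume \<delta>: "\<delta> \<in> {0..<2 * pi - w}"
    have "euler_box q \<phi> \<psi> (w + \<delta>)" using box \<delta> by (auto simp: euler_box_def)
    moreover have "cis (- (w + \<delta>)) * euler_V (Suc q) \<phi> \<psi> i = cis (\<delta> * - 1) * (cis (- w) * euler_V (Suc q) \<phi> \<psi> i)" for i
      unfolding mult.assoc[symmetric] cis_mult by (simp add: algebra_simps)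
    moreover have "F \<phi> \<psi> (w + \<delta>) = cis (of_int (l q) * \<delta>) * F \<phi> \<psi> w"
      unfolding col_fun_def by (simp add: cis_conv_exp exp_add algebra_simps)
    ultimately show "\<exists>\<phi>' \<psi>' w'. euler_box q \<phi>' \<psi>' w' \<and>
      (\<forall>i<Suc q. cis (- w') * euler_V (Suc q) \<phi>' \<psi>' i = cis (\<delta> * - 1) * (cis (- w) * euler_V (Suc q) \<phi> \<psi> i)) \<and>
      F \<phi>' \<psi>' w' = cis (of_int (l q) * \<delta>) * F \<phi> \<psi> w"
      by blast
  qed
qed

text \<open>sin^m cos^n as a function of s = sin^2. The real square root is continuous on the whole
  line, so this function satisfies the continuity hypothesis of
  \<open>integral_col_prod\<close>.\<close>

definition trig :: "nat \<Rightarrow> real \<Rightarrow> real" where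
  "trig j s = sqrt s ^ m j * sqrt (1 - s) ^ n j"

text \<open>Without phases the mean is a product of functions of the single quotients r_j / r_(j+1),
  whose joint law is given by \<open>integral_col_prod\<close>.\<close>

lemma integral_avg_radial:
  assumes k0: "\<And>j. j \<in> {1..q} \<Longrightarrow> k j = 0" and l0: "l q = 0"
  shows "(LINT g|M. avg g) = c' * I' * of_real (\<Prod>j\<in>{1..q}. beta_int j (trig j))"
proof -
  define s where "s = (\<lambda>j g. col_sum (Suc q) j g / col_sum (Suc q) (Suc j) g)"
  have q2: "2 \<le> Suc q" using q by simp
  have hc: "continuous_on UNIV (trig j)" for j
    unfolding trig_def by (intro continuous_intros)
  have hm: "trig j \<in> borel_measurable borel" for j by (rule borel_measurable_continuous_onI[OF hc])
  have "(LINT g|M. avg g) = (LINT g|M. c' * I' * of_real (\<Prod>j\<in>{1..<Suc q}. trig j (s j g)))"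
  proof (rule integral_cong_AE)
    show "AE g in M. avg g = c' * I' * of_real (\<Prod>j\<in>{1..<Suc q}. trig j (s j g))"
      using G.AE_cols_nonzero[OF q2] AE_space
    proof eventually_elim
      case (elim g)
      then have g: "g \<in> SU (Suc q)" by simp
      obtain \<phi> \<psi> w where box: "euler_box q \<phi> \<psi> w"
        and col: "\<And>i. i < Suc q \<Longrightarrow> g $$ (i, q) = cis (- w) * euler_V (Suc q) \<phi> \<psi> i"
        using column_box[OF g] elim by auto
      have sc: "sin (\<psi> j) > 0" "cos (\<psi> j) > 0" if "j \<in> {1..q}" for j
      proof -
        have "0 < \<psi> j" "\<psi> j < pi / 2" using box that by (simp_all add: euler_box_def)
        then show "sin (\<psi> j) > 0" "cos (\<psi> j) > 0" by (simp_all add: sin_gt_zero2 cos_gt_zero)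
      qed
      \<comment> \<open>The common phase of the column drops out of the moduli, which leaves
        \<open>euler_V_norm\<close>.\<close>
      have cs: "col_sum (Suc q) p g = (\<Prod>j\<in>{p..<Suc q}. (sin (\<psi> j))\<^sup>2)" if "1 \<le> p" "p \<le> Suc q" for p
        unfolding euler_V_norm[OF that, of \<phi> \<psi>, symmetric] col_sum_def
        using that col by (intro sum.cong) (auto simp: norm_mult)
      have sj: "s j g = (sin (\<psi> j))\<^sup>2" if j: "j \<in> {1..<Suc q}" for j
      proof -
        have c1: "col_sum (Suc q) j g = (\<Prod>i\<in>{j..<Suc q}. (sin (\<psi> i))\<^sup>2)"
          and c2: "col_sum (Suc q) (Suc j) g = (\<Prod>i\<in>{Suc j..<Suc q}. (sin (\<psi> i))\<^sup>2)"
          by (rule cs; use j in simp)+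
        have "col_sum (Suc q) j g = (sin (\<psi> j))\<^sup>2 * col_sum (Suc q) (Suc j) g"
          unfolding c1 c2 by (rule prod.atLeast_Suc_lessThan) (use j in simp)
        moreover have "col_sum (Suc q) (Suc j) g > 0"
          unfolding c2 by (intro prod_pos zero_less_power sc(1)) (use j in auto)
        ultimately show ?thesis by (simp add: s_def)
      qed
      have "trig j (s j g) = sin (\<psi> j) ^ m j * cos (\<psi> j) ^ n j" if j: "j \<in> {1..<Suc q}" for j
      proof -
        have "1 - (sin (\<psi> j))\<^sup>2 = (cos (\<psi> j))\<^sup>2" by (simp add: cos_squared_eq)
        then show ?thesis using sc[of j] j by (simp add: trig_def sj)
      qed
      then have "(\<Prod>j\<in>{1..q}. complex_of_real (trig j (s j g))) = (\<Prod>j\<in>{1..q}.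
          exp (\<i> * of_int (k j) * of_real (\<phi> j)) * of_real (sin (\<psi> j) ^ m j * cos (\<psi> j) ^ n j))"
        by (intro prod.cong refl) (simp add: k0)
      then have "complex_of_real (\<Prod>j\<in>{1..<Suc q}. trig j (s j g)) = F \<phi> \<psi> w"
        unfolding col_fun_def of_real_prod atLeastLessThanSuc_atLeastAtMost by (simp add: l0)
      then show ?case using avg_eq[OF g box col] by simp
    qed
    have "s j \<in> borel_measurable M" if "j < Suc q" for j
      unfolding s_def using that by (intro borel_measurable_divide G.measurable_col_sum) auto
    from measurable_compose[OF this hm]
    show "(\<lambda>g. c' * I' * complex_of_real (\<Prod>j\<in>{1..<Suc q}. trig j (s j g))) \<in> borel_measurable M"
      by (intro borel_measurable_times borel_measurable_const borel_measurable_of_real borel_measurable_prod) auto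
  qed (rule measurable_avg)
  also have "\<dots> = c' * I' * of_real (LINT g|M. (\<Prod>j\<in>{1..<Suc q}. trig j (s j g)))"
    by (simp del: of_real_prod)
  also have "(LINT g|M. (\<Prod>j\<in>{1..<Suc q}. trig j (s j g))) = (\<Prod>j\<in>{1..<Suc q}. beta_int j (trig j))"
    unfolding s_def using q by (intro G.integral_col_prod q2 hc) auto
  finally show ?thesis by (simp add: atLeastLessThanSuc_atLeastAtMost)
qed

end

section \<open>Comparison with the integral I and conclusion\<close>

lemma beta_int_trig:
  assumes "j \<ge> 1"
  shows "beta_int j (\<lambda>s. sqrt s ^ a * sqrt (1 - s) ^ b)
    = 2 * j * (LINT x:{0..1}|lborel. x ^ a * (1 - x\<^sup>2) powr (real b / 2) * x ^ (2 * j - 1))"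
proof -
  have "beta_int j (\<lambda>s. sqrt s ^ a * sqrt (1 - s) ^ b)
    = (LINT x:{0..1}|lborel. 2 * j * (x ^ a * (1 - x\<^sup>2) powr (real b / 2) * x ^ (2 * j - 1)))"
    unfolding beta_int_def set_lebesgue_integral_def
  proof (rule integral_cong_AE)
    \<comment> \<open>At x = 1 the two sides may differ for b = 0, since 0 powr 0 is 0 whereas 0 ^ 0
      is 1.\<close>
    have "AE x in lborel. x \<noteq> (1 :: real)" by (rule AE_lborel_singleton)
    then show "AE x::real in lborel. indicator {0..1} x *\<^sub>R (sqrt (x\<^sup>2) ^ a * sqrt (1 - x\<^sup>2) ^ b * (2 * real j * x ^ (2 * j - 1)))
      = indicator {0..1} x *\<^sub>R (2 * j * (x ^ a * (1 - x\<^sup>2) powr (real b / 2) * x ^ (2 * j - 1)))"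
    proof eventually_elim
      case (elim x)
      show ?case
      proof (cases "x \<in> {0..1}")
        case True
        then have "x\<^sup>2 < 1\<^sup>2" using elim by (intro power_strict_mono) auto
        then have pos: "1 - x\<^sup>2 > 0" by simp
        have "sqrt (1 - x\<^sup>2) ^ b = (1 - x\<^sup>2) powr (real b / 2)"
          using pos by (simp add: powr_half_sqrt[symmetric] powr_power)
        then show ?thesis using True by simp
      qed simp
    qed
  qed measurable
  then show ?thesis by simp
qed

lemma I_int_eq:
  fixes C :: complex
  shows "I_int (Suc q) C m n = 2 ^ q * C * of_real (\<Prod>j\<in>{1..q}.
    LINT x:{0..1}|lborel. x ^ m j * (1 - x\<^sup>2) powr (real (n j) / 2) * x ^ (2 * j - 1))"
proof -
  interpret product_sigma_finite "\<lambda>_ :: nat. lborel :: real measure" ..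
  \<comment> \<open>The indicator of the cube is distributed over the coordinates, so that the
    integrand becomes a product and Fubini applies.\<close>
  define t where "t = (\<lambda>j x. indicator {0..1} x * (x ^ m j * (1 - x\<^sup>2) powr (real (n j) / 2) * x ^ (2 * j - 1)) :: real)"
  have ti: "integrable lborel (t j)" for j
  proof -
    have "integrable lborel (indicator {0..1} :: real \<Rightarrow> real)"
      by (rule integrable_real_indicator) auto
    then show ?thesis
    proof (rule Bochner_Integration.integrable_bound)
      show "t j \<in> borel_measurable lborel" unfolding t_def by measurable
      show "AE x in lborel. norm (t j x) \<le> norm (indicator {0..1} x :: real)"
      proof (rule AE_I2)
        fix x :: real
        show "norm (t j x) \<le> norm (indicator {0..1} x :: real)"
        proof (cases "x \<in> {0..1}")
          case True
          then have "x\<^sup>2 \<le> 1" by (simp add: power_le_one)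
          then have p: "\<bar>(1 - x\<^sup>2) powr (real (n j) / 2)\<bar> \<le> 1"
            using powr_le1[of "real (n j) / 2" "1 - x\<^sup>2"] by simp
          have "\<bar>x ^ i\<bar> \<le> 1" for i using True by (auto simp: power_abs intro!: power_le_one)
          with p have "\<bar>x ^ m j * (1 - x\<^sup>2) powr (real (n j) / 2) * x ^ (2 * j - 1)\<bar> \<le> 1 * 1 * 1"
            unfolding abs_mult by (intro mult_mono mult_nonneg_nonneg) auto
          then show ?thesis using True by (simp add: t_def)
        qed (simp add: t_def)
      qed
    qed
  qed
  have "I_int (Suc q) C m n = (LINT x|(\<Pi>\<^sub>M j\<in>{1..q}. lborel). 2 ^ q * C * of_real (\<Prod>j\<in>{1..q}. t j (x j)))"
    unfolding I_int_def set_lebesgue_integral_def diff_Suc_1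
  proof (rule Bochner_Integration.integral_cong[OF refl])
    fix x assume "x \<in> space (\<Pi>\<^sub>M j\<in>{1..q}. (lborel :: real measure))"
    then have x: "x \<in> extensional {1..q}" by (auto simp: space_PiM PiE_def)
    show "indicat_real ({1..q} \<rightarrow>\<^sub>E {0..1}) x *\<^sub>R
        (complex_of_real (\<Prod>j = 1..q. x j ^ m j * (1 - (x j)\<^sup>2) powr (real (n j) / 2)) * J_tilde (Suc q) C x)
      = 2 ^ q * C * complex_of_real (\<Prod>j\<in>{1..q}. t j (x j))"
    proof (cases "x \<in> {1..q} \<rightarrow>\<^sub>E {0..1}")
      case True
      then have "t j (x j) = x j ^ m j * (1 - (x j)\<^sup>2) powr (real (n j) / 2) * x j ^ (2 * j - 1)" if "j \<in> {1..q}" for j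
        using that by (auto simp: t_def PiE_iff)
      then have "(\<Prod>j\<in>{1..q}. t j (x j)) = (\<Prod>j = 1..q. x j ^ m j * (1 - (x j)\<^sup>2) powr (real (n j) / 2)) * (\<Prod>j = 1..q. x j ^ (2 * j - 1))"
        by (simp add: prod.distrib)
      then show ?thesis using True by (simp add: J_tilde_def)
    next
      case False
      then obtain j where "j \<in> {1..q}" "x j \<notin> {0..1}" using x by (auto simp: PiE_iff)
      then have "j \<in> {1..q}" "t j (x j) = 0" by (simp_all add: t_def)
      then have "(\<Prod>j\<in>{1..q}. t j (x j)) = 0" by (intro prod_zero bexI[of _ j]) auto
      then show ?thesis using False by simp
    qed
  qed
  also have "\<dots> = 2 ^ q * C * of_real (LINT x|(\<Pi>\<^sub>M j\<in>{1..q}. lborel). (\<Prod>j\<in>{1..q}. t j (x j)))"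
    by (simp del: of_real_prod)
  also have "(LINT x|(\<Pi>\<^sub>M j\<in>{1..q}. lborel). (\<Prod>j\<in>{1..q}. t j (x j))) = (\<Prod>j\<in>{1..q}. integral\<^sup>L lborel (t j))"
    by (rule product_integral_prod) (use ti in auto)
  finally show ?thesis by (simp add: t_def set_lebesgue_integral_def)
qed

theorem lemma2p6:
  fixes N :: nat and M M' :: "complex mat measure"
  assumes "N \<ge> 2" and "haar_SU N M" and "haar_SU (N - 1) M'"
  shows "\<exists>K :: complex. \<forall>c k m n l f. euler_family N c k m n l f \<longrightarrow>
    (LINT g|M. f N g) =
      2 * of_real pi ^ N * c * (\<Prod>j\<in>{1..N - 1}. of_bool (k j = 0)) * of_bool (l (N - 1) = 0)
      * (LINT g|M'. f (N - 1) g) * I_int N (C_const N K c) m n"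
proof -
  obtain q where N: "N = Suc q" and q: "1 \<le> q" using assms(1) by (cases N) auto
  \<comment> \<open>The weights contribute the product of the 2 j, which is 2^q q!. The power of two
    is already in \<open>J_tilde\<close> and 2 pi^N is the explicit prefactor, so this remains; it
    depends on N only.\<close>
  define K where "K = complex_of_real (fact q / (2 * pi ^ N))"
  have "(LINT g|M. f N g) =
      2 * of_real pi ^ N * c * (\<Prod>j\<in>{1..N - 1}. of_bool (k j = 0)) * of_bool (l (N - 1) = 0)
      * (LINT g|M'. f (N - 1) g) * I_int N (C_const N K c) m n"
    if fam: "euler_family N c k m n l f" for c k m n l f
  proof -
    interpret euler_int q M M' c k m n l f
      by unfold_locales (use assms q fam in \<open>auto simp: N\<close>)
    show ?thesis
    proof (cases "(\<forall>j\<in>{1..q}. k j = 0) \<and> l q = 0")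
      case False
      then have "(LINT g|M. avg g) = 0" using integral_avg_zero_\<phi> integral_avg_zero_\<omega> by blast
      moreover have "(\<Prod>j\<in>{1..q}. of_bool (k j = 0)) * (of_bool (l q = 0) :: complex) = 0"
        using False by auto
      ultimately show ?thesis using integral_avg by (auto simp: N)
    next
      case True
      define P where "P = (\<Prod>j\<in>{1..q}. LINT x:{0..1}|lborel. x ^ m j * (1 - x\<^sup>2) powr (real (n j) / 2) * x ^ (2 * j - 1))"
      have "(\<Prod>j\<in>{1..q}. beta_int j (trig j)) = (\<Prod>j\<in>{1..q}. 2 * real j) * P"
        unfolding P_def prod.distrib[symmetric]
        by (rule prod.cong) (use beta_int_trig in \<open>auto simp: trig_def[abs_def]\<close>)
      also have "(\<Prod>j\<in>{1..q}. 2 * real j) = 2 ^ q * fact q"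
        by (simp add: prod.distrib fact_prod)
      finally have L: "(LINT g|M. f N g) = c' * I' * of_real (2 ^ q * fact q * P)"
        using integral_avg integral_avg_radial True by (simp add: N)
      have R: "I_int N (C_const N K c) m n = 2 ^ q * C_const N K c * of_real P"
        unfolding N P_def by (rule I_int_eq)
      have D: "(\<Prod>j\<in>{1..N - 1}. of_bool (k j = 0)) = (1 :: complex)" "of_bool (l (N - 1) = 0) = (1 :: complex)"
        using True by (auto simp: N)
      have KK: "2 * of_real pi ^ N * K = fact q" by (simp add: K_def)
      show ?thesis
      proof (cases "c = 0")
        case True
        \<comment> \<open>The bound |c| makes f vanish identically, and the explicit factor c
          annihilates the other side.\<close>
        have "(LINT g|M. f N g) = (LINT g|M. 0)"
          by (rule Bochner_Integration.integral_cong[OF refl]) (use bound_fN True in \<open>auto simp: N\<close>)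
        then show ?thesis using True by simp
      next
        case False
        define a where "a = c'"
        \<comment> \<open>Both conventions meet here: for N = 2 the explicit c is the one from f,
          for larger N it cancels against K / c because c already sits in the integral over SU(N -
          1).\<close>
        have cK: "c * C_const N K c = a * K" using False q by (auto simp: a_def C_const_def N)
        have "2 * of_real pi ^ N * c * 1 * 1 * I' * (2 ^ q * C_const N K c * of_real P)
          = 2 * of_real pi ^ N * (c * C_const N K c) * I' * 2 ^ q * of_real P"
          by (simp only: mult_1_left mult_1_right mult_ac)
        also have "\<dots> = (2 * of_real pi ^ N * K) * a * I' * 2 ^ q * of_real P"
          unfolding cK by (simp only: mult_ac)
        also have "\<dots> = a * I' * of_real (2 ^ q * fact q * P)" unfolding KK by simp
        finally have E: "2 * of_real pi ^ N * c * 1 * 1 * I' * (2 ^ q * C_const N K c * of_real P)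
          = a * I' * of_real (2 ^ q * fact q * P)" .
        have "N - 1 = q" by (simp add: N)
        then show ?thesis unfolding L R D using E[symmetric] by (simp only: a_def)
      qed
    qed
  qed
  then show ?thesis by blast
qed

end
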